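(* For a nonnegative integer $n$ let $\kappa_n=\sum_{1\le\ell<m\le n}s_{\ell m}\in\mathbb{C}S_n$, where $s_{\ell m}$ is the transposition switching $\ell$ and $m$. Let $Z_k\in\mathbb{C}A_k(n)$ and $Z_{k+\frac12}\in\mathbb{C}A_{k+\frac12}(n)$, $k\in\mathbb{Z}_{\ge0}$, be the elements of the partition algebras defined in the context. For a box $b$ in row $i$ and column $j$ of a partition let $c(b)=j-i$. (a) For $n\in\mathbb{Z}_{\ge0}$, $\kappa_n$ is a central element of $\mathbb{C}S_n$. If $\lambda$ is a partition with $n$ boxes and $S_n^\lambda$ is the irreducible $S_n$-module indexed by $\lambda$, then $\kappa_n=\sum_{b\in\lambda}c(b)$ as operators on $S_n^\lambda$. (b) Let $n,k\in\mathbb{Z}_{\ge0}$. Then, as operators on $V^{\otimes k}$, where $\dim V=n$, $$Z_k=\kappa_n-\binom n2+kn\qquad\text{and}\qquad Z_{k+\frac12}=\kappa_{n-1}-\binom n2+(k+1)n-1 .$$ (c) Let $n\in\mathbb{C}$ and $k\in\mathbb{Z}_{\ge0}$. Then $Z_k$ is a central element of $\mathbb{C}A_k(n)$, and, if $n$ is such that $\mathbb{C}A_k(n)$ is semisimple and $\lambda\vdash n$ with $|\lambda_{>1}|\le k$, then $$Z_k=kn-\binom n2+\sum_{b\in\lambda}c(b)\qquad\text{as operators on } A_k^\lambda,$$ where $A_k^\lambda$ is the irreducible $\mathbb{C}A_k(n)$-module indexed by $\lambda$. Furthermore, $Z_{k+\frac12}$ is a central element of $\mathbb{C}A_{k+\frac12}(n)$,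 and, if $n$ is such that $\mathbb{C}A_{k+\frac12}(n)$ is semisimple and $\lambda\vdash n-1$ is a partition with $|\lambda_{>1}|\le k$, then $$Z_{k+\frac12}=kn+n-1-\binom n2+\sum_{b\in\lambda}c(b)\qquad\text{as operators on } A_{k+\frac12}^\lambda,$$ where $A_{k+\frac12}^\lambda$ is the irreducible $\mathbb{C}A_{k+\frac12}(n)$-module indexed by $\lambda$.
   Context: Partition algebras. For an integer $k\ge0$, $A_k$ is the set of set partitions of $\{1,\ldots,k,1',\ldots,k'\}$, and $A_{k+\frac12}$ is the set of $d\in A_{k+1}$ in which $k+1$ and $(k+1)'$ are in the same block. $d_1\circ d_2$ is obtained by placing $d_1$ above $d_2$ (top row unprimed, bottom row primed), identifying bottom vertex $i'$ of $d_1$ with top vertex $i$ of $d_2$, and removing the connected components lying entirely in the middle row. For $n\in\mathbb{C}$ and $k\in\frac12\mathbb{Z}_{\ge0}$, $\mathbb{C}A_k(n)$ has basis $A_k$ and product $d_1d_2=n^\ell(d_1\circ d_2)$, $\ell$ being the number of components removed. For integers $k$, $\mathbb{C}A_k(n)\subseteq\mathbb{C}A_{k+\frac12}(n)$ by adding the block $\{k+1,(k+1)'\}$. Elements $Z_k$. For $S\subseteq\{1,\ldots,k\}$ let $S'=\{\ell':\ell\in S\}$, and for $I\subseteq S\cup S'$ let $I^c=(S\cup S')\setminus I$. Let $b_S\in A_k$ have blocks $S\cup S'$ and $\{\ell,\ell'\}$ for $\ell\notin S$, and let $d_I\in A_k$ have blocks $I$, $I^c$ and $\{\ell,\ell'\}$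 for $\ell\notin S$. Write $\mathrm{sg}(I)=(-1)^{\#\{\ell\in S:\{\ell,\ell'\}\subseteq I\}+\#\{\ell\in S:\{\ell,\ell'\}\subseteq I^c\}}$. Set $$p_S=\sum_I\tfrac12\,\mathrm{sg}(I)\,d_I,$$ the sum over $I\subseteq S\cup S'$ such that $I\ne\emptyset$, $I\ne S\cup S'$, $I\ne\{\ell,\ell'\}$ and $I\neq\{\ell,\ell'\}^c$ (for all $\ell\in S$). For $S\subseteq\{1,\ldots,k+1\}$ with $k+1\in S$ set (with $b_S,d_I$ now in $A_{k+1}$) $$\tilde p_S=\sum_I\tfrac12\,\mathrm{sg}(I)\,d_I,$$ the sum over all $I\subseteq S\cup S'$ such that $\{k+1,(k+1)'\}\subseteq I$ or $\{k+1,(k+1)'\}\subseteq I^c$, and $I\ne\emptyset$, $I\ne S\cup S'$, $I\ne\{k+1,(k+1)'\}$, $I\ne\{k+1,(k+1)'\}^c$. Then $Z_0=1$, $Z_{\frac12}=1$, and for $k\in\mathbb{Z}_{\ge1}$ $$Z_k=\binom k2+\sum_{S\subseteq\{1,\ldots,k\},\,|S|\ge1}p_S+\sum_{S\subseteq\{1,\ldots,k\},\,|S|\ge2}(n-k+|S|)(-1)^{|S|}b_S,$$ $$Z_{k+\frac12}=k+Z_k+\sum_{S\subseteq\{1,\ldots,k+1\},\,k+1\in S,\,|S|\ge2}\Big(\tilde p_S+(n-(k+1)+|S|)(-1)^{|S|}b_S\Big).$$ Actions on tensor space. $V$ has basis $v_1,\ldots,v_n$; $S_n$ acts by $\sigma(v_{i_1}\otimes\cdots\otimes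 v_{i_k})=v_{\sigma(i_1)}\otimes\cdots\otimes v_{\sigma(i_k)}$, and $S_{n-1}$ is the stabilizer of $n$. A diagram $d\in A_k$ sends $v_{i_1}\otimes\cdots\otimes v_{i_k}$ to the sum of $v_{i_{1'}}\otimes\cdots\otimes v_{i_{k'}}$ over all $i_{1'},\ldots,i_{k'}\in\{1,\ldots,n\}$ such that $i_r=i_s$ whenever $r,s$ are in the same block of $d$. $\mathbb{C}A_{k+\frac12}(n)$ acts on $V^{\otimes k}\cong V^{\otimes k}\otimes v_n\subseteq V^{\otimes(k+1)}$ by restriction of the action of $\mathbb{C}A_{k+1}(n)$. Indexing of irreducibles. For $\lambda=(\lambda_1,\lambda_2,\ldots)$ let $\lambda_{>1}=(\lambda_2,\lambda_3,\ldots)$, and write $\lambda\vdash n$ if $\lambda$ is a partition with $n$ boxes. For $\lambda\vdash n$ with $|\lambda_{>1}|\le k$, the irreducible $\mathbb{C}A_k(n)$-module $A_k^\lambda$ is the multiplicity space of $S_n^\lambda$ in $V^{\otimes k}$, i.e. $V^{\otimes k}\cong\bigoplus_\lambda S_n^\lambda\otimes A_k^\lambda$ as $(\mathbb{C}S_n,\mathbb{C}A_k(n))$-bimodules. For $\lambda\vdash n-1$ with $|\lambda_{>1}|\le k$, the irreducible $\mathbb{C}A_{k+\frac12}(n)$-module $A_{k+\frac12}^\lambda$ is the multiplicity space of $S_{n-1}^\lambda$ in $V^{\otimes k}$, i.e. $V^{\otimes k}\cong\bigoplus_\lambda S_{n-1}^\lambda\otimes A_{k+\frac12}^\lambda$ as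 $(\mathbb{C}S_{n-1},\mathbb{C}A_{k+\frac12}(n))$-bimodules.
   Formalization: Z_0 and Z_{1/2} are taken as 0, not 1 (with 1, (b) fails at k=0); in p̃_S the excluded I are {l,l'} and complements for l in S, l≠k+1, not {k+1,(k+1)'} and its complement (as printed, (b) fails for all k≥2); the second formula in (b) is for n≥1. *)

theory Defs
  imports
    Complex_Main
    "HOL-Library.Function_Algebras"
    "HOL-Library.FuncSet"
    "HOL-Library.Disjoint_Sets"
    "HOL-Combinatorics.Permutations"
begin

section \<open>Algebras and modules with a finite basis\<close>

text \<open>
  A complex vector space with finite basis \<open>B\<close> is represented by the functions
  that vanish outside \<open>B\<close>.  Addition of functions is the pointwise one of
  \<open>Function_Algebras\<close>; its pointwise multiplication is never used.
\<close>

definition cscale :: "complex \<Rightarrow> ('b \<Rightarrow> complex) \<Rightarrow> 'b \<Rightarrow> complex"  (infixr \<open>*c\<close> 75)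
  where "c *c f = (\<lambda>x. c * f x)"

global_interpretation cfun: vector_space cscale
  by unfold_locales (auto simp: cscale_def fun_eq_iff algebra_simps)

definition free_space :: "'b set \<Rightarrow> ('b \<Rightarrow> complex) set"
  where "free_space B = {f. \<forall>b. b \<notin> B \<longrightarrow> f b = 0}"

definition basis :: "'b \<Rightarrow> 'b \<Rightarrow> complex"
  where "basis b = (\<lambda>x. if x = b then 1 else 0)"

text \<open>
  The bilinear product on \<open>free_space B\<close> in which the product of the basis
  elements \<open>a\<close> and \<open>b\<close> is \<open>w a b\<close> times the basis element \<open>p a b\<close>.
\<close>

definition bilinear_prod ::
    "'b set \<Rightarrow> ('b \<Rightarrow> 'b \<Rightarrow> 'b) \<Rightarrow> ('b \<Rightarrow> 'b \<Rightarrow> complex) \<Rightarrow>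
     ('b \<Rightarrow> complex) \<Rightarrow> ('b \<Rightarrow> complex) \<Rightarrow> 'b \<Rightarrow> complex"
  where "bilinear_prod B p w x y =
    (\<Sum>a\<in>B. \<Sum>b\<in>B. (x a * y b * w a b) *c basis (p a b))"

definition center :: "'a set \<Rightarrow> ('a \<Rightarrow> 'a \<Rightarrow> 'a) \<Rightarrow> 'a set"
  where "center A m = {z \<in> A. \<forall>x\<in>A. m z x = m x z}"

definition left_ideal ::
    "('b \<Rightarrow> complex) set \<Rightarrow> (('b \<Rightarrow> complex) \<Rightarrow> ('b \<Rightarrow> complex) \<Rightarrow> 'b \<Rightarrow> complex) \<Rightarrow>
     ('b \<Rightarrow> complex) set \<Rightarrow> bool"
  where "left_ideal A m L \<longleftrightarrow>
    L \<subseteq> A \<and> cfun.subspace L \<and> (\<forall>x\<in>A. \<forall>y\<in>L. m x y \<in> L)"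

text \<open>An algebra is semisimple if its regular module is completely reducible.\<close>

definition semisimple_algebra ::
    "('b \<Rightarrow> complex) set \<Rightarrow> (('b \<Rightarrow> complex) \<Rightarrow> ('b \<Rightarrow> complex) \<Rightarrow> 'b \<Rightarrow> complex) \<Rightarrow> bool"
  where "semisimple_algebra A m \<longleftrightarrow>
    (\<forall>L. left_ideal A m L \<longrightarrow>
      (\<exists>L'. left_ideal A m L' \<and> L \<inter> L' = {0} \<and>
            A = {x + y | x y. x \<in> L \<and> y \<in> L'}))"

section \<open>The group algebra of the symmetric group\<close>

definition symm :: "nat \<Rightarrow> (nat \<Rightarrow> nat) set"
  where "symm n = {\<sigma>. \<sigma> permutes {1..n}}"

definition symm_alg :: "nat \<Rightarrow> ((nat \<Rightarrow> nat) \<Rightarrow> complex) set"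
  where "symm_alg n = free_space (symm n)"

definition symm_mult ::
    "nat \<Rightarrow> ((nat \<Rightarrow> nat) \<Rightarrow> complex) \<Rightarrow> ((nat \<Rightarrow> nat) \<Rightarrow> complex) \<Rightarrow> (nat \<Rightarrow> nat) \<Rightarrow> complex"
  where "symm_mult n = bilinear_prod (symm n) (\<circ>) (\<lambda>_ _. 1)"

definition kappa :: "nat \<Rightarrow> (nat \<Rightarrow> nat) \<Rightarrow> complex"
  where "kappa n = (\<Sum>(l, m) \<in> {(l, m). 1 \<le> l \<and> l < m \<and> m \<le> n}. basis (transpose l m))"

text \<open>
  The action of the group algebra on \<open>free_space B\<close> that extends linearly an action
  \<open>act\<close> of the permutations on the basis \<open>B\<close>.
\<close>

definition symm_act ::
    "nat \<Rightarrow> 'b set \<Rightarrow> ((nat \<Rightarrow> nat) \<Rightarrow> 'b \<Rightarrow> 'b) \<Rightarrow>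
     ((nat \<Rightarrow> nat) \<Rightarrow> complex) \<Rightarrow> ('b \<Rightarrow> complex) \<Rightarrow> 'b \<Rightarrow> complex"
  where "symm_act n B act x f =
    (\<Sum>\<sigma>\<in>symm n. \<Sum>b\<in>B. (x \<sigma> * f b) *c basis (act \<sigma> b))"

section \<open>Partitions and Specht modules\<close>

text \<open>A partition is the weakly decreasing list of its nonzero parts.\<close>

definition is_partition :: "nat list \<Rightarrow> nat \<Rightarrow> bool"
  where "is_partition \<mu> n \<longleftrightarrow> sorted_wrt (\<ge>) \<mu> \<and> 0 \<notin> set \<mu> \<and> sum_list \<mu> = n"

definition boxes :: "nat list \<Rightarrow> (nat \<times> nat) set"
  where "boxes \<mu> = {(i, j). 1 \<le> i \<and> i \<le> length \<mu> \<and> 1 \<le> j \<and> j \<le> \<mu> ! (i - 1)}"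

definition content :: "nat \<times> nat \<Rightarrow> complex"
  where "content b = of_nat (snd b) - of_nat (fst b)"

text \<open>
  Only the values of a tableau on \<open>boxes \<mu>\<close> matter below.  The tabloid of a
  tableau is the sequence of the sets of entries of its rows.
\<close>

definition tableaux :: "nat list \<Rightarrow> (nat \<times> nat \<Rightarrow> nat) set"
  where "tableaux \<mu> = {t. bij_betw t (boxes \<mu>) {1..sum_list \<mu>}}"

definition tabloid :: "nat list \<Rightarrow> (nat \<times> nat \<Rightarrow> nat) \<Rightarrow> nat \<Rightarrow> nat set"
  where "tabloid \<mu> t = (\<lambda>i. t ` {b \<in> boxes \<mu>. fst b = i})"

definition tabloids :: "nat list \<Rightarrow> (nat \<Rightarrow> nat set) set"
  where "tabloids \<mu> = tabloid \<mu> ` tableaux \<mu>"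

definition column_stabilizer :: "nat list \<Rightarrow> (nat \<times> nat \<Rightarrow> nat) \<Rightarrow> (nat \<Rightarrow> nat) set"
  where "column_stabilizer \<mu> t =
    {\<sigma> \<in> symm (sum_list \<mu>).
       \<forall>b\<in>boxes \<mu>. \<exists>b'\<in>boxes \<mu>. snd b' = snd b \<and> \<sigma> (t b) = t b'}"

definition polytabloid ::
    "nat list \<Rightarrow> (nat \<times> nat \<Rightarrow> nat) \<Rightarrow> (nat \<Rightarrow> nat set) \<Rightarrow> complex"
  where "polytabloid \<mu> t =
    (\<Sum>\<sigma>\<in>column_stabilizer \<mu> t. of_int (sign \<sigma>) *c basis (tabloid \<mu> (\<sigma> \<circ> t)))"

definition specht :: "nat list \<Rightarrow> ((nat \<Rightarrow> nat set) \<Rightarrow> complex) set"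
  where "specht \<mu> = cfun.span (polytabloid \<mu> ` tableaux \<mu>)"

definition specht_act ::
    "nat list \<Rightarrow> ((nat \<Rightarrow> nat) \<Rightarrow> complex) \<Rightarrow>
     ((nat \<Rightarrow> nat set) \<Rightarrow> complex) \<Rightarrow> (nat \<Rightarrow> nat set) \<Rightarrow> complex"
  where "specht_act \<mu> = symm_act (sum_list \<mu>) (tabloids \<mu>) (\<lambda>\<sigma> T i. \<sigma> ` T i)"

section \<open>Partition algebras\<close>

text \<open>
  \<open>Top i\<close> is the vertex \<open>i\<close> and \<open>Bot i\<close> the vertex \<open>i'\<close>.  The vertices \<open>Mid i\<close>
  occur only in the stacking of two diagrams.
\<close>

datatype vertex = Top nat | Mid nat | Bot nat

type_synonym diagram = "vertex set set"

definition dbl :: "nat set \<Rightarrow> vertex set"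
  where "dbl S = Top ` S \<union> Bot ` S"

definition diagrams :: "nat \<Rightarrow> diagram set"
  where "diagrams k = {d. partition_on (dbl {1..k}) d}"

text \<open>The half-integer case: \<open>half_diagrams k\<close> is the set of diagrams for \<open>k + 1/2\<close>.\<close>

definition half_diagrams :: "nat \<Rightarrow> diagram set"
  where "half_diagrams k =
    {d \<in> diagrams (k + 1). \<exists>B\<in>d. Top (k + 1) \<in> B \<and> Bot (k + 1) \<in> B}"

fun bot_to_mid :: "vertex \<Rightarrow> vertex" where
  "bot_to_mid (Bot i) = Mid i"
| "bot_to_mid v = v"

fun top_to_mid :: "vertex \<Rightarrow> vertex" where
  "top_to_mid (Top i) = Mid i"
| "top_to_mid v = v"

definition stack_components :: "nat \<Rightarrow> diagram \<Rightarrow> diagram \<Rightarrow> vertex set set"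
  where "stack_components k d1 d2 =
    (dbl {1..k} \<union> Mid ` {1..k}) //
    (\<Union>B \<in> (`) bot_to_mid ` d1 \<union> (`) top_to_mid ` d2. B \<times> B)\<^sup>*"

definition diagram_comp :: "nat \<Rightarrow> diagram \<Rightarrow> diagram \<Rightarrow> diagram"
  where "diagram_comp k d1 d2 =
    {C - range Mid | C. C \<in> stack_components k d1 d2 \<and> \<not> C \<subseteq> range Mid}"

definition removed :: "nat \<Rightarrow> diagram \<Rightarrow> diagram \<Rightarrow> nat"
  where "removed k d1 d2 = card {C \<in> stack_components k d1 d2. C \<subseteq> range Mid}"

definition part_alg :: "nat \<Rightarrow> (diagram \<Rightarrow> complex) set"
  where "part_alg k = free_space (diagrams k)"

definition part_mult ::
    "complex \<Rightarrow> nat \<Rightarrow> (diagram \<Rightarrow> complex) \<Rightarrow> (diagram \<Rightarrow> complex) \<Rightarrow> diagram \<Rightarrow> complex"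
  where "part_mult n k =
    bilinear_prod (diagrams k) (diagram_comp k) (\<lambda>d1 d2. n ^ removed k d1 d2)"

definition half_part_alg :: "nat \<Rightarrow> (diagram \<Rightarrow> complex) set"
  where "half_part_alg k = free_space (half_diagrams k)"

definition half_part_mult ::
    "complex \<Rightarrow> nat \<Rightarrow> (diagram \<Rightarrow> complex) \<Rightarrow> (diagram \<Rightarrow> complex) \<Rightarrow> diagram \<Rightarrow> complex"
  where "half_part_mult n k =
    bilinear_prod (half_diagrams k) (diagram_comp (k + 1)) (\<lambda>d1 d2. n ^ removed (k + 1) d1 d2)"

subsection \<open>The central elements\<close>

definition vertical :: "nat \<Rightarrow> nat set \<Rightarrow> diagram"
  where "vertical k S = {{Top l, Bot l} | l. l \<in> {1..k} - S}"

definition part_one :: "nat \<Rightarrow> diagram \<Rightarrow> complex"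
  where "part_one k = basis (vertical k {})"

definition add_strand :: "nat \<Rightarrow> (diagram \<Rightarrow> complex) \<Rightarrow> diagram \<Rightarrow> complex"
  where "add_strand k x =
    (\<Sum>d\<in>diagrams k. x d *c basis (insert {Top (k + 1), Bot (k + 1)} d))"

definition b_diag :: "nat \<Rightarrow> nat set \<Rightarrow> diagram"
  where "b_diag k S = insert (dbl S) (vertical k S)"

definition d_diag :: "nat \<Rightarrow> nat set \<Rightarrow> vertex set \<Rightarrow> diagram"
  where "d_diag k S I = {I, dbl S - I} \<union> vertical k S"

definition sg :: "nat set \<Rightarrow> vertex set \<Rightarrow> complex"
  where "sg S I =
    (-1) ^ (card {l \<in> S. {Top l, Bot l} \<subseteq> I} + card {l \<in> S. {Top l, Bot l} \<subseteq> dbl S - I})"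

definition p_elem :: "nat \<Rightarrow> nat set \<Rightarrow> diagram \<Rightarrow> complex"
  where "p_elem k S =
    (\<Sum>I \<in> {I. I \<subseteq> dbl S \<and> I \<noteq> {} \<and> I \<noteq> dbl S \<and>
              (\<forall>l\<in>S. I \<noteq> {Top l, Bot l} \<and> I \<noteq> dbl S - {Top l, Bot l})}.
       (1/2 * sg S I) *c basis (d_diag k S I))"

text \<open>
  The summation range of \<open>p_tilde k S\<close> (with \<open>k + 1 \<in> S\<close>) corrects a misprint.  Halverson
  and Ram exclude \<open>I = {Top (k+1), Bot (k+1)}\<close> and its complement, instead of
  \<open>I = {Top l, Bot l}\<close> and its complement for the \<open>l \<in> S\<close> other than \<open>k + 1\<close>.  The two
  ranges agree if \<open>S\<close> has two elements, that is for every \<open>S\<close> used when \<open>k = 1\<close>.  From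
  \<open>k = 2\<close> on, the printed range does not give the operator
  \<open>\<kappa>\<^bsub>n-1\<^esub> - (n choose 2) + (k + 1) n - 1\<close> on tensor space.  For \<open>k = 2\<close>, \<open>n = 1\<close> all
  diagrams act as \<open>1\<close>; the element then acts as \<open>1\<close> instead of \<open>2\<close>.
\<close>

definition p_tilde :: "nat \<Rightarrow> nat set \<Rightarrow> diagram \<Rightarrow> complex"
  where "p_tilde k S =
    (\<Sum>I \<in> {I. I \<subseteq> dbl S \<and>
              ({Top (k + 1), Bot (k + 1)} \<subseteq> I \<or> {Top (k + 1), Bot (k + 1)} \<subseteq> dbl S - I) \<and>
              I \<noteq> {} \<and> I \<noteq> dbl S \<and>
              (\<forall>l\<in>S - {k + 1}. I \<noteq> {Top l, Bot l} \<and> I \<noteq> dbl S - {Top l, Bot l})}.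
       (1/2 * sg S I) *c basis (d_diag (k + 1) S I))"

text \<open>
  The formulas for \<open>k \<ge> 1\<close> are used for \<open>k = 0\<close> too, where they give \<open>0\<close> for both
  elements.  Halverson and Ram set both to \<open>1\<close> for \<open>k = 0\<close>; but
  \<open>\<kappa>\<^sub>n - (n choose 2)\<close> and \<open>\<kappa>\<^bsub>n-1\<^esub> - (n choose 2) + n - 1\<close> act as \<open>0\<close> on the zeroth
  tensor power, which is the trivial module.
\<close>

definition Z :: "nat \<Rightarrow> complex \<Rightarrow> diagram \<Rightarrow> complex"
  where "Z k n =
    of_nat (k choose 2) *c part_one k
    + (\<Sum>S \<in> {S. S \<subseteq> {1..k} \<and> 1 \<le> card S}. p_elem k S)
    + (\<Sum>S \<in> {S. S \<subseteq> {1..k} \<and> 2 \<le> card S}.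
         ((n - of_nat k + of_nat (card S)) * (-1) ^ card S) *c basis (b_diag k S))"

definition Z_half :: "nat \<Rightarrow> complex \<Rightarrow> diagram \<Rightarrow> complex"
  where "Z_half k n =
    of_nat k *c part_one (k + 1) + add_strand k (Z k n)
    + (\<Sum>S \<in> {S. S \<subseteq> {1..k + 1} \<and> k + 1 \<in> S \<and> 2 \<le> card S}.
         p_tilde k S
         + ((n - of_nat (k + 1) + of_nat (card S)) * (-1) ^ card S) *c basis (b_diag (k + 1) S))"

section \<open>Tensor space\<close>

text \<open>
  The word \<open>[i\<^sub>1, \<dots>, i\<^sub>k]\<close> stands for the basis tensor
  \<open>v\<^bsub>i\<^sub>1\<^esub> \<otimes> \<dots> \<otimes> v\<^bsub>i\<^sub>k\<^esub>\<close>, where \<open>n\<close> is the dimension of \<open>V\<close>.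
\<close>

definition words :: "nat \<Rightarrow> nat \<Rightarrow> nat list set"
  where "words n k = {w. length w = k \<and> set w \<subseteq> {1..n}}"

definition tensor :: "nat \<Rightarrow> nat \<Rightarrow> (nat list \<Rightarrow> complex) set"
  where "tensor n k = free_space (words n k)"

text \<open>
  The action of the group algebra of \<open>symm r\<close>, where \<open>r = n\<close>, or \<open>r = n - 1\<close> for the
  stabilizer of \<open>n\<close>.
\<close>

definition tensor_act ::
    "nat \<Rightarrow> nat \<Rightarrow> nat \<Rightarrow> ((nat \<Rightarrow> nat) \<Rightarrow> complex) \<Rightarrow> (nat list \<Rightarrow> complex) \<Rightarrow> nat list \<Rightarrow> complex"
  where "tensor_act r n k = symm_act r (words n k) map"

fun label :: "nat list \<Rightarrow> nat list \<Rightarrow> vertex \<Rightarrow> nat" where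
  "label w w' (Top i) = w ! (i - 1)"
| "label w w' (Bot i) = w' ! (i - 1)"
| "label w w' (Mid i) = 0"

definition compatible :: "diagram \<Rightarrow> nat list \<Rightarrow> nat list \<Rightarrow> bool"
  where "compatible d w w' \<longleftrightarrow> (\<forall>B\<in>d. \<forall>r\<in>B. \<forall>s\<in>B. label w w' r = label w w' s)"

text \<open>
  Diagrams map tensors on their top row to tensors on their bottom row, so this is a
  right action.
\<close>

definition diag_act ::
    "nat \<Rightarrow> nat \<Rightarrow> (nat list \<Rightarrow> complex) \<Rightarrow> (diagram \<Rightarrow> complex) \<Rightarrow> nat list \<Rightarrow> complex"
  where "diag_act n k f x =
    (\<Sum>w\<in>words n k. \<Sum>d\<in>diagrams k. \<Sum>w'\<in>{w' \<in> words n k. compatible d w w'}.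
       (f w * x d) *c basis w')"

definition tensor_last :: "nat \<Rightarrow> nat \<Rightarrow> (nat list \<Rightarrow> complex) \<Rightarrow> nat list \<Rightarrow> complex"
  where "tensor_last n k f = (\<Sum>w\<in>words n k. f w *c basis (w @ [n]))"

text \<open>
  \<open>half_diag_act n k f x\<close> is the tensor \<open>g\<close> for which \<open>g \<otimes> v\<^sub>n\<close> is the image of
  \<open>f \<otimes> v\<^sub>n\<close> under \<open>x\<close>; see \<open>tensor_last_half_diag_act\<close>.
\<close>

definition half_diag_act ::
    "nat \<Rightarrow> nat \<Rightarrow> (nat list \<Rightarrow> complex) \<Rightarrow> (diagram \<Rightarrow> complex) \<Rightarrow> nat list \<Rightarrow> complex"
  where "half_diag_act n k f x =
    (\<lambda>w. diag_act n (k + 1) (tensor_last n k f) x (w @ [n]))"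

lemma sum_fun_apply: "(\<Sum>a\<in>A. f a) x = (\<Sum>a\<in>A. f a x)"
  by (induction A rule: infinite_finite_induct) auto

lemma finite_words: "finite (words n k)"
  using finite_lists_length_eq[of "{1..n}" k] by (simp add: words_def conj_commute)

lemma diag_act_apply:
  "diag_act n k f x u =
    (\<Sum>w\<in>words n k. \<Sum>d\<in>diagrams k. if u \<in> words n k \<and> compatible d w u then f w * x d else 0)"
proof -
  have "(\<Sum>w'\<in>{w' \<in> words n k. compatible d w w'}. ((f w * x d) *c basis w') u) =
      (if u \<in> words n k \<and> compatible d w u then f w * x d else 0)" for w d
  proof -
    have "(\<Sum>w'\<in>{w' \<in> words n k. compatible d w w'}. ((f w * x d) *c basis w') u) =
        (\<Sum>w'\<in>{w' \<in> words n k. compatible d w w'}. if u = w' then f w * x d else 0)"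
      by (rule sum.cong[OF refl]) (simp add: cscale_def basis_def)
    then show ?thesis
      by (simp add: finite_words sum.delta')
  qed
  then show ?thesis
    by (simp add: diag_act_def sum_fun_apply)
qed

lemma tensor_last_apply:
  "tensor_last n k f u = (if u \<in> (\<lambda>w. w @ [n]) ` words n k then f (butlast u) else 0)"
proof (cases "u \<in> (\<lambda>w. w @ [n]) ` words n k")
  case True
  then obtain v where v: "v \<in> words n k" "u = v @ [n]"
    by blast
  have "tensor_last n k f u = (\<Sum>w\<in>words n k. if v = w then f w else 0)"
    unfolding tensor_last_def sum_fun_apply
    by (rule sum.cong[OF refl]) (simp add: cscale_def basis_def v)
  with v True show ?thesis
    by (simp add: finite_words sum.delta')
next
  case False
  have "tensor_last n k f u = (\<Sum>w\<in>words n k. 0)"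
    unfolding tensor_last_def sum_fun_apply
  proof (rule sum.cong[OF refl])
    fix w assume "w \<in> words n k"
    with False have "u \<noteq> w @ [n]"
      by blast
    then show "(f w *c basis (w @ [n])) u = 0"
      by (simp add: cscale_def basis_def)
  qed
  with False show ?thesis
    by simp
qed

lemma tensor_last_half_diag_act:
  assumes "1 \<le> n" and x: "x \<in> half_part_alg k"
  shows "tensor_last n k (half_diag_act n k f x) = diag_act n (k + 1) (tensor_last n k f) x"
proof
  fix u
  show "tensor_last n k (half_diag_act n k f x) u = diag_act n (k + 1) (tensor_last n k f) x u"
  proof (cases "u \<in> (\<lambda>w. w @ [n]) ` words n k")
    case True
    then show ?thesis by (auto simp: tensor_last_apply half_diag_act_def)
  next
    case False
    have "(if u \<in> words n (k + 1) \<and> compatible d w u then tensor_last n k f w * x d else 0) = 0"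
      for w d
    proof (rule ccontr)
      assume *: "\<not> ?thesis"
      then have u: "u \<in> words n (k + 1)" and c: "compatible d w u"
        and w: "tensor_last n k f w \<noteq> 0" and d: "x d \<noteq> 0"
        by (auto split: if_splits)
      from w obtain w0 where w0: "w0 \<in> words n k" "w = w0 @ [n]"
        by (auto simp: tensor_last_apply split: if_splits)
      from d x have "d \<in> half_diagrams k"
        by (auto simp: half_part_alg_def free_space_def)
      then obtain B where "B \<in> d" "Top (k + 1) \<in> B" "Bot (k + 1) \<in> B"
        by (auto simp: half_diagrams_def)
      with c have "label w u (Top (k + 1)) = label w u (Bot (k + 1))"
        unfolding compatible_def by blast
      with w0 have un: "u ! k = n"
        by (simp add: words_def nth_append)
      have len: "length u = k + 1"
        using u by (auto simp: words_def)
      have ne: "u \<noteq> []"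
        using len by auto
      have "last u = n"
        using ne un len by (simp add: last_conv_nth)
      with ne have eq: "u = butlast u @ [n]"
        using append_butlast_last_id by metis
      have "butlast u \<in> words n k"
        using u by (auto simp: words_def dest: in_set_butlastD)
      then have "u \<in> (\<lambda>w. w @ [n]) ` words n k"
        by (rule image_eqI[rotated]) (rule eq)
      with False show False by blast
    qed
    then show ?thesis
      using False by (simp add: tensor_last_apply diag_act_apply)
  qed
qed

section \<open>Irreducible modules of the partition algebras\<close>

text \<open>
  The multiplicity space of the Specht module of \<open>\<mu>\<close> in the \<open>k\<close>-th tensor power is the
  space of \<open>symm (sum_list \<mu>)\<close>-linear maps between them, a right module by
  postcomposition.  For \<open>\<mu>\<close> of size \<open>n\<close> this is the module \<open>A\<^sub>k\<^sup>\<mu>\<close>, and for \<open>\<mu>\<close> of size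
  \<open>n - 1\<close> the module indexed by \<open>\<mu>\<close> in the half-integer case.
\<close>

definition mult_space ::
    "nat \<Rightarrow> nat \<Rightarrow> nat list \<Rightarrow> (((nat \<Rightarrow> nat set) \<Rightarrow> complex) \<Rightarrow> nat list \<Rightarrow> complex) set"
  where "mult_space n k \<mu> =
    {\<phi> \<in> specht \<mu> \<rightarrow>\<^sub>E tensor n k.
       (\<forall>s\<in>specht \<mu>. \<forall>t\<in>specht \<mu>. \<phi> (s + t) = \<phi> s + \<phi> t) \<and>
       (\<forall>c. \<forall>s\<in>specht \<mu>. \<phi> (c *c s) = c *c \<phi> s) \<and>
       (\<forall>x\<in>symm_alg (sum_list \<mu>). \<forall>s\<in>specht \<mu>.
          \<phi> (specht_act \<mu> x s) = tensor_act (sum_list \<mu>) n k x (\<phi> s))}"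

definition mult_space_act ::
    "nat \<Rightarrow> nat \<Rightarrow> nat list \<Rightarrow> (((nat \<Rightarrow> nat set) \<Rightarrow> complex) \<Rightarrow> nat list \<Rightarrow> complex) \<Rightarrow>
     (diagram \<Rightarrow> complex) \<Rightarrow> ((nat \<Rightarrow> nat set) \<Rightarrow> complex) \<Rightarrow> nat list \<Rightarrow> complex"
  where "mult_space_act n k \<mu> \<phi> x = (\<lambda>s\<in>specht \<mu>. diag_act n k (\<phi> s) x)"

definition half_mult_space_act ::
    "nat \<Rightarrow> nat \<Rightarrow> nat list \<Rightarrow> (((nat \<Rightarrow> nat set) \<Rightarrow> complex) \<Rightarrow> nat list \<Rightarrow> complex) \<Rightarrow>
     (diagram \<Rightarrow> complex) \<Rightarrow> ((nat \<Rightarrow> nat set) \<Rightarrow> complex) \<Rightarrow> nat list \<Rightarrow> complex"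
  where "half_mult_space_act n k \<mu> \<phi> x = (\<lambda>s\<in>specht \<mu>. half_diag_act n k (\<phi> s) x)"

definition mult_space_scale ::
    "nat list \<Rightarrow> complex \<Rightarrow> (((nat \<Rightarrow> nat set) \<Rightarrow> complex) \<Rightarrow> nat list \<Rightarrow> complex) \<Rightarrow>
     ((nat \<Rightarrow> nat set) \<Rightarrow> complex) \<Rightarrow> nat list \<Rightarrow> complex"
  where "mult_space_scale \<mu> c \<phi> = (\<lambda>s\<in>specht \<mu>. c *c \<phi> s)"

end

theory Submission
  imports Defs
begin

text \<open>
  On a polytabloid the class sum of transpositions can be moved past the column
  antisymmetrizer.  A transposition of two entries in the same row then gives \<open>1\<close>, one of two
  entries in the same column gives \<open>-1\<close>, and every other one gives \<open>0\<close>, which adds up to the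
  sum of the contents.

  On tensor space, the matrix of the transposition of \<open>i\<close> and \<open>j\<close> is a tensor power of
  \<open>1 - (E\<^sub>i\<^sub>i + E\<^sub>j\<^sub>j - E\<^sub>i\<^sub>j - E\<^sub>j\<^sub>i)\<close>.  Expanding the power over the set \<open>S\<close> of positions with the second
  summand, and the second summands over the set \<open>I\<close> of vertices labelled \<open>i\<close>, gives
  the diagrams \<open>d\<^sub>I\<close>.  The terms \<open>i = j\<close> cancel, so that \<open>i\<close> and \<open>j\<close> can be summed freely.

  The action on tensor space is faithful for large \<open>n\<close>, so the central elements commute with the
  whole algebra for all large integers \<open>n\<close>, and hence for all complex \<open>n\<close> because the structure
  constants are polynomials in \<open>n\<close>.
\<close>

text \<open>The coefficients of \<open>Z\<close> come from the subsets \<open>I\<close> that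
  \<open>p_S\<close> leaves out. For |S| >= 2, an empty \<open>I\<close> or an empty complement
  leaves one of \<open>i\<close>, \<open>j\<close> unconstrained; the two cases together, halved,
  give n (-1)^|S| b_S. The set {l, l'} and its complement turn column \<open>l\<close> into a
  vertical strand and give (-1)^|S| b_T with T = S - {l}. Collected by \<open>T\<close>, each b_T
  occurs k - |T| times with sign (-1)^(|T|+1), which changes n into n - k + |T|. If |S| = 2, b_T is
  the identity, and these \<open>S\<close> add up to \<open>k choose 2\<close>. Each singleton gives
  -n beside its p_S, and the empty set gives \<open>n choose 2\<close>. The factor 1/2 compensates
  for summing over ordered pairs.

  In the half-integer case column k+1 is labelled n at both ends. The off-diagonal terms of its
  factor then vanish for \<open>i\<close> different from \<open>j\<close>, which is why
  \<open>I\<close> must not split that column. The cancellation of the terms \<open>i = j\<close>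
  needs a column that may be split, so \<open>S = {k + 1}\<close> is computed by itself.\<close>

lemma cscale_apply [simp]: "(c *c f) x = c * f x"
  by (simp add: cscale_def)

lemma sum_scale_basis_apply:
  "finite A \<Longrightarrow> (\<Sum>a\<in>A. c a *c basis a) x = (if x \<in> A then c x else 0)"
  by (simp add: sum_fun_apply basis_def if_distrib sum.delta' cong: if_cong)

lemma free_space_add: "f \<in> free_space B \<Longrightarrow> g \<in> free_space B \<Longrightarrow> f + g \<in> free_space B"
  by (auto simp: free_space_def)

lemma free_space_scale: "f \<in> free_space B \<Longrightarrow> c *c f \<in> free_space B"
  by (auto simp: free_space_def)

lemma free_space_sum_in: "(\<And>a. a \<in> A \<Longrightarrow> f a \<in> free_space B) \<Longrightarrow> (\<Sum>a\<in>A. f a) \<in> free_space B"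
  by (induction A rule: infinite_finite_induct) (auto simp: free_space_def)

lemma basis_in_free_space: "b \<in> B \<Longrightarrow> basis b \<in> free_space B"
  by (auto simp: free_space_def basis_def)

lemma bilinear_prod_in_free_space:
  assumes "\<And>a b. a \<in> B \<Longrightarrow> b \<in> B \<Longrightarrow> p a b \<in> B"
  shows "bilinear_prod B p w x y \<in> free_space B"
  unfolding bilinear_prod_def
  by (intro free_space_sum_in free_space_scale basis_in_free_space assms)

section \<open>The class sum of transpositions\<close>

text \<open>The conjugacy class itself instead of the ordered pairs in \<open>kappa\<close>, so that
  its invariance under conjugation can be used directly.\<close>

definition transps :: "nat \<Rightarrow> (nat \<Rightarrow> nat) set"
  where "transps n = {transpose l m | l m. l \<in> {1..n} \<and> m \<in> {1..n} \<and> l \<noteq> m}"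

lemma transpose_eq_iff_less:
  fixes l m l' m' :: nat
  assumes "l < m" "l' < m'" "transpose l m = transpose l' m'"
  shows "l = l' \<and> m = m'"
proof -
  have "transpose l' m' l = m" "transpose l' m' m = l"
    using assms(3) by (metis transpose_apply_first, metis transpose_apply_second)
  then show ?thesis
    using assms(1,2) by (auto simp: transpose_def split: if_splits)
qed

lemma transps_conv_ordered:
  "transps n = (\<lambda>(l, m). transpose l m) ` {(l, m). 1 \<le> l \<and> l < m \<and> m \<le> n}"
proof (intro set_eqI iffI)
  fix \<tau> assume "\<tau> \<in> transps n"
  then obtain l m where lm: "\<tau> = transpose l m" "l \<in> {1..n}" "m \<in> {1..n}" "l \<noteq> m"
    by (auto simp: transps_def)
  show "\<tau> \<in> (\<lambda>(l, m). transpose l m) ` {(l, m). 1 \<le> l \<and> l < m \<and> m \<le> n}"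
  proof (cases "l < m")
    case True
    with lm show ?thesis by (intro image_eqI[of _ _ "(l, m)"]) auto
  next
    case False
    with lm show ?thesis
      by (intro image_eqI[of _ _ "(m, l)"]) (auto simp: transpose_commute)
  qed
qed (force simp: transps_def)

lemma finite_symm: "finite (symm n)"
  unfolding symm_def by (simp add: finite_permutations)

lemma transps_subset_symm: "transps n \<subseteq> symm n"
  by (auto simp: transps_def symm_def intro: permutes_swap_id)

lemma finite_transps: "finite (transps n)"
  by (rule finite_subset[OF transps_subset_symm finite_symm])

lemma inj_on_transpose_ordered:
  "inj_on (\<lambda>(l, m). transpose l m) {(l, m). 1 \<le> l \<and> l < m \<and> m \<le> (n::nat)}"
  by (rule inj_onI) (auto dest: transpose_eq_iff_less)

lemma kappa_conv_transps: "kappa n = (\<Sum>\<tau>\<in>transps n. basis \<tau>)"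
  unfolding transps_conv_ordered kappa_def
  by (subst sum.reindex[OF inj_on_transpose_ordered]) (auto intro: sum.cong)

lemma kappa_apply: "kappa n \<sigma> = (if \<sigma> \<in> transps n then 1 else 0)"
  using sum_scale_basis_apply[OF finite_transps, of "\<lambda>_. 1" n \<sigma>]
  by (simp add: kappa_conv_transps)

lemma symm_comp: "\<sigma> \<in> symm n \<Longrightarrow> \<tau> \<in> symm n \<Longrightarrow> \<sigma> \<circ> \<tau> \<in> symm n"
  by (auto simp: symm_def intro: permutes_compose)

lemma symm_inv: "\<sigma> \<in> symm n \<Longrightarrow> inv \<sigma> \<in> symm n"
  by (auto simp: symm_def intro: permutes_inv)

lemma symm_bij: "\<sigma> \<in> symm n \<Longrightarrow> bij \<sigma>"
  by (auto simp: symm_def intro: permutes_bij)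

lemma conj_transpose: "bij \<sigma> \<Longrightarrow> \<sigma> \<circ> transpose l m \<circ> inv \<sigma> = transpose (\<sigma> l) (\<sigma> m)"
proof
  fix x assume b: "bij \<sigma>"
  obtain y where y: "x = \<sigma> y" using b by (metis bij_pointE)
  show "(\<sigma> \<circ> transpose l m \<circ> inv \<sigma>) x = transpose (\<sigma> l) (\<sigma> m) x"
    using b by (auto simp: y bij_is_inj transpose_def inj_eq)
qed

lemma transps_conj:
  assumes "\<sigma> \<in> symm n" "\<tau> \<in> transps n"
  shows "\<sigma> \<circ> \<tau> \<circ> inv \<sigma> \<in> transps n"
proof -
  obtain l m where lm: "\<tau> = transpose l m" "l \<in> {1..n}" "m \<in> {1..n}" "l \<noteq> m"
    using assms(2) by (auto simp: transps_def)
  have p: "\<sigma> permutes {1..n}" using assms(1) by (simp add: symm_def)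
  have "\<sigma> l \<in> {1..n}" "\<sigma> m \<in> {1..n}"
    using permutes_in_image[OF p] lm by blast+
  moreover have "\<sigma> l \<noteq> \<sigma> m"
    using lm(4) permutes_inj[OF p] by (auto dest: injD)
  ultimately show ?thesis
    using lm(1) conj_transpose[OF symm_bij[OF assms(1)], of l m]
    by (auto simp: transps_def)
qed

text \<open>Conjugation by \<open>\<sigma>\<close> permutes the transpositions. Since
  \<open>f\<close> is arbitrary, this yields both the centrality of \<open>kappa\<close> and the
  step past the column antisymmetrizer.\<close>

lemma sum_transps_comp:
  assumes "\<sigma> \<in> symm n"
  shows "(\<Sum>\<tau>\<in>transps n. f (\<tau> \<circ> \<sigma>)) = (\<Sum>\<tau>\<in>transps n. f (\<sigma> \<circ> \<tau>))"
proof (rule sum.reindex_bij_witness[of _ "\<lambda>\<tau>. \<sigma> \<circ> \<tau> \<circ> inv \<sigma>" "\<lambda>\<tau>. inv \<sigma> \<circ> \<tau> \<circ> \<sigma>"])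
  note b = symm_bij[OF assms]
  have ii: "inv (inv \<sigma>) = \<sigma>" using b by (rule inv_inv_eq)
  have c: "inv \<sigma> \<circ> \<sigma> = id" "\<sigma> \<circ> inv \<sigma> = id"
    using b by (auto simp: bij_is_inj bij_is_surj surj_iff[symmetric])
  show "\<sigma> \<circ> (inv \<sigma> \<circ> \<tau> \<circ> \<sigma>) \<circ> inv \<sigma> = \<tau>" "inv \<sigma> \<circ> (\<sigma> \<circ> \<tau> \<circ> inv \<sigma>) \<circ> \<sigma> = \<tau>"
    "f (\<sigma> \<circ> (inv \<sigma> \<circ> \<tau> \<circ> \<sigma>)) = f (\<tau> \<circ> \<sigma>)" for \<tau>
    using c by (metis comp_assoc comp_id id_comp)+
  show "\<tau> \<in> transps n \<Longrightarrow> inv \<sigma> \<circ> \<tau> \<circ> \<sigma> \<in> transps n" for \<tau>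
    using transps_conj[OF symm_inv[OF assms], of \<tau>] ii by simp
  show "\<tau> \<in> transps n \<Longrightarrow> \<sigma> \<circ> \<tau> \<circ> inv \<sigma> \<in> transps n" for \<tau>
    using transps_conj[OF assms] .
qed

lemma sum_symm_kappa:
  "(\<Sum>\<sigma>\<in>symm n. (kappa n \<sigma> * c \<sigma>) *c f \<sigma>) = (\<Sum>\<tau>\<in>transps n. c \<tau> *c f \<tau>)"
  by (rule sum.mono_neutral_cong_right[OF finite_symm transps_subset_symm])
    (auto simp: kappa_apply fun_eq_iff)

theorem kappa_in_center: "kappa n \<in> center (symm_alg n) (symm_mult n)"
proof -
  have "symm_mult n (kappa n) x = symm_mult n x (kappa n)" for x
  proof -
    have "symm_mult n (kappa n) x =
        (\<Sum>b\<in>symm n. \<Sum>a\<in>symm n. (kappa n a * x b) *c basis (a \<circ> b))"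
      unfolding symm_mult_def bilinear_prod_def by (subst sum.swap) simp
    also have "\<dots> = (\<Sum>b\<in>symm n. \<Sum>a\<in>transps n. x b *c basis (a \<circ> b))"
      by (intro sum.cong refl sum_symm_kappa)
    also have "\<dots> = (\<Sum>b\<in>symm n. \<Sum>a\<in>transps n. x b *c basis (b \<circ> a))"
      by (intro sum.cong refl sum_transps_comp[where f = "\<lambda>s. x _ *c basis s"])
    also have "\<dots> = (\<Sum>b\<in>symm n. \<Sum>a\<in>symm n. (kappa n a * x b) *c basis (b \<circ> a))"
      by (intro sum.cong refl sum_symm_kappa[symmetric])
    also have "\<dots> = symm_mult n x (kappa n)"
      unfolding symm_mult_def bilinear_prod_def by (simp add: mult.commute)
    finally show ?thesis .
  qed
  moreover have "kappa n \<in> symm_alg n"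
    using transps_subset_symm by (auto simp: symm_alg_def free_space_def kappa_apply)
  ultimately show ?thesis
    by (simp add: center_def)
qed

lemma symm_act_add: "symm_act n B act x (f + g) = symm_act n B act x f + symm_act n B act x g"
  by (simp add: symm_act_def fun_eq_iff sum_fun_apply algebra_simps sum.distrib)

lemma symm_act_scale: "symm_act n B act x (c *c f) = c *c symm_act n B act x f"
  by (simp add: symm_act_def fun_eq_iff sum_fun_apply algebra_simps sum_distrib_left)

lemma symm_act_zero: "symm_act n B act x 0 = 0"
  by (simp add: symm_act_def fun_eq_iff sum_fun_apply)

lemma symm_act_sum: "symm_act n B act x (\<Sum>a\<in>A. f a) = (\<Sum>a\<in>A. symm_act n B act x (f a))"
proof (induction A rule: infinite_finite_induct)
  case (infinite A)
  then show ?case by (simp only: sum.infinite[OF infinite] symm_act_zero)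
next
  case empty
  show ?case by (simp only: sum.empty symm_act_zero)
next
  case (insert a A)
  then show ?case by (simp only: sum.insert[OF insert(1,2)] symm_act_add)
qed

lemma symm_act_kappa:
  "symm_act n B act (kappa n) f = (\<Sum>\<tau>\<in>transps n. \<Sum>b\<in>B. f b *c basis (act \<tau> b))"
proof -
  have "symm_act n B act (kappa n) f =
      (\<Sum>b\<in>B. \<Sum>\<sigma>\<in>symm n. (kappa n \<sigma> * f b) *c basis (act \<sigma> b))"
    unfolding symm_act_def by (rule sum.swap)
  also have "\<dots> = (\<Sum>b\<in>B. \<Sum>\<tau>\<in>transps n. f b *c basis (act \<tau> b))"
    by (intro sum.cong refl sum_symm_kappa)
  finally show ?thesis
    by (subst sum.swap)
qed

lemma symm_act_kappa_basis:
  assumes "finite B" "b \<in> B"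
  shows "symm_act n B act (kappa n) (basis b) = (\<Sum>\<tau>\<in>transps n. basis (act \<tau> b))"
proof -
  have "(\<Sum>b'\<in>B. basis b b' *c basis (act \<tau> b')) = basis (act \<tau> b)" for \<tau>
  proof -
    have "(\<Sum>b'\<in>B. basis b b' *c basis (act \<tau> b')) = (\<Sum>b'\<in>{b}. basis b b' *c basis (act \<tau> b'))"
      by (rule sum.mono_neutral_right) (use assms in \<open>auto simp: basis_def fun_eq_iff\<close>)
    then show ?thesis by (simp add: basis_def fun_eq_iff)
  qed
  then show ?thesis
    by (simp add: symm_act_kappa)
qed

section \<open>The class sum of transpositions on Specht modules\<close>

lemma finite_boxes: "finite (boxes \<mu>)"
proof (rule finite_subset)
  show "boxes \<mu> \<subseteq> {1..length \<mu>} \<times> {1..sum_list \<mu>}"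
  proof
    fix b assume "b \<in> boxes \<mu>"
    then obtain i j where b: "b = (i, j)" "1 \<le> i" "i \<le> length \<mu>" "1 \<le> j" "j \<le> \<mu> ! (i - 1)"
      by (auto simp: boxes_def)
    then have "\<mu> ! (i - 1) \<in> set \<mu>" by auto
    then have "\<mu> ! (i - 1) \<le> sum_list \<mu>" by (intro member_le_sum_list) auto
    with b show "b \<in> {1..length \<mu>} \<times> {1..sum_list \<mu>}" by auto
  qed
qed auto

lemma boxes_left: "(i, j) \<in> boxes \<mu> \<Longrightarrow> 1 \<le> j' \<Longrightarrow> j' \<le> j \<Longrightarrow> (i, j') \<in> boxes \<mu>"
  by (auto simp: boxes_def)

lemma boxes_up:
  assumes "sorted_wrt (\<ge>) \<mu>" "(i, j) \<in> boxes \<mu>" "1 \<le> i'" "i' \<le> i"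
  shows "(i', j) \<in> boxes \<mu>"
proof (cases "i' = i")
  case False
  with assms have "\<mu> ! (i - 1) \<le> \<mu> ! (i' - 1)"
    using sorted_wrt_nth_less[OF assms(1), of "i' - 1" "i - 1"] by (auto simp: boxes_def)
  with assms show ?thesis by (auto simp: boxes_def)
qed (use assms in auto)

lemma tabloid_comp: "tabloid \<mu> (\<sigma> \<circ> t) = (\<lambda>i. \<sigma> ` tabloid \<mu> t i)"
  by (auto simp: tabloid_def fun_eq_iff image_comp)

lemma tabloid_cong: "(\<And>b. b \<in> boxes \<mu> \<Longrightarrow> t b = t' b) \<Longrightarrow> tabloid \<mu> t = tabloid \<mu> t'"
  unfolding tabloid_def by (intro ext image_cong) auto

lemma finite_tabloids: "finite (tabloids \<mu>)"
proof (rule finite_subset)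
  show "tabloids \<mu> \<subseteq> tabloid \<mu> ` (boxes \<mu> \<rightarrow>\<^sub>E {1..sum_list \<mu>})"
  proof
    fix T assume "T \<in> tabloids \<mu>"
    then obtain t where t: "T = tabloid \<mu> t" "bij_betw t (boxes \<mu>) {1..sum_list \<mu>}"
      by (auto simp: tabloids_def tableaux_def)
    have "T = tabloid \<mu> (restrict t (boxes \<mu>))"
      unfolding t by (rule tabloid_cong) auto
    moreover have "restrict t (boxes \<mu>) \<in> boxes \<mu> \<rightarrow>\<^sub>E {1..sum_list \<mu>}"
      using bij_betwE[OF t(2)] by auto
    ultimately show "T \<in> tabloid \<mu> ` (boxes \<mu> \<rightarrow>\<^sub>E {1..sum_list \<mu>})" by blast
  qed
qed (auto intro!: finite_PiE finite_boxes)

lemma tableaux_comp: "t \<in> tableaux \<mu> \<Longrightarrow> \<sigma> \<in> symm (sum_list \<mu>) \<Longrightarrow> \<sigma> \<circ> t \<in> tableaux \<mu>"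
  by (auto simp: tableaux_def symm_def intro: bij_betw_trans permutes_imp_bij)

lemma column_stabilizer_subset: "column_stabilizer \<mu> t \<subseteq> symm (sum_list \<mu>)"
  by (auto simp: column_stabilizer_def)

lemma column_stabilizerE:
  assumes "\<sigma> \<in> column_stabilizer \<mu> t" "b \<in> boxes \<mu>"
  obtains b' where "b' \<in> boxes \<mu>" "snd b' = snd b" "\<sigma> (t b) = t b'"
proof -
  have "\<forall>b\<in>boxes \<mu>. \<exists>b'\<in>boxes \<mu>. snd b' = snd b \<and> \<sigma> (t b) = t b'"
    using assms(1) by (simp add: column_stabilizer_def)
  from bspec[OF this assms(2)] show ?thesis
    using that by blast
qed

lemma column_stabilizer_comp:
  assumes "\<sigma> \<in> column_stabilizer \<mu> t" "\<rho> \<in> column_stabilizer \<mu> t"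
  shows "\<sigma> \<circ> \<rho> \<in> column_stabilizer \<mu> t"
proof -
  have "\<exists>b'\<in>boxes \<mu>. snd b' = snd b \<and> (\<sigma> \<circ> \<rho>) (t b) = t b'" if b: "b \<in> boxes \<mu>" for b
  proof -
    obtain b1 where b1: "b1 \<in> boxes \<mu>" "snd b1 = snd b" "\<rho> (t b) = t b1"
      by (rule column_stabilizerE[OF assms(2) b])
    obtain b2 where "b2 \<in> boxes \<mu>" "snd b2 = snd b1" "\<sigma> (t b1) = t b2"
      by (rule column_stabilizerE[OF assms(1) b1(1)])
    with b1 show ?thesis by auto
  qed
  moreover have "\<sigma> \<circ> \<rho> \<in> symm (sum_list \<mu>)"
    using assms column_stabilizer_subset by (blast intro: symm_comp)
  ultimately show ?thesis
    unfolding column_stabilizer_def by blast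
qed

lemma transpose_in_column_stabilizer:
  assumes t: "t \<in> tableaux \<mu>" and b: "b \<in> boxes \<mu>" "b' \<in> boxes \<mu>" "snd b = snd b'"
  shows "transpose (t b) (t b') \<in> column_stabilizer \<mu> t"
proof -
  have bij: "bij_betw t (boxes \<mu>) {1..sum_list \<mu>}"
    using t by (simp add: tableaux_def)
  have "transpose (t b) (t b') \<in> symm (sum_list \<mu>)"
    unfolding symm_def using bij_betwE[OF bij] b by (auto intro!: permutes_swap_id)
  moreover have "\<exists>d\<in>boxes \<mu>. snd d = snd c \<and> transpose (t b) (t b') (t c) = t d"
    if c: "c \<in> boxes \<mu>" for c
  proof -
    have "transpose (t b) (t b') (t c) = t (transpose b b' c)"
      using c b bij by (auto simp: transpose_def bij_betw_def inj_on_def)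
    with c b show ?thesis
      by (intro bexI[of _ "transpose b b' c"]) (auto simp: transpose_def)
  qed
  ultimately show ?thesis
    unfolding column_stabilizer_def by blast
qed

text \<open>Right multiplication by an odd element of the column stabilizer permutes the stabilizer
  and flips every sign.\<close>

lemma sum_column_stabilizer_transpose:
  assumes \<rho>: "transpose x y \<in> column_stabilizer \<mu> t" and "x \<noteq> y"
  shows "(\<Sum>\<sigma>\<in>column_stabilizer \<mu> t. of_int (sign \<sigma>) *c f (\<sigma> \<circ> transpose x y)) =
    - (\<Sum>\<sigma>\<in>column_stabilizer \<mu> t. of_int (sign \<sigma>) *c f \<sigma>)"
proof -
  have s: "sign (\<sigma> \<circ> transpose x y) = - sign \<sigma>" if "\<sigma> \<in> column_stabilizer \<mu> t" for \<sigma>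
  proof -
    have "permutation \<sigma>"
      using that column_stabilizer_subset[of \<mu> t] by (auto simp: symm_def permutation_permutes)
    then show ?thesis
      using \<open>x \<noteq> y\<close> by (simp add: sign_compose permutation_swap_id sign_swap_id)
  qed
  have "(\<Sum>\<sigma>\<in>column_stabilizer \<mu> t. of_int (sign \<sigma>) *c f (\<sigma> \<circ> transpose x y)) =
      (\<Sum>\<sigma>\<in>column_stabilizer \<mu> t. - (of_int (sign \<sigma>) *c f \<sigma>))"
  proof (rule sum.reindex_bij_witness[of _ "\<lambda>\<sigma>. \<sigma> \<circ> transpose x y" "\<lambda>\<sigma>. \<sigma> \<circ> transpose x y"])
    show "- (of_int (sign (\<sigma> \<circ> transpose x y)) *c f (\<sigma> \<circ> transpose x y)) =
        of_int (sign \<sigma>) *c f (\<sigma> \<circ> transpose x y)" if "\<sigma> \<in> column_stabilizer \<mu> t" for \<sigma>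
      by (simp add: s[OF that] fun_eq_iff)
  qed (simp_all add: comp_assoc column_stabilizer_comp \<rho>)
  then show ?thesis
    by (simp add: sum_negf)
qed

lemma tabloid_transpose_row:
  assumes t: "t \<in> tableaux \<mu>" and b: "b \<in> boxes \<mu>" "b' \<in> boxes \<mu>" "fst b = fst b'"
  shows "tabloid \<mu> (transpose (t b) (t b') \<circ> t) = tabloid \<mu> t"
proof
  fix i
  have inj: "inj_on t (boxes \<mu>)" using t by (simp add: tableaux_def bij_betw_def)
  have "transpose (t b) (t b') (t c) = t (transpose b b' c)" if "c \<in> boxes \<mu>" for c
    using that b inj by (auto simp: transpose_def inj_on_def)
  then have "tabloid \<mu> (transpose (t b) (t b') \<circ> t) i =
      t ` transpose b b' ` {c \<in> boxes \<mu>. fst c = i}"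
    unfolding tabloid_def image_image by (intro image_cong) auto
  also have "transpose b b' ` {c \<in> boxes \<mu>. fst c = i} = {c \<in> boxes \<mu>. fst c = i}"
    using b by (intro transpose_image_eq) auto
  finally show "tabloid \<mu> (transpose (t b) (t b') \<circ> t) i = tabloid \<mu> t i"
    by (simp add: tabloid_def)
qed


text \<open>A Garnir-type cancellation. Let \<open>z\<close> be the box in the row of
  \<open>b\<close> and the column of \<open>b'\<close>; it lies in the shape because
  \<open>b\<close> is in a higher row than \<open>b'\<close>. After the entries of \<open>b\<close>
  and \<open>b'\<close> are exchanged, \<open>t b'\<close> and \<open>t z\<close> share a row, so
  their transposition fixes the tabloid. In \<open>t\<close> they share a column, so the same
  transposition changes the sign of the antisymmetrized sum, which is therefore its own
  negative.\<close>

lemma column_antisymmetrizer_off: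
  assumes sorted: "sorted_wrt (\<ge>) \<mu>" and t: "t \<in> tableaux \<mu>"
    and b: "b \<in> boxes \<mu>" "b' \<in> boxes \<mu>" "fst b < fst b'" "snd b \<noteq> snd b'"
  shows "(\<Sum>\<sigma>\<in>column_stabilizer \<mu> t.
    of_int (sign \<sigma>) *c basis (tabloid \<mu> (\<sigma> \<circ> transpose (t b) (t b') \<circ> t))) = 0"
proof -
  have inj: "inj_on t (boxes \<mu>)" using t by (simp add: tableaux_def bij_betw_def)
  define z where "z = (fst b, snd b')"
  have z: "z \<in> boxes \<mu>"
    unfolding z_def using boxes_up[OF sorted, of "fst b'" "snd b'" "fst b"] b
    by (auto simp: boxes_def)
  have ne: "b \<noteq> b'" "z \<noteq> b" "z \<noteq> b'" using b by (auto simp: z_def prod_eq_iff)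
  then have tne: "t b \<noteq> t b'" "t z \<noteq> t b" "t z \<noteq> t b'"
    using inj b z by (auto simp: inj_on_def)
  define s where "s = transpose (t b) (t b') \<circ> t"
  have bij: "bij_betw t (boxes \<mu>) {1..sum_list \<mu>}" using t by (simp add: tableaux_def)
  have "transpose (t b) (t b') \<in> symm (sum_list \<mu>)"
    unfolding symm_def using bij_betwE[OF bij] b by (auto intro!: permutes_swap_id)
  then have s: "s \<in> tableaux \<mu>"
    unfolding s_def by (rule tableaux_comp[OF t])
  have sb: "s b = t b'" "s z = t z"
    using tne by (auto simp: s_def transpose_def)
  have fixed: "tabloid \<mu> (transpose (t b') (t z) \<circ> s) = tabloid \<mu> s"
    using tabloid_transpose_row[OF s b(1) z] by (simp add: sb) (simp add: z_def)
  have \<rho>: "transpose (t b') (t z) \<in> column_stabilizer \<mu> t"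
    by (rule transpose_in_column_stabilizer[OF t b(2) z]) (simp add: z_def)
  define X where "X = (\<Sum>\<sigma>\<in>column_stabilizer \<mu> t. of_int (sign \<sigma>) *c basis (tabloid \<mu> (\<sigma> \<circ> s)))"
  have "tabloid \<mu> ((\<sigma> \<circ> transpose (t b') (t z)) \<circ> s) = tabloid \<mu> (\<sigma> \<circ> s)" for \<sigma>
    by (simp only: comp_assoc tabloid_comp[of \<mu> \<sigma>] fixed)
  then have "X = (\<Sum>\<sigma>\<in>column_stabilizer \<mu> t.
      of_int (sign \<sigma>) *c basis (tabloid \<mu> ((\<sigma> \<circ> transpose (t b') (t z)) \<circ> s)))"
    by (simp only: X_def)
  also have "\<dots> = - X"
    unfolding X_def using tne(3)
    by (intro sum_column_stabilizer_transpose[where f = "\<lambda>\<sigma>. basis (tabloid \<mu> (\<sigma> \<circ> s))", OF \<rho>]) auto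
  finally have "X T = 0" for T
    by (auto dest: fun_cong[of _ _ T])
  then show ?thesis
    by (auto simp: X_def s_def comp_assoc fun_eq_iff)
qed

text \<open>The reading order by rows. It charges each transposition of two entries to the later of
  the two boxes, and the contributions charged to a box add up to its content.\<close>

definition box_less :: "nat \<times> nat \<Rightarrow> nat \<times> nat \<Rightarrow> bool"
  where "box_less b b' \<longleftrightarrow> fst b < fst b' \<or> fst b = fst b' \<and> snd b < snd b'"

lemma sum_transps_tableau:
  fixes f :: "(nat \<Rightarrow> nat) \<Rightarrow> 'a::comm_monoid_add"
  assumes t: "t \<in> tableaux \<mu>"
  shows "(\<Sum>\<tau>\<in>transps (sum_list \<mu>). f \<tau>) =
    (\<Sum>b'\<in>boxes \<mu>. \<Sum>b\<in>{b \<in> boxes \<mu>. box_less b b'}. f (transpose (t b) (t b')))"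
proof -
  let ?P = "SIGMA b':boxes \<mu>. {b \<in> boxes \<mu>. box_less b b'}"
  let ?g = "\<lambda>(b', b). transpose (t b) (t b')"
  have bij: "bij_betw t (boxes \<mu>) {1..sum_list \<mu>}" using t by (simp add: tableaux_def)
  then have inj: "inj_on t (boxes \<mu>)" and im: "t ` boxes \<mu> = {1..sum_list \<mu>}"
    by (auto simp: bij_betw_def)
  have "inj_on ?g ?P"
  proof (rule inj_onI, clarsimp)
    fix i j i' j' k l k' l' :: nat
    let ?b = "(i, j)" and ?b' = "(i', j')" and ?c = "(k, l)" and ?c' = "(k', l')"
    assume b: "?b \<in> boxes \<mu>" "?b' \<in> boxes \<mu>" "?c \<in> boxes \<mu>" "?c' \<in> boxes \<mu>"
      and l: "box_less ?b' ?b" "box_less ?c' ?c"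
      and eq: "transpose (t ?b') (t ?b) = transpose (t ?c') (t ?c)"
    have "?b' \<noteq> ?b" using l by (auto simp: box_less_def)
    then have ne: "t ?b' \<noteq> t ?b" using b by (simp add: inj_on_eq_iff[OF inj])
    have "transpose (t ?c') (t ?c) (t ?b') = t ?b" "transpose (t ?c') (t ?c) (t ?b) = t ?b'"
      unfolding eq[symmetric] by auto
    \<comment> \<open>A transposition determines the unordered pair that it moves;
      \<open>box_less\<close> then excludes the reversed pair.\<close>
    then have "t ?c' = t ?b' \<and> t ?c = t ?b \<or> t ?c' = t ?b \<and> t ?c = t ?b'"
      using ne by (auto simp: transpose_def split: if_splits)
    then have "?c' = ?b' \<and> ?c = ?b \<or> ?c' = ?b \<and> ?c = ?b'"
      by (simp only: inj_on_eq_iff[OF inj] b)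
    then show "i = k \<and> j = l \<and> i' = k' \<and> j' = l'"
      using l by (auto simp: box_less_def)
  qed
  moreover have "?g ` ?P = transps (sum_list \<mu>)"
  proof (intro set_eqI iffI)
    fix \<tau> assume "\<tau> \<in> ?g ` ?P"
    then obtain b b' where "b \<in> boxes \<mu>" "b' \<in> boxes \<mu>" "box_less b b'" "\<tau> = transpose (t b) (t b')"
      by auto
    moreover from this have "t b \<noteq> t b'"
      by (auto simp: inj_on_eq_iff[OF inj] box_less_def)
    ultimately show "\<tau> \<in> transps (sum_list \<mu>)"
      unfolding transps_def im[symmetric] by blast
  next
    fix \<tau> assume "\<tau> \<in> transps (sum_list \<mu>)"
    then obtain x y where "\<tau> = transpose x y" "x \<in> t ` boxes \<mu>" "y \<in> t ` boxes \<mu>" "x \<noteq> y"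
      by (auto simp: transps_def im)
    then obtain b b' where b: "b \<in> boxes \<mu>" "b' \<in> boxes \<mu>" "b \<noteq> b'" "\<tau> = transpose (t b) (t b')"
      by auto
    then consider "box_less b b'" | "box_less b' b"
      unfolding box_less_def by (metis linorder_neqE_nat prod_eqI)
    then show "\<tau> \<in> ?g ` ?P"
    proof cases
      case 1 with b show ?thesis by (intro image_eqI[of _ _ "(b', b)"]) auto
    next
      case 2 with b show ?thesis
        by (intro image_eqI[of _ _ "(b, b')"]) (auto simp: transpose_commute)
    qed
  qed
  ultimately have "(\<Sum>\<tau>\<in>transps (sum_list \<mu>). f \<tau>) = (\<Sum>p\<in>?P. f (?g p))"
    using sum.reindex[of ?g ?P f] by (simp only: comp_def)
  also have "\<dots> = (\<Sum>b'\<in>boxes \<mu>. \<Sum>b\<in>{b \<in> boxes \<mu>. box_less b b'}. f (transpose (t b) (t b')))"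
    by (subst sum.Sigma) (auto simp: finite_boxes case_prod_beta)
  finally show ?thesis .
qed

lemma card_boxes_left:
  assumes "b' \<in> boxes \<mu>"
  shows "card {b \<in> boxes \<mu>. fst b = fst b' \<and> snd b < snd b'} = snd b' - 1"
proof -
  have "{b \<in> boxes \<mu>. fst b = fst b' \<and> snd b < snd b'} = Pair (fst b') ` {1..<snd b'}"
    using assms boxes_left[of "fst b'" "snd b'" \<mu>] by (force simp: boxes_def)
  then show ?thesis by (simp add: card_image inj_on_def)
qed

lemma card_boxes_up:
  assumes "sorted_wrt (\<ge>) \<mu>" "b' \<in> boxes \<mu>"
  shows "card {b \<in> boxes \<mu>. snd b = snd b' \<and> fst b < fst b'} = fst b' - 1"
proof -
  have "{b \<in> boxes \<mu>. snd b = snd b' \<and> fst b < fst b'} = (\<lambda>i. (i, snd b')) ` {1..<fst b'}"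
  proof (intro set_eqI iffI)
    fix x assume "x \<in> (\<lambda>i. (i, snd b')) ` {1..<fst b'}"
    then show "x \<in> {b \<in> boxes \<mu>. snd b = snd b' \<and> fst b < fst b'}"
      using boxes_up[OF assms(1), of "fst b'" "snd b'"] assms(2) by auto
  qed (auto simp: boxes_def)
  then show ?thesis by (simp add: card_image inj_on_def)
qed

text \<open>For \<open>b'\<close> in row i and column j, the j - 1 boxes to its left contribute 1
  each and the i - 1 boxes above it contribute -1 each. Every other box that precedes
  \<open>b'\<close> lies in a strictly higher row and another column, where
  \<open>column_antisymmetrizer_off\<close> gives 0.\<close>

lemma sum_transps_polytabloid:
  assumes sorted: "sorted_wrt (\<ge>) \<mu>" and t: "t \<in> tableaux \<mu>" and b': "b' \<in> boxes \<mu>"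
  defines "W \<equiv> \<lambda>b. \<Sum>\<sigma>\<in>column_stabilizer \<mu> t.
    of_int (sign \<sigma>) *c basis (tabloid \<mu> (\<sigma> \<circ> transpose (t b) (t b') \<circ> t))"
  shows "(\<Sum>b\<in>{b \<in> boxes \<mu>. box_less b b'}. W b) = content b' *c polytabloid \<mu> t"
proof -
  have inj: "inj_on t (boxes \<mu>)" using t by (simp add: tableaux_def bij_betw_def)
  let ?R = "{b \<in> boxes \<mu>. fst b = fst b' \<and> snd b < snd b'}"
  let ?C = "{b \<in> boxes \<mu>. snd b = snd b' \<and> fst b < fst b'}"
  let ?O = "{b \<in> boxes \<mu>. snd b \<noteq> snd b' \<and> fst b < fst b'}"
  have R: "W b = polytabloid \<mu> t" if "b \<in> ?R" for b
  proof -
    have "tabloid \<mu> (\<sigma> \<circ> transpose (t b) (t b') \<circ> t) = tabloid \<mu> (\<sigma> \<circ> t)" for \<sigma>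
      using that b' by (simp only: comp_assoc tabloid_comp[of \<mu> \<sigma>]
        tabloid_transpose_row[OF t, of b b'] mem_Collect_eq)
    then show ?thesis by (simp only: W_def polytabloid_def)
  qed
  have C: "W b = - polytabloid \<mu> t" if "b \<in> ?C" for b
  proof -
    have "t b \<noteq> t b'" using that b' inj by (auto simp: inj_on_def)
    with that b' show ?thesis
      unfolding W_def polytabloid_def
      by (intro sum_column_stabilizer_transpose[where f = "\<lambda>\<sigma>. basis (tabloid \<mu> (\<sigma> \<circ> t))"]
        transpose_in_column_stabilizer t) auto
  qed
  have O: "W b = 0" if "b \<in> ?O" for b
    unfolding W_def using that b' by (intro column_antisymmetrizer_off[OF sorted t]) auto
  have "{b \<in> boxes \<mu>. box_less b b'} = ?R \<union> ?C \<union> ?O"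
    by (auto simp: box_less_def)
  then have "(\<Sum>b\<in>{b \<in> boxes \<mu>. box_less b b'}. W b) = (\<Sum>b\<in>?R \<union> ?C \<union> ?O. W b)"
    by simp
  also have "\<dots> = (\<Sum>b\<in>?R \<union> ?C. W b) + (\<Sum>b\<in>?O. W b)"
    by (rule sum.union_disjoint) (auto simp: finite_boxes)
  also have "(\<Sum>b\<in>?R \<union> ?C. W b) = (\<Sum>b\<in>?R. W b) + (\<Sum>b\<in>?C. W b)"
    by (rule sum.union_disjoint) (auto simp: finite_boxes)
  also have "(\<Sum>b\<in>?O. W b) = (\<Sum>b\<in>?O. 0)"
    by (rule sum.cong[OF refl O])
  also have "(\<Sum>b\<in>?R. W b) = (\<Sum>b\<in>?R. polytabloid \<mu> t)"
    by (rule sum.cong[OF refl R])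
  also have "(\<Sum>b\<in>?C. W b) = (\<Sum>b\<in>?C. - polytabloid \<mu> t)"
    by (rule sum.cong[OF refl C])
  finally have *: "(\<Sum>b\<in>{b \<in> boxes \<mu>. box_less b b'}. W b) =
      (\<Sum>b\<in>?R. polytabloid \<mu> t) + (\<Sum>b\<in>?C. - polytabloid \<mu> t) + (\<Sum>b\<in>?O. 0)" .
  have "1 \<le> fst b'" "1 \<le> snd b'" using b' by (auto simp: boxes_def)
  then show ?thesis
    unfolding *
    by (simp add: fun_eq_iff sum_fun_apply card_boxes_left[OF b'] card_boxes_up[OF sorted b']
        content_def of_nat_diff algebra_simps)
qed

lemma specht_act_kappa_polytabloid:
  assumes sorted: "sorted_wrt (\<ge>) \<mu>" and t: "t \<in> tableaux \<mu>"
  shows "specht_act \<mu> (kappa (sum_list \<mu>)) (polytabloid \<mu> t) =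
    (\<Sum>b\<in>boxes \<mu>. content b) *c polytabloid \<mu> t"
proof -
  let ?C = "column_stabilizer \<mu> t" and ?T = "transps (sum_list \<mu>)"
  have basis: "symm_act (sum_list \<mu>) (tabloids \<mu>) (\<lambda>\<sigma> T i. \<sigma> ` T i) (kappa (sum_list \<mu>))
      (basis (tabloid \<mu> (\<sigma> \<circ> t))) = (\<Sum>\<tau>\<in>?T. basis (\<lambda>i. \<tau> ` tabloid \<mu> (\<sigma> \<circ> t) i))" if "\<sigma> \<in> ?C" for \<sigma>
  proof -
    have "\<sigma> \<in> symm (sum_list \<mu>)" using column_stabilizer_subset that by blast
    from tableaux_comp[OF t this] show ?thesis
      by (intro symm_act_kappa_basis finite_tabloids) (simp add: tabloids_def)
  qed
  have "specht_act \<mu> (kappa (sum_list \<mu>)) (polytabloid \<mu> t) =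
      (\<Sum>\<sigma>\<in>?C. of_int (sign \<sigma>) *c (\<Sum>\<tau>\<in>?T. basis (\<lambda>i. \<tau> ` tabloid \<mu> (\<sigma> \<circ> t) i)))"
    unfolding specht_act_def polytabloid_def symm_act_sum symm_act_scale
    by (rule sum.cong) (simp_all only: basis)
  also have "\<dots> = (\<Sum>\<sigma>\<in>?C. of_int (sign \<sigma>) *c (\<Sum>\<tau>\<in>?T. basis (tabloid \<mu> (\<tau> \<circ> \<sigma> \<circ> t))))"
    by (simp only: tabloid_comp comp_assoc)
  \<comment> \<open>With \<open>\<tau>\<close> to the right of \<open>\<sigma>\<close>, the
    transposition acts on \<open>t\<close> before the antisymmetrization, so what happens depends
    only on the two boxes of \<open>t\<close> that it exchanges.\<close>
  also have "\<dots> = (\<Sum>\<sigma>\<in>?C. of_int (sign \<sigma>) *c (\<Sum>\<tau>\<in>?T. basis (tabloid \<mu> (\<sigma> \<circ> \<tau> \<circ> t))))"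
  proof (rule sum.cong[OF refl], rule arg_cong[where f = "cscale _"])
    fix \<sigma> assume "\<sigma> \<in> ?C"
    then have "\<sigma> \<in> symm (sum_list \<mu>)" using column_stabilizer_subset by blast
    then show "(\<Sum>\<tau>\<in>?T. basis (tabloid \<mu> (\<tau> \<circ> \<sigma> \<circ> t))) = (\<Sum>\<tau>\<in>?T. basis (tabloid \<mu> (\<sigma> \<circ> \<tau> \<circ> t)))"
      by (rule sum_transps_comp[where f = "\<lambda>\<rho>. basis (tabloid \<mu> (\<rho> \<circ> t))"])
  qed
  also have "\<dots> = (\<Sum>\<tau>\<in>?T. \<Sum>\<sigma>\<in>?C. of_int (sign \<sigma>) *c basis (tabloid \<mu> (\<sigma> \<circ> \<tau> \<circ> t)))"
    by (simp only: cfun.scale_sum_right) (rule sum.swap)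
  also have "\<dots> = (\<Sum>b'\<in>boxes \<mu>. \<Sum>b\<in>{b \<in> boxes \<mu>. box_less b b'}.
      \<Sum>\<sigma>\<in>?C. of_int (sign \<sigma>) *c basis (tabloid \<mu> (\<sigma> \<circ> transpose (t b) (t b') \<circ> t)))"
    by (rule sum_transps_tableau[OF t])
  also have "\<dots> = (\<Sum>b'\<in>boxes \<mu>. content b' *c polytabloid \<mu> t)"
    by (intro sum.cong refl sum_transps_polytabloid[OF sorted t])
  finally show ?thesis
    by (simp only: cfun.scale_sum_left)
qed

theorem specht_act_kappa:
  assumes "is_partition \<mu> n" "s \<in> specht \<mu>"
  shows "specht_act \<mu> (kappa n) s = (\<Sum>b\<in>boxes \<mu>. content b) *c s"
proof -
  have \<mu>: "sorted_wrt (\<ge>) \<mu>" "sum_list \<mu> = n"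
    using assms(1) by (auto simp: is_partition_def)
  show ?thesis
    using assms(2) unfolding specht_def
  proof (induction rule: cfun.span_induct_alt)
    case base
    show ?case by (simp only: specht_act_def symm_act_zero cfun.scale_zero_right)
  next
    case (step c x y)
    then obtain t where t: "t \<in> tableaux \<mu>" "x = polytabloid \<mu> t" by auto
    have "specht_act \<mu> (kappa n) (c *c x + y) = c *c specht_act \<mu> (kappa n) x + specht_act \<mu> (kappa n) y"
      by (simp only: specht_act_def symm_act_add symm_act_scale)
    also have "\<dots> = (\<Sum>b\<in>boxes \<mu>. content b) *c (c *c x + y)"
      using specht_act_kappa_polytabloid[OF \<mu>(1) t(1)] step(2)
      by (simp only: \<mu>(2) t(2) cfun.scale_right_distrib cfun.scale_left_commute)
    finally show ?case .
  qed
qed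

section \<open>Diagrams as matrices on tensor space\<close>

text \<open>The word \<open>w\<close> labels the top row and \<open>u\<close> the bottom row. An
  entry does not involve the dimension \<open>n\<close>; only the range of the words does.\<close>

definition mat :: "nat \<Rightarrow> (diagram \<Rightarrow> complex) \<Rightarrow> nat list \<Rightarrow> nat list \<Rightarrow> complex"
  where "mat k x w u = (\<Sum>d\<in>diagrams k. x d * of_bool (compatible d w u))"

lemma finite_dbl: "finite S \<Longrightarrow> finite (dbl S)"
  by (simp add: dbl_def)

lemma finite_diagrams: "finite (diagrams k)"
  unfolding diagrams_def by (rule finitely_many_partition_on) (simp add: finite_dbl)

lemma mat_add: "mat k (x + y) w u = mat k x w u + mat k y w u"
  by (simp add: mat_def algebra_simps sum.distrib)

lemma mat_diff: "mat k (x - y) w u = mat k x w u - mat k y w u"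
  by (simp add: mat_def algebra_simps sum_subtractf)

lemma mat_scale: "mat k (c *c x) w u = c * mat k x w u"
  by (simp add: mat_def sum_distrib_left algebra_simps)

lemma mat_sum: "mat k (\<Sum>a\<in>A. f a) w u = (\<Sum>a\<in>A. mat k (f a) w u)"
  by (simp add: mat_def sum_fun_apply sum_distrib_right) (rule sum.swap)

lemma mat_basis: "d \<in> diagrams k \<Longrightarrow> mat k (basis d) w u = of_bool (compatible d w u)"
  by (simp add: mat_def basis_def finite_diagrams if_distrib[of "\<lambda>c. c * _"] sum.delta' cong: if_cong)

lemma diag_act_mat:
  "diag_act n k f x u = (if u \<in> words n k then \<Sum>w\<in>words n k. f w * mat k x w u else 0)"
  by (simp add: diag_act_apply mat_def sum_distrib_left mult.assoc of_bool_def if_distrib cong: if_cong)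

section \<open>Stacking of diagrams as matrix multiplication\<close>

fun label3 :: "nat list \<Rightarrow> nat list \<Rightarrow> nat list \<Rightarrow> vertex \<Rightarrow> nat" where
  "label3 w v u (Top i) = w ! (i - 1)"
| "label3 w v u (Mid i) = v ! (i - 1)"
| "label3 w v u (Bot i) = u ! (i - 1)"

definition const_on :: "('a \<Rightarrow> 'b) \<Rightarrow> 'a set \<Rightarrow> bool"
  where "const_on h B \<longleftrightarrow> (\<forall>r\<in>B. \<forall>s\<in>B. h r = h s)"

lemma compatible_conv_const_on: "compatible d w u \<longleftrightarrow> (\<forall>B\<in>d. const_on (label w u) B)"
  by (simp add: compatible_def const_on_def)

lemma const_onD: "const_on h B \<Longrightarrow> r \<in> B \<Longrightarrow> s \<in> B \<Longrightarrow> h r = h s"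
  unfolding const_on_def by blast

lemma const_on_cong: "(\<And>r. r \<in> B \<Longrightarrow> h r = h' r) \<Longrightarrow> const_on h B \<longleftrightarrow> const_on h' B"
  unfolding const_on_def by (intro ball_cong refl) simp

lemma const_on_image: "const_on h (f ` B) \<longleftrightarrow> const_on (h \<circ> f) B"
  by (simp add: const_on_def)

text \<open>The quotient of \<open>stack_components\<close>, but taken on the union of
  \<open>F\<close> itself. That set is closed under the generated relation, so the classes partition
  it for every family \<open>F\<close>.\<close>

definition components :: "'a set set \<Rightarrow> 'a set set"
  where "components F = \<Union>F // (\<Union>B\<in>F. B \<times> B)\<^sup>*"

context
  fixes F :: "'a set set" and R
  defines "R \<equiv> (\<Union>B\<in>F. B \<times> B)\<^sup>*"
begin

lemma components_closed:
  assumes "(x, y) \<in> R" "x \<in> \<Union>F"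
  shows "y \<in> \<Union>F"
  using assms(1) unfolding R_def
proof (induction rule: rtrancl_induct)
  case base
  show ?case by (rule assms(2))
next
  case (step y z)
  then show ?case by blast
qed

lemma components_sym: "(x, y) \<in> R \<Longrightarrow> (y, x) \<in> R"
proof -
  have "sym R"
    unfolding R_def by (rule sym_rtrancl) (auto simp: sym_def)
  then show "(x, y) \<in> R \<Longrightarrow> (y, x) \<in> R"
    by (rule symD)
qed

lemma components_class_eq: "(x, y) \<in> R \<Longrightarrow> R `` {x} = R `` {y}"
proof -
  assume xy: "(x, y) \<in> R"
  have trans: "(p, q) \<in> R \<Longrightarrow> (q, r) \<in> R \<Longrightarrow> (p, r) \<in> R" for p q r
    unfolding R_def by (rule rtrancl_trans)
  show ?thesis
    using trans[OF xy] trans[OF components_sym[OF xy]] by blast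
qed

lemma components_conv: "components F = (\<lambda>x. R `` {x}) ` \<Union>F"
  by (auto simp: components_def R_def quotient_def)

lemma partition_on_components: "partition_on (\<Union>F) (components F)"
proof (rule partition_onI)
  show "\<Union>(components F) = \<Union>F"
    unfolding components_conv using components_closed by (auto simp: R_def)
next
  fix C D assume "C \<in> components F" "D \<in> components F" "C \<noteq> D"
  then obtain x y where xy: "C = R `` {x}" "D = R `` {y}"
    by (auto simp: components_conv)
  show "disjnt C D"
  proof (rule ccontr)
    assume "\<not> disjnt C D"
    then obtain z where "(x, z) \<in> R" "(y, z) \<in> R"
      by (auto simp: disjnt_def xy)
    then have "C = D"
      using components_class_eq unfolding xy by metis
    with \<open>C \<noteq> D\<close> show False ..
  qed
next
  show "{} \<notin> components F"
    by (auto simp: components_conv R_def)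
qed

lemma components_superset:
  assumes "B \<in> F" "r \<in> B"
  obtains C where "C \<in> components F" "B \<subseteq> C"
proof
  show "R `` {r} \<in> components F" using assms by (auto simp: components_conv)
  show "B \<subseteq> R `` {r}" using assms by (auto simp: R_def)
qed

text \<open>Constancy on the members of \<open>F\<close> propagates along chains of overlapping
  members; conversely every member lies inside one component.\<close>

lemma const_on_components:
  "(\<forall>C\<in>components F. const_on h C) \<longleftrightarrow> (\<forall>B\<in>F. const_on h B)"
proof
  assume *: "\<forall>C\<in>components F. const_on h C"
  show "\<forall>B\<in>F. const_on h B"
  proof
    fix B assume B: "B \<in> F"
    show "const_on h B"
      unfolding const_on_def
    proof (intro ballI)
      fix r s assume rs: "r \<in> B" "s \<in> B"
      obtain C where "C \<in> components F" "B \<subseteq> C"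
        using components_superset[OF B rs(1)] .
      with * rs show "h r = h s" by (auto simp: const_on_def)
    qed
  qed
next
  assume *: "\<forall>B\<in>F. const_on h B"
  have h: "h x = h y" if "(x, y) \<in> R" for x y
    using that unfolding R_def
  proof (induction rule: rtrancl_induct)
    case (step y z)
    then show ?case using * by (auto simp: const_on_def)
  qed simp
  show "\<forall>C\<in>components F. const_on h C"
  proof
    fix C assume "C \<in> components F"
    then obtain x where "C = R `` {x}"
      unfolding components_conv by blast
    then have "h r = h x" if "r \<in> C" for r
      using h[of x r] that by simp
    then show "const_on h C"
      unfolding const_on_def by simp
  qed
qed

end

lemma partition_on_unique:
  "partition_on A P \<Longrightarrow> C \<in> P \<Longrightarrow> D \<in> P \<Longrightarrow> x \<in> C \<Longrightarrow> x \<in> D \<Longrightarrow> C = D"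
  unfolding partition_on_def disjoint_def by blast

lemma diagramD: "d \<in> diagrams k \<Longrightarrow> partition_on (dbl {1..k}) d"
  by (simp add: diagrams_def)

lemma stack_components_conv:
  assumes "a \<in> diagrams k" "b \<in> diagrams k"
  shows "stack_components k a b = components ((`) bot_to_mid ` a \<union> (`) top_to_mid ` b)"
    and "\<Union>((`) bot_to_mid ` a \<union> (`) top_to_mid ` b) = dbl {1..k} \<union> Mid ` {1..k}"
proof -
  have "\<Union>((`) bot_to_mid ` a) = bot_to_mid ` dbl {1..k}" "\<Union>((`) top_to_mid ` b) = top_to_mid ` dbl {1..k}"
    by (simp_all only: image_Union[symmetric] partition_onD1[OF diagramD[OF assms(1)], symmetric]
      partition_onD1[OF diagramD[OF assms(2)], symmetric])
  then show *: "\<Union>((`) bot_to_mid ` a \<union> (`) top_to_mid ` b) = dbl {1..k} \<union> Mid ` {1..k}"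
    by (simp only: Union_Un_distrib) (auto simp: dbl_def image_Un image_image)
  show "stack_components k a b = components ((`) bot_to_mid ` a \<union> (`) top_to_mid ` b)"
    unfolding stack_components_def components_def * ..
qed

lemma partition_on_stack_components:
  assumes "a \<in> diagrams k" "b \<in> diagrams k"
  shows "partition_on (dbl {1..k} \<union> Mid ` {1..k}) (stack_components k a b)"
  using partition_on_components[of "(`) bot_to_mid ` a \<union> (`) top_to_mid ` b"]
  by (simp only: stack_components_conv[OF assms])

text \<open>Once the glued rows are renamed to \<open>Mid\<close>, the blocks of both diagrams live
  in one vertex set, where \<open>label3\<close> restricts to the labellings of \<open>a\<close> and
  of \<open>b\<close>. Both compatibilities together are constancy on all these blocks, hence on the
  components.\<close>

lemma compatible_stack:
  assumes "a \<in> diagrams k" "b \<in> diagrams k"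
  shows "compatible a w v \<and> compatible b v u \<longleftrightarrow>
    (\<forall>C\<in>stack_components k a b. const_on (label3 w v u) C)"
proof -
  have a: "const_on (label3 w v u) (bot_to_mid ` B) \<longleftrightarrow> const_on (label w v) B" if "B \<in> a" for B
    unfolding const_on_image
  proof (rule const_on_cong)
    fix r assume "r \<in> B"
    then have "r \<in> dbl {1..k}" using partition_onD1[OF diagramD[OF assms(1)]] that by auto
    then show "(label3 w v u \<circ> bot_to_mid) r = label w v r" by (auto simp: dbl_def)
  qed
  have b: "const_on (label3 w v u) (top_to_mid ` B) \<longleftrightarrow> const_on (label v u) B" if "B \<in> b" for B
    unfolding const_on_image
  proof (rule const_on_cong)
    fix r assume "r \<in> B"
    then have "r \<in> dbl {1..k}" using partition_onD1[OF diagramD[OF assms(2)]] that by auto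
    then show "(label3 w v u \<circ> top_to_mid) r = label v u r" by (auto simp: dbl_def)
  qed
  show ?thesis
    unfolding stack_components_conv(1)[OF assms] const_on_components compatible_conv_const_on
    by (simp add: a b ball_Un)
qed

lemma diagram_comp_in_diagrams:
  assumes "a \<in> diagrams k" "b \<in> diagrams k"
  shows "diagram_comp k a b \<in> diagrams k"
proof -
  note P = partition_on_stack_components[OF assms]
  have "partition_on (dbl {1..k}) (diagram_comp k a b)"
  proof (rule partition_onI)
    have "\<Union>(diagram_comp k a b) = \<Union>(stack_components k a b) - range Mid"
      unfolding diagram_comp_def by blast
    also have "\<dots> = dbl {1..k}"
      using partition_onD1[OF P] by (auto simp: dbl_def)
    finally show "\<Union>(diagram_comp k a b) = dbl {1..k}" .
  next
    fix C D assume "C \<in> diagram_comp k a b" "D \<in> diagram_comp k a b" "C \<noteq> D"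
    then obtain C' D' where "C = C' - range Mid" "D = D' - range Mid" "C' \<noteq> D'"
      "C' \<in> stack_components k a b" "D' \<in> stack_components k a b"
      by (auto simp: diagram_comp_def)
    with P show "disjnt C D"
      unfolding disjnt_def partition_on_def disjoint_def by blast
  next
    show "{} \<notin> diagram_comp k a b"
      by (auto simp: diagram_comp_def)
  qed
  then show ?thesis by (simp add: diagrams_def)
qed

text \<open>The distinguished blocks of the two diagrams meet in \<open>Mid (k + 1)\<close>, so the
  component that contains them joins \<open>Top (k + 1)\<close> to
  \<open>Bot (k + 1)\<close>.\<close>

lemma diagram_comp_in_half_diagrams:
  assumes "a \<in> half_diagrams k" "b \<in> half_diagrams k"
  shows "diagram_comp (k + 1) a b \<in> half_diagrams k"
proof -
  have ab: "a \<in> diagrams (k + 1)" "b \<in> diagrams (k + 1)"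
    using assms by (auto simp: half_diagrams_def)
  obtain A where A: "A \<in> a" "Top (k + 1) \<in> A" "Bot (k + 1) \<in> A"
    using assms(1) by (auto simp: half_diagrams_def)
  obtain B where B: "B \<in> b" "Top (k + 1) \<in> B" "Bot (k + 1) \<in> B"
    using assms(2) by (auto simp: half_diagrams_def)
  let ?F = "(`) bot_to_mid ` a \<union> (`) top_to_mid ` b"
  have "bot_to_mid ` A \<in> ?F" "top_to_mid ` B \<in> ?F" using A B by auto
  moreover have A': "Top (k + 1) \<in> bot_to_mid ` A" "Mid (k + 1) \<in> bot_to_mid ` A"
    using A by force+
  moreover have B': "Bot (k + 1) \<in> top_to_mid ` B" "Mid (k + 1) \<in> top_to_mid ` B"
    using B by force+
  ultimately obtain C D where CD: "C \<in> components ?F" "bot_to_mid ` A \<subseteq> C"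
      "D \<in> components ?F" "top_to_mid ` B \<subseteq> D"
    using components_superset by metis
  then have "C = D"
    using A' B' by (intro partition_on_unique[OF partition_on_components[of ?F], of _ _ "Mid (k + 1)"]) auto
  then have "C - range Mid \<in> diagram_comp (k + 1) a b"
      "Top (k + 1) \<in> C - range Mid" "Bot (k + 1) \<in> C - range Mid"
    unfolding diagram_comp_def stack_components_conv(1)[OF ab] using CD A' B' by auto
  then show ?thesis
    unfolding half_diagrams_def using diagram_comp_in_diagrams[OF ab] by blast
qed

lemma words_nth: "w \<in> words n k \<Longrightarrow> i \<in> {1..k} \<Longrightarrow> w ! (i - 1) \<in> {1..n}"
  by (rule subsetD[of "set w"]) (auto simp: words_def)

lemma words_eqI:
  assumes "v \<in> words n k" "v' \<in> words n k" "\<And>i. i \<in> {1..k} \<Longrightarrow> v ! (i - 1) = v' ! (i - 1)"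
  shows "v = v'"
proof (rule nth_equalityI)
  show "length v = length v'" using assms by (simp add: words_def)
  show "v ! i = v' ! i" if "i < length v" for i
    using assms(3)[of "Suc i"] that assms(1) by (simp add: words_def)
qed

text \<open>The argument of \<open>g\<close> counts positions from 1, like the vertices, whereas
  list indices start at 0.\<close>

definition word_of :: "nat \<Rightarrow> (nat \<Rightarrow> nat) \<Rightarrow> nat list"
  where "word_of k g = map (\<lambda>i. g (i + 1)) [0..<k]"

lemma word_of_nth: "i \<in> {1..k} \<Longrightarrow> word_of k g ! (i - 1) = g i"
  by (auto simp: word_of_def)

lemma word_of_in_words: "(\<And>i. i \<in> {1..k} \<Longrightarrow> g i \<in> {1..n}) \<Longrightarrow> word_of k g \<in> words n k"
  by (auto simp: words_def word_of_def)

text \<open>A component that reaches an outer row forces the letters of its middle vertices. A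
  component inside the middle row may carry any of the \<open>n\<close> letters, independently of
  the others.\<close>

lemma card_extensions:
  assumes P: "partition_on (dbl {1..k} \<union> Mid ` {1..k}) P"
    and wu: "w \<in> words n k" "u \<in> words n k"
    and comp: "compatible {C - range Mid | C. C \<in> P \<and> \<not> C \<subseteq> range Mid} w u"
  shows "card {v \<in> words n k. \<forall>C\<in>P. const_on (label3 w v u) C} =
    n ^ card {C \<in> P. C \<subseteq> range Mid}"
proof -
  let ?M = "{C \<in> P. C \<subseteq> range Mid}"
  let ?V = "{v \<in> words n k. \<forall>C\<in>P. const_on (label3 w v u) C}"
  have finP: "finite P"
    by (rule finite_elements[OF _ P]) (simp add: finite_dbl)
  have ne: "C \<noteq> {}" if "C \<in> P" for C
    using that partition_onD3[OF P] by auto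
  have sub: "C \<subseteq> dbl {1..k} \<union> Mid ` {1..k}" if "C \<in> P" for C
    using that partition_onD1[OF P] by auto
  define fwd where "fwd v = (\<lambda>C\<in>?M. label3 w v u (SOME r. r \<in> C))" for v
  have fwd: "fwd v C = label3 w v u r" if "v \<in> ?V" "C \<in> ?M" "r \<in> C" for v C r
  proof -
    have "(SOME r. r \<in> C) \<in> C" using that(3) by (rule someI[of "\<lambda>r. r \<in> C"])
    moreover have "const_on (label3 w v u) C" using that by auto
    ultimately show ?thesis
      using that by (auto simp: fwd_def dest: const_onD)
  qed
  have "inj_on fwd ?V"
  proof (rule inj_onI)
    fix v v' assume v: "v \<in> ?V" "v' \<in> ?V" and eq: "fwd v = fwd v'"
    show "v = v'"
    proof (rule words_eqI)
      fix i assume "i \<in> {1..k}"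
      then obtain C where C: "C \<in> P" "Mid i \<in> C"
        using partition_onD1[OF P] by blast
      show "v ! (i - 1) = v' ! (i - 1)"
      proof (cases "C \<subseteq> range Mid")
        case True
        with C fwd[OF v(1), of C "Mid i"] fwd[OF v(2), of C "Mid i"] eq show ?thesis by simp
      next
        case False
        then obtain r where r: "r \<in> C" "r \<notin> range Mid" by auto
        then have "label3 w v u r = label3 w v' u r" by (cases r) auto
        moreover have "label3 w v u (Mid i) = label3 w v u r" "label3 w v' u (Mid i) = label3 w v' u r"
          using v C r(1) const_onD[of "label3 w _ u" C "Mid i" r] by blast+
        ultimately show ?thesis by simp
      qed
    qed (use v in auto)
  qed
  moreover have "fwd ` ?V = ?M \<rightarrow>\<^sub>E {1..n}"
  proof (intro set_eqI iffI)
    fix g assume "g \<in> fwd ` ?V"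
    then obtain v where v: "v \<in> ?V" "g = fwd v" by auto
    have "g C \<in> {1..n}" if C: "C \<in> ?M" for C
    proof -
      obtain r where r: "r \<in> C" using ne[of C] C by auto
      with C sub[of C] obtain i where "r = Mid i" "i \<in> {1..k}" by (auto simp: dbl_def)
      then show ?thesis
        using fwd[OF v(1) C r] v words_nth[of v n k i] by simp
    qed
    then show "g \<in> ?M \<rightarrow>\<^sub>E {1..n}" by (auto simp: v(2) fwd_def)
  next
    fix g assume g: "g \<in> ?M \<rightarrow>\<^sub>E {1..n}"
    \<comment> \<open>The letter prescribed on each component: free according to \<open>g\<close> on
      the inner ones, and on the others the letter of any outer vertex, well defined by
      \<open>comp\<close>.\<close>
    define val where "val C = (if C \<subseteq> range Mid then g C else label w u (SOME r. r \<in> C - range Mid))" for C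
    define cls where "cls r = (THE C. C \<in> P \<and> r \<in> C)" for r
    have cls: "cls r = C" if "C \<in> P" "r \<in> C" for C r
      unfolding cls_def
    proof (rule the_equality)
      show "D = C" if "D \<in> P \<and> r \<in> D" for D
        using that \<open>C \<in> P\<close> \<open>r \<in> C\<close> partition_on_unique[OF P] by blast
    qed (use that in simp)
    define v where "v = word_of k (\<lambda>i. val (cls (Mid i)))"
    have val_outer: "val C = label w u r" if "C \<in> P" "r \<in> C" "r \<notin> range Mid" for C r
    proof -
      have "(SOME r. r \<in> C - range Mid) \<in> C - range Mid" 
        by (rule someI[of "\<lambda>r. r \<in> C - range Mid" r]) (use that in auto)
      moreover have "const_on (label w u) (C - range Mid)"
        using comp that unfolding compatible_conv_const_on by blast
      ultimately have "label w u (SOME r. r \<in> C - range Mid) = label w u r"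
        using that by (auto dest: const_onD)
      then show ?thesis using that by (auto simp: val_def)
    qed
    have val_in: "val C \<in> {1..n}" if C: "C \<in> P" for C
    proof (cases "C \<subseteq> range Mid")
      case True with g C show ?thesis by (auto simp: val_def)
    next
      case False
      then obtain r where r: "r \<in> C" "r \<notin> range Mid" by auto
      with sub[OF C] have "r \<in> dbl {1..k}" by auto
      then have "label w u r \<in> {1..n}" using words_nth wu by (auto simp: dbl_def)
      with val_outer[OF C r] show ?thesis by simp
    qed
    have v: "v \<in> words n k"
      unfolding v_def
    proof (intro word_of_in_words val_in)
      fix i assume "i \<in> {1..k}"
      then obtain C where "C \<in> P" "Mid i \<in> C" using partition_onD1[OF P] by blast
      then show "cls (Mid i) \<in> P" using cls by auto
    qed
    have lab: "label3 w v u r = val C" if "C \<in> P" "r \<in> C" for C r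
    proof (cases "r \<in> range Mid")
      case True
      with sub[OF that(1)] that(2) obtain i where i: "r = Mid i" "i \<in> {1..k}" by (auto simp: dbl_def)
      with cls[OF that] show ?thesis by (simp add: v_def word_of_nth del: One_nat_def)
    next
      case False
      then have "label3 w v u r = label w u r" by (cases r) auto
      with val_outer[OF that False] show ?thesis by simp
    qed
    have vV: "v \<in> ?V" using v lab by (auto simp: const_on_def)
    have "fwd v = g"
    proof
      fix C
      show "fwd v C = g C"
      proof (cases "C \<in> ?M")
        case True
        then obtain r where r: "r \<in> C" using ne by auto
        have "fwd v C = val C" using fwd[OF vV True r] lab[of C r] True r by auto
        then show ?thesis using True by (simp add: val_def)
      next
        case False then show ?thesis using g by (auto simp: fwd_def PiE_def extensional_def)
      qed
    qed
    with vV show "g \<in> fwd ` ?V" by blast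
  qed
  ultimately have "card ?V = card (?M \<rightarrow>\<^sub>E {1..n})"
    using card_image[of fwd ?V] by simp
  also have "\<dots> = n ^ card ?M"
    using finP by (simp add: card_PiE)
  finally show ?thesis .
qed

text \<open>This is why the product of the partition algebra carries the factor n^l: it counts the
  free letters of the removed components. If the composite is incompatible, the outer letters
  already conflict within a component, and no middle word exists.\<close>

lemma card_compatible_between:
  assumes ab: "a \<in> diagrams k" "b \<in> diagrams k" and wu: "w \<in> words n k" "u \<in> words n k"
  shows "card {v \<in> words n k. compatible a w v \<and> compatible b v u} =
    n ^ removed k a b * of_bool (compatible (diagram_comp k a b) w u)"
proof (cases "compatible (diagram_comp k a b) w u")
  case True
  have "card {v \<in> words n k. compatible a w v \<and> compatible b v u} = n ^ removed k a b"
    unfolding compatible_stack[OF ab] removed_def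
    by (rule card_extensions[OF partition_on_stack_components[OF ab] wu])
      (rule True[unfolded diagram_comp_def])
  with True show ?thesis by simp
next
  case False
  then obtain C where C: "C \<in> stack_components k a b" "\<not> const_on (label w u) (C - range Mid)"
    by (auto simp: diagram_comp_def compatible_conv_const_on)
  have "label w u r = label3 w v u r" if "r \<in> C - range Mid" for r v
    using that by (cases r) auto
  then have "\<not> const_on (label3 w v u) (C - range Mid)" for v
    using C(2) const_on_cong[of "C - range Mid" "label w u" "label3 w v u"] by simp
  then have "\<not> const_on (label3 w v u) C" for v
    unfolding const_on_def by blast
  with C(1) have none: "{v \<in> words n k. compatible a w v \<and> compatible b v u} = {}"
    unfolding compatible_stack[OF ab] by auto
  show ?thesis
    unfolding none using False by simp
qed

lemma mat_part_mult:
  assumes wu: "w \<in> words n k" "u \<in> words n k"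
  shows "mat k (part_mult (of_nat n) k x y) w u = (\<Sum>v\<in>words n k. mat k x w v * mat k y v u)"
proof -
  let ?D = "diagrams k"
  have "(\<Sum>v\<in>words n k. mat k x w v * mat k y v u) =
      (\<Sum>v\<in>words n k. \<Sum>a\<in>?D. \<Sum>b\<in>?D. x a * y b * of_bool (compatible a w v \<and> compatible b v u))"
    unfolding mat_def sum_product
    by (rule sum.cong[OF refl], rule sum.cong[OF refl], rule sum.cong[OF refl]) (simp add: of_bool_conj)
  also have "\<dots> = (\<Sum>a\<in>?D. \<Sum>b\<in>?D. \<Sum>v\<in>words n k. x a * y b * of_bool (compatible a w v \<and> compatible b v u))"
    by (subst sum.swap, rule sum.cong[OF refl], rule sum.swap)
  also have "\<dots> = (\<Sum>a\<in>?D. \<Sum>b\<in>?D. x a * y b *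
      of_nat (card {v \<in> words n k. compatible a w v \<and> compatible b v u}))"
    by (simp add: sum_distrib_left[symmetric] of_bool_def sum.If_cases finite_words Int_def)
  also have "\<dots> = (\<Sum>a\<in>?D. \<Sum>b\<in>?D. x a * y b * of_nat n ^ removed k a b *
      of_bool (compatible (diagram_comp k a b) w u))"
    by (intro sum.cong refl) (simp add: card_compatible_between[OF _ _ wu])
  also have "\<dots> = mat k (part_mult (of_nat n) k x y) w u"
    unfolding part_mult_def bilinear_prod_def mat_sum mat_scale
    by (intro sum.cong refl) (simp add: mat_basis diagram_comp_in_diagrams)
  finally show ?thesis ..
qed

lemma part_mult_in_part_alg: "part_mult n k x y \<in> part_alg k"
  unfolding part_mult_def part_alg_def
  by (intro bilinear_prod_in_free_space diagram_comp_in_diagrams)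

lemma half_part_mult_in_half_part_alg: "half_part_mult n k x y \<in> half_part_alg k"
  unfolding half_part_mult_def half_part_alg_def
  by (intro bilinear_prod_in_free_space diagram_comp_in_half_diagrams)

lemma half_diagrams_subset: "half_diagrams k \<subseteq> diagrams (k + 1)"
  by (auto simp: half_diagrams_def)

lemma half_part_mult_eq:
  assumes "x \<in> half_part_alg k" "y \<in> half_part_alg k"
  shows "half_part_mult n k x y = part_mult n (k + 1) x y"
  unfolding half_part_mult_def part_mult_def bilinear_prod_def
proof (rule sum.mono_neutral_cong_left[OF finite_diagrams half_diagrams_subset])
  show "\<forall>a\<in>diagrams (k + 1) - half_diagrams k.
      (\<Sum>b\<in>diagrams (k + 1). (x a * y b * n ^ removed (k + 1) a b) *c basis (diagram_comp (k + 1) a b)) = 0"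
    using assms(1) by (auto simp: half_part_alg_def free_space_def fun_eq_iff sum_fun_apply)
  show "(\<Sum>b\<in>half_diagrams k. (x a * y b * n ^ removed (k + 1) a b) *c basis (diagram_comp (k + 1) a b)) =
      (\<Sum>b\<in>diagrams (k + 1). (x a * y b * n ^ removed (k + 1) a b) *c basis (diagram_comp (k + 1) a b))" for a
    using assms(2)
    by (intro sum.mono_neutral_left finite_diagrams half_diagrams_subset)
      (auto simp: half_part_alg_def free_space_def fun_eq_iff)
qed

section \<open>Faithfulness on large tensor space\<close>

text \<open>The diagram as an equivalence relation. Refinement becomes inclusion, and the number of
  related pairs measures how coarse the diagram is.\<close>

definition same_block :: "diagram \<Rightarrow> (vertex \<times> vertex) set"
  where "same_block d = (\<Union>B\<in>d. B \<times> B)"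

lemma same_block_iff:
  assumes "d \<in> diagrams k" "B \<in> d" "r \<in> B"
  shows "(r, s) \<in> same_block d \<longleftrightarrow> s \<in> B"
  unfolding same_block_def using partition_on_unique[OF diagramD[OF assms(1)] assms(2) _ assms(3)] assms
  by blast

lemma same_block_inj:
  assumes "d \<in> diagrams k" "e \<in> diagrams k" "same_block d = same_block e"
  shows "d = e"
proof -
  have sub: "d \<subseteq> e" if d: "d \<in> diagrams k" and e: "e \<in> diagrams k"
    and eq: "same_block d = same_block e" for d e
  proof
    fix B assume B: "B \<in> d"
    then obtain r where r: "r \<in> B" using partition_onD3[OF diagramD[OF d]] by (metis all_not_in_conv)
    then have "(r, r) \<in> same_block e"
      using same_block_iff[OF d B r] eq by blast
    then obtain C where C: "C \<in> e" "r \<in> C"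
      unfolding same_block_def by blast
    have "s \<in> B \<longleftrightarrow> s \<in> C" for s
      using same_block_iff[OF d B r, of s] same_block_iff[OF e C, of s] eq by simp
    then have "B = C" by blast
    with C show "B \<in> e" by simp
  qed
  from sub[OF assms] sub[OF assms(2,1) assms(3)[symmetric]] show ?thesis by auto
qed

lemma finite_same_block:
  assumes "d \<in> diagrams k"
  shows "finite (same_block d)"
proof (rule finite_subset)
  show "same_block d \<subseteq> dbl {1..k} \<times> dbl {1..k}"
    unfolding same_block_def partition_onD1[OF diagramD[OF assms]] by blast
qed (simp add: finite_dbl)

text \<open>The blocks of \<open>d\<close> are exactly the level sets of the labelling, so the
  compatible diagrams are exactly the refinements of \<open>d\<close>.\<close>

definition separates :: "nat \<Rightarrow> diagram \<Rightarrow> nat list \<Rightarrow> nat list \<Rightarrow> bool"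
  where "separates k d w u \<longleftrightarrow>
    (\<forall>r\<in>dbl {1..k}. \<forall>s\<in>dbl {1..k}. label w u r = label w u s \<longleftrightarrow> (r, s) \<in> same_block d)"

lemma compatible_iff_same_block:
  assumes "separates k d w u" "e \<in> diagrams k"
  shows "compatible e w u \<longleftrightarrow> same_block e \<subseteq> same_block d"
proof -
  have "B \<subseteq> dbl {1..k}" if "B \<in> e" for B
    using that partition_onD1[OF diagramD[OF assms(2)]] by auto
  then show ?thesis
    using assms(1) unfolding separates_def compatible_def same_block_def[of e]
    by (fastforce simp: subset_iff)
qed

text \<open>
  Among the diagrams in the support of a nonzero \<open>x\<close>, one with the fewest related pairs of
  vertices is the only one compatible with the words that separate its blocks.
\<close>

lemma mat_faithful:
  assumes x: "x \<in> free_space D" and D: "D \<subseteq> diagrams k"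
    and sep: "\<And>d. d \<in> D \<Longrightarrow> \<exists>w u. separates k d w u \<and> mat k x w u = 0"
  shows "x = 0"
proof (rule ccontr)
  assume "x \<noteq> 0"
  then obtain d0 where "x d0 \<noteq> 0" by (auto simp: fun_eq_iff)
  then obtain d where d: "x d \<noteq> 0"
    and min: "\<And>e. x e \<noteq> 0 \<Longrightarrow> card (same_block d) \<le> card (same_block e)"
    using ex_has_least_nat[of "\<lambda>d. x d \<noteq> 0" d0 "\<lambda>d. card (same_block d)"] by blast
  have supp: "e \<in> diagrams k" if "x e \<noteq> 0" for e
    using that x D by (auto simp: free_space_def)
  have "d \<in> D" using d x by (auto simp: free_space_def)
  from sep[OF this] obtain w u where wu: "separates k d w u" "mat k x w u = 0" by blast
  have other: "x e * of_bool (compatible e w u) = 0" if "e \<in> diagrams k - {d}" for e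
  proof (rule ccontr)
    assume "\<not> ?thesis"
    then have e: "x e \<noteq> 0" "same_block e \<subseteq> same_block d"
      using compatible_iff_same_block[OF wu(1)] that by auto
    then have "same_block e = same_block d"
      using min[OF e(1)] finite_same_block[OF supp[OF d]] by (intro card_seteq)
    with same_block_inj[of e k d] that supp[OF d] show False by auto
  qed
  have "mat k x w u = (\<Sum>e\<in>{d}. x e * of_bool (compatible e w u))"
    unfolding mat_def using other supp[OF d] by (intro sum.mono_neutral_right finite_diagrams) auto
  also have "\<dots> = x d"
    using compatible_iff_same_block[OF wu(1) supp[OF d]] by simp
  finally show False using d wu(2) by simp
qed

text \<open>Give each block its own letter. There are 2k vertices, hence at most 2k blocks, which is
  where the bound on \<open>n\<close> comes from.\<close>

lemma separating_words:
  assumes d: "d \<in> diagrams k" and n: "2 * k \<le> n"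
  shows "\<exists>f. f ` dbl {1..k} \<subseteq> {1..n} \<and> (\<forall>r\<in>dbl {1..k}. \<forall>s\<in>dbl {1..k}. f r = f s \<longleftrightarrow> (r, s) \<in> same_block d)"
proof -
  have P: "partition_on (dbl {1..k}) d" by (rule diagramD[OF d])
  have fin: "finite d" by (rule finite_elements[OF _ P]) (simp add: finite_dbl)
  have "card (dbl {1..k}) = 2 * k"
    unfolding dbl_def by (subst card_Un_disjoint) (auto simp: card_image inj_on_def)
  define B where "B r = (THE C. C \<in> d \<and> r \<in> C)" for r
  have B: "B r = C" if "C \<in> d" "r \<in> C" for r C
    unfolding B_def
  proof (rule the_equality)
    show "D = C" if "D \<in> d \<and> r \<in> D" for D
      using that \<open>C \<in> d\<close> \<open>r \<in> C\<close> partition_on_unique[OF P] by blast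
  qed (use that in simp)
  have Bin: "B r \<in> d" "r \<in> B r" if "r \<in> dbl {1..k}" for r
    using that partition_onD1[OF P] B by auto
  have "d \<subseteq> B ` dbl {1..k}"
  proof
    fix C assume C: "C \<in> d"
    then obtain r where r: "r \<in> C" using partition_onD3[OF P] by (metis all_not_in_conv)
    then have "r \<in> dbl {1..k}" using C partition_onD1[OF P] by auto
    with B[OF C r] show "C \<in> B ` dbl {1..k}" by auto
  qed
  then have "card d \<le> card (dbl {1..k})"
    by (intro surj_card_le) (simp_all add: finite_dbl)
  with \<open>card (dbl {1..k}) = 2 * k\<close> n have "card d \<le> card {1..n}" by simp
  then obtain g where g: "inj_on g d" "g ` d \<subseteq> {1..n}"
    using card_le_inj[OF fin, of "{1..n}"] by auto
  have "g (B r) = g (B s) \<longleftrightarrow> (r, s) \<in> same_block d" if "r \<in> dbl {1..k}" "s \<in> dbl {1..k}" for r s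
  proof -
    have "g (B r) = g (B s) \<longleftrightarrow> B r = B s"
      using that Bin g(1) by (auto simp: inj_on_eq_iff)
    also have "\<dots> \<longleftrightarrow> (r, s) \<in> same_block d"
      using same_block_iff[OF d Bin[OF that(1)], of s] Bin[OF that(2)] B[OF Bin(1)[OF that(1)], of s] by auto
    finally show ?thesis .
  qed
  moreover have "(\<lambda>r. g (B r)) ` dbl {1..k} \<subseteq> {1..n}" using g(2) Bin by auto
  ultimately show ?thesis by (intro exI[of _ "\<lambda>r. g (B r)"]) auto
qed

lemma label_word_of:
  "r \<in> dbl {1..k} \<Longrightarrow> label (word_of k (\<lambda>i. f (Top i))) (word_of k (\<lambda>i. f (Bot i))) r = f r"
  by (auto simp: dbl_def word_of_nth simp del: One_nat_def)

lemma separates_word_of: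
  assumes "\<forall>r\<in>dbl {1..k}. \<forall>s\<in>dbl {1..k}. f r = f s \<longleftrightarrow> (r, s) \<in> same_block d"
  shows "separates k d (word_of k (\<lambda>i. f (Top i))) (word_of k (\<lambda>i. f (Bot i)))"
  using assms unfolding separates_def by (simp add: label_word_of)

lemma mat_eq_zero:
  assumes "x \<in> part_alg k" "2 * k \<le> n"
    and "\<And>w u. w \<in> words n k \<Longrightarrow> u \<in> words n k \<Longrightarrow> mat k x w u = 0"
  shows "x = 0"
proof (rule mat_faithful[OF _ subset_refl])
  show "x \<in> free_space (diagrams k)" using assms(1) by (simp add: part_alg_def)
  fix d assume "d \<in> diagrams k"
  from separating_words[OF this assms(2)] obtain f where f: "f ` dbl {1..k} \<subseteq> {1..n}"
    "\<forall>r\<in>dbl {1..k}. \<forall>s\<in>dbl {1..k}. f r = f s \<longleftrightarrow> (r, s) \<in> same_block d" by blast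
  have "word_of k (\<lambda>i. f (Top i)) \<in> words n k" "word_of k (\<lambda>i. f (Bot i)) \<in> words n k"
    by (rule word_of_in_words, rule subsetD[OF f(1)], simp add: dbl_def)+
  with separates_word_of[OF f(2)] assms(3)
  show "\<exists>w u. separates k d w u \<and> mat k x w u = 0" by blast
qed

lemma word_of_Suc: "word_of (k + 1) g = word_of k g @ [g (k + 1)]"
  by (simp add: word_of_def)

lemma half_mat_eq_zero:
  assumes "x \<in> half_part_alg k" "2 * (k + 1) \<le> n"
    and "\<And>w u. w \<in> words n k \<Longrightarrow> u \<in> words n k \<Longrightarrow> mat (k + 1) x (w @ [n]) (u @ [n]) = 0"
  shows "x = 0"
proof (rule mat_faithful[OF _ half_diagrams_subset])
  show "x \<in> free_space (half_diagrams k)" using assms(1) by (simp add: half_part_alg_def)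
  fix d assume d: "d \<in> half_diagrams k"
  then have "d \<in> diagrams (k + 1)" using half_diagrams_subset by auto
  from separating_words[OF this assms(2)] obtain f where f: "f ` dbl {1..k + 1} \<subseteq> {1..n}"
    "\<forall>r\<in>dbl {1..k + 1}. \<forall>s\<in>dbl {1..k + 1}. f r = f s \<longleftrightarrow> (r, s) \<in> same_block d" by blast
  \<comment> \<open>Renames the letters so that the block of \<open>Top (k + 1)\<close> carries
    \<open>n\<close>. In a half diagram this block also contains \<open>Bot (k + 1)\<close>, so both
    words end in \<open>n\<close>.\<close>
  define g where "g = transpose (f (Top (k + 1))) n \<circ> f"
  have TB: "Top (k + 1) \<in> dbl {1..k + 1}" "Bot (k + 1) \<in> dbl {1..k + 1}" by (auto simp: dbl_def)
  have "f (Top (k + 1)) = f (Bot (k + 1))"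
    using d f(2) TB by (auto simp: half_diagrams_def same_block_def)
  then have gn: "g (Top (k + 1)) = n" "g (Bot (k + 1)) = n" by (simp_all add: g_def)
  have "f (Top (k + 1)) \<in> {1..n}" using f(1) TB by blast
  then have perm: "transpose (f (Top (k + 1))) n permutes {1..n}"
    using assms(2) by (intro permutes_swap_id) auto
  have g: "\<forall>r\<in>dbl {1..k + 1}. \<forall>s\<in>dbl {1..k + 1}. g r = g s \<longleftrightarrow> (r, s) \<in> same_block d"
    using f(2) unfolding g_def comp_def inj_eq[OF permutes_inj[OF perm]] .
  have gin: "g r \<in> {1..n}" if "r \<in> dbl {1..k + 1}" for r
    using permutes_in_image[OF perm] f(1) that unfolding g_def comp_def by blast
  have "word_of k (\<lambda>i. g (Top i)) \<in> words n k" "word_of k (\<lambda>i. g (Bot i)) \<in> words n k"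
    by (rule word_of_in_words, rule gin, simp add: dbl_def)+
  with separates_word_of[OF g] assms(3)
  show "\<exists>w u. separates (k + 1) d w u \<and> mat (k + 1) x w u = 0"
    unfolding word_of_Suc gn by blast
qed

section \<open>The matrices of the central elements\<close>

text \<open>\<open>Q\<close> collects the columns that \<open>I\<close> must not split. With
  \<open>Q = {}\<close> the resulting range is that of \<open>p_elem\<close>, with
  \<open>Q = {k + 1}\<close> that of \<open>p_tilde\<close>, so that one computation covers both
  elements.\<close>

definition locked_subsets :: "nat set \<Rightarrow> nat set \<Rightarrow> vertex set set"
  where "locked_subsets Q S = {I. I \<subseteq> dbl S \<and>
    (\<forall>q\<in>Q \<inter> S. {Top q, Bot q} \<subseteq> I \<or> {Top q, Bot q} \<subseteq> dbl S - I)}"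

definition pair_subsets :: "nat set \<Rightarrow> nat set \<Rightarrow> vertex set set"
  where "pair_subsets Q S = (\<lambda>l. dbl {l}) ` (S - Q) \<union> (\<lambda>l. dbl (S - {l})) ` (S - Q)"

definition p_range :: "nat set \<Rightarrow> nat set \<Rightarrow> vertex set set"
  where "p_range Q S = locked_subsets Q S - ({{}, dbl S} \<union> pair_subsets Q S)"

definition p_gen :: "nat \<Rightarrow> nat set \<Rightarrow> nat set \<Rightarrow> diagram \<Rightarrow> complex"
  where "p_gen k Q S = (\<Sum>I\<in>p_range Q S. (1/2 * sg S I) *c basis (d_diag k S I))"

lemma dbl_simps [simp]: "Top l \<in> dbl S \<longleftrightarrow> l \<in> S" "Bot l \<in> dbl S \<longleftrightarrow> l \<in> S" "Mid l \<notin> dbl S"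
  by (auto simp: dbl_def)

lemma vertex_set_eqI:
  assumes "\<And>l. Top l \<in> A \<longleftrightarrow> Top l \<in> B" "\<And>l. Bot l \<in> A \<longleftrightarrow> Bot l \<in> B" "\<And>l. Mid l \<in> A \<longleftrightarrow> Mid l \<in> B"
  shows "A = B"
proof (rule set_eqI)
  show "x \<in> A \<longleftrightarrow> x \<in> B" for x
    using assms by (cases x) auto
qed

lemma dbl_singleton: "dbl {l} = {Top l, Bot l}"
  by (auto simp: dbl_def)

lemma dbl_minus: "dbl S - dbl T = dbl (S - T)"
  by (rule vertex_set_eqI) auto

lemma dbl_empty: "dbl {} = {}"
  by (auto simp: dbl_def)

lemma dbl_eq_iff: "dbl S = dbl T \<longleftrightarrow> S = T"
  using dbl_simps(1) by blast

lemma dbl_subset_iff: "dbl S \<subseteq> dbl T \<longleftrightarrow> S \<subseteq> T"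
  by (auto simp: dbl_def)

lemma p_elem_eq_p_gen: "p_elem k S = p_gen k {} S"
proof -
  have "{I. I \<subseteq> dbl S \<and> I \<noteq> {} \<and> I \<noteq> dbl S \<and>
      (\<forall>l\<in>S. I \<noteq> {Top l, Bot l} \<and> I \<noteq> dbl S - {Top l, Bot l})} = p_range {} S"
    unfolding p_range_def locked_subsets_def pair_subsets_def dbl_singleton[symmetric] dbl_minus
    by blast
  then show ?thesis
    by (simp only: p_elem_def p_gen_def)
qed

lemma p_tilde_eq_p_gen: "k + 1 \<in> S \<Longrightarrow> p_tilde k S = p_gen (k + 1) {k + 1} S"
proof -
  assume "k + 1 \<in> S"
  then have "{k + 1} \<inter> S = {k + 1}" by blast
  then have "{I. I \<subseteq> dbl S \<and>
      ({Top (k + 1), Bot (k + 1)} \<subseteq> I \<or> {Top (k + 1), Bot (k + 1)} \<subseteq> dbl S - I) \<and>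
      I \<noteq> {} \<and> I \<noteq> dbl S \<and>
      (\<forall>l\<in>S - {k + 1}. I \<noteq> {Top l, Bot l} \<and> I \<noteq> dbl S - {Top l, Bot l})} = p_range {k + 1} S"
    unfolding p_range_def locked_subsets_def pair_subsets_def dbl_singleton[symmetric] dbl_minus
    by blast
  then show ?thesis
    by (simp only: p_tilde_def p_gen_def)
qed

section \<open>Factorization of the signed sum over \<open>I\<close> into columns\<close>

lemma finite_locked_subsets: "finite S \<Longrightarrow> finite (locked_subsets Q S)"
  by (rule finite_subset[of _ "Pow (dbl S)"]) (auto simp: locked_subsets_def finite_dbl)

lemma prod_of_bool: "finite S \<Longrightarrow> (\<Prod>l\<in>S. of_bool (P l)) = (of_bool (\<forall>l\<in>S. P l) :: 'a::comm_semiring_1)"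
  by (induction S rule: finite_induct) auto

text \<open>A column contributes -1 exactly if both of its vertices are on the same side of
  \<open>I\<close>. This local form of the sign lets the sum over \<open>I\<close> factor.\<close>

lemma sg_prod:
  assumes "finite S" "I \<subseteq> dbl S"
  shows "sg S I = (\<Prod>l\<in>S. if (Top l \<in> I) = (Bot l \<in> I) then - 1 else 1)"
proof -
  let ?A = "{l \<in> S. {Top l, Bot l} \<subseteq> I}" and ?B = "{l \<in> S. {Top l, Bot l} \<subseteq> dbl S - I}"
  have "card ?A + card ?B = card (?A \<union> ?B)"
    by (rule card_Un_disjoint[symmetric]) (use assms in auto)
  also have "?A \<union> ?B = {l \<in> S. (Top l \<in> I) = (Bot l \<in> I)}"
    by auto
  finally have "sg S I = (\<Prod>l\<in>{l \<in> S. (Top l \<in> I) = (Bot l \<in> I)}. - 1)"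
    by (simp add: sg_def)
  also have "\<dots> = (\<Prod>l\<in>S. if (Top l \<in> I) = (Bot l \<in> I) then - 1 else 1)"
    by (rule prod.inter_filter[OF assms(1)])
  finally show ?thesis .
qed

lemma sg_dbl:
  assumes "finite S" "T \<subseteq> S"
  shows "sg S (dbl T) = (- 1) ^ card S"
  using assms by (subst sg_prod) (auto simp: dbl_subset_iff)

text \<open>The matrix of the transposition of \<open>i \<noteq> j\<close> is the identity minus \<open>diff_entry i j\<close>.\<close>

definition diff_entry :: "nat \<Rightarrow> nat \<Rightarrow> nat \<Rightarrow> nat \<Rightarrow> complex"
  where "diff_entry i j x y = of_bool (x = i \<and> y = i) + of_bool (x = j \<and> y = j)
    - of_bool (x = i \<and> y = j) - of_bool (x = j \<and> y = i)"

lemma transpose_entry: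
  "i \<noteq> j \<Longrightarrow> of_bool (transpose i j x = y) = - diff_entry i j x y + of_bool (x = y)"
  by (auto simp: diff_entry_def transpose_def)

text \<open>The pair \<open>c\<close> records whether the top and the bottom vertex of column
  \<open>l\<close> belong to \<open>I\<close>; vertices in \<open>I\<close> must be labelled
  \<open>i\<close>, the others \<open>j\<close>.\<close>

definition choice_entry :: "(vertex \<Rightarrow> nat) \<Rightarrow> nat \<Rightarrow> nat \<Rightarrow> nat \<Rightarrow> bool \<times> bool \<Rightarrow> complex"
  where "choice_entry L i j l c = (if fst c = snd c then - 1 else 1) *
    of_bool (L (Top l) = (if fst c then i else j)) * of_bool (L (Bot l) = (if snd c then i else j))"

definition choices :: "nat set \<Rightarrow> nat \<Rightarrow> (bool \<times> bool) set"
  where "choices Q l = (if l \<in> Q then {(True, True), (False, False)} else UNIV)"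

text \<open>The four choices are the four terms of \<open>diff_entry\<close>. For
  \<open>i = j\<close> they cancel, and both sides are 0.\<close>

lemma sum_choices_free:
  "l \<notin> Q \<Longrightarrow> (\<Sum>c\<in>choices Q l. choice_entry L i j l c) = - diff_entry i j (L (Top l)) (L (Bot l))"
proof -
  assume "l \<notin> Q"
  then have "choices Q l = {(True, True), (True, False), (False, True), (False, False)}"
    by (auto simp: choices_def)
  then show ?thesis
    by (simp add: choice_entry_def diff_entry_def of_bool_conj)
qed

text \<open>The two omitted choices would label one end of the column \<open>i\<close> and the other
  \<open>j\<close>, which is impossible if the ends agree and \<open>i\<close> differs from
  \<open>j\<close>. Unlike for a free column, this fails for \<open>i = j\<close>.\<close>

lemma sum_choices_locked:
  assumes "l \<in> Q" "L (Top l) = L (Bot l)" "i \<noteq> j"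
  shows "(\<Sum>c\<in>choices Q l. choice_entry L i j l c) = - diff_entry i j (L (Top l)) (L (Bot l))"
  using assms by (auto simp: choices_def choice_entry_def diff_entry_def)

lemma prod_choice_entry:
  assumes "finite S" "I \<subseteq> dbl S"
  shows "(\<Prod>l\<in>S. choice_entry L i j l (Top l \<in> I, Bot l \<in> I)) =
    sg S I * (of_bool (\<forall>r\<in>I. L r = i) * of_bool (\<forall>r\<in>dbl S - I. L r = j))"
proof -
  have "(\<forall>l\<in>S. L (Top l) = (if Top l \<in> I then i else j) \<and> L (Bot l) = (if Bot l \<in> I then i else j)) \<longleftrightarrow>
      (\<forall>r\<in>dbl S. L r = (if r \<in> I then i else j))"
    by (auto simp: dbl_def ball_Un)
  also have "\<dots> \<longleftrightarrow> (\<forall>r\<in>I. L r = i) \<and> (\<forall>r\<in>dbl S - I. L r = j)"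
    using assms(2) by auto
  finally show ?thesis
    by (simp only: choice_entry_def fst_conv snd_conv prod.distrib sg_prod[OF assms] prod_of_bool[OF assms(1)]
        of_bool_conj[symmetric] mult.assoc)
qed

text \<open>The distributive law: to choose \<open>I\<close> is to choose independently, for each
  column of \<open>S\<close>, which of its ends lie in \<open>I\<close>.\<close>

lemma sum_locked_subsets_prod:
  assumes "finite S"
  shows "(\<Sum>I\<in>locked_subsets Q S. sg S I * (of_bool (\<forall>r\<in>I. L r = i) * of_bool (\<forall>r\<in>dbl S - I. L r = j))) =
    (\<Prod>l\<in>S. \<Sum>c\<in>choices Q l. choice_entry L i j l c)"
proof -
  let ?I = "\<lambda>f. {v. \<exists>l\<in>S. v = Top l \<and> fst (f l) \<or> v = Bot l \<and> snd (f l)}"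
  have mem: "Top l \<in> ?I f \<longleftrightarrow> l \<in> S \<and> fst (f l)" "Bot l \<in> ?I f \<longleftrightarrow> l \<in> S \<and> snd (f l)" "Mid l \<notin> ?I f" for f l
    by auto
  have "(\<Prod>l\<in>S. \<Sum>c\<in>choices Q l. choice_entry L i j l c) =
      (\<Sum>f\<in>PiE S (choices Q). \<Prod>l\<in>S. choice_entry L i j l (f l))"
    by (rule prod_sum_PiE[OF assms]) (auto simp: choices_def)
  also have "\<dots> = (\<Sum>I\<in>locked_subsets Q S. sg S I * (of_bool (\<forall>r\<in>I. L r = i) * of_bool (\<forall>r\<in>dbl S - I. L r = j)))"
  proof (rule sum.reindex_bij_witness[of _ "\<lambda>I. \<lambda>l\<in>S. (Top l \<in> I, Bot l \<in> I)" ?I])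
    fix f assume f: "f \<in> PiE S (choices Q)"
    show "(\<lambda>l\<in>S. (Top l \<in> ?I f, Bot l \<in> ?I f)) = f"
    proof
      show "(\<lambda>l\<in>S. (Top l \<in> ?I f, Bot l \<in> ?I f)) l = f l" for l
        using PiE_arb[OF f, of l] by (cases "l \<in> S") (simp_all only: restrict_apply mem if_True if_False simp_thms prod.collapse)
    qed
    have sub: "?I f \<subseteq> dbl S" by auto
    have "f q = (True, True) \<or> f q = (False, False)" if "q \<in> Q \<inter> S" for q
      using PiE_mem[OF f, of q] that by (auto simp: choices_def)
    then show "?I f \<in> locked_subsets Q S"
      unfolding locked_subsets_def using sub by fastforce
    have "(\<Prod>l\<in>S. choice_entry L i j l (f l)) = (\<Prod>l\<in>S. choice_entry L i j l (Top l \<in> ?I f, Bot l \<in> ?I f))"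
      by (rule prod.cong) (simp_all add: mem)
    then show "sg S (?I f) * (of_bool (\<forall>r\<in>?I f. L r = i) * of_bool (\<forall>r\<in>dbl S - ?I f. L r = j)) =
        (\<Prod>l\<in>S. choice_entry L i j l (f l))"
      by (simp only: prod_choice_entry[OF assms sub])
  next
    fix I assume I: "I \<in> locked_subsets Q S"
    then have sub: "I \<subseteq> dbl S" by (simp add: locked_subsets_def)
    show "?I (\<lambda>l\<in>S. (Top l \<in> I, Bot l \<in> I)) = I"
      using sub by (intro vertex_set_eqI) auto
    show "(\<lambda>l\<in>S. (Top l \<in> I, Bot l \<in> I)) \<in> PiE S (choices Q)"
      using I by (auto simp: locked_subsets_def choices_def)
  qed
  finally show ?thesis ..
qed

text \<open>Counts the letters with which all of \<open>I\<close> can be labelled. Its value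
  \<open>n\<close> at the empty set is the source of the \<open>n\<close> in the coefficient of
  \<open>b_diag\<close>.\<close>

definition label_count :: "nat \<Rightarrow> (vertex \<Rightarrow> nat) \<Rightarrow> vertex set \<Rightarrow> complex"
  where "label_count n L I = (if I = {} then of_nat n else of_bool (const_on L I))"

lemma sum_label_count:
  assumes "L ` I \<subseteq> {1..n}"
  shows "(\<Sum>i\<in>{1..n}. of_bool (\<forall>r\<in>I. L r = i)) = label_count n L I"
proof (cases "I = {}")
  case False
  then obtain r where r: "r \<in> I" by blast
  have "(\<forall>s\<in>I. L s = i) \<longleftrightarrow> i = L r \<and> const_on L I" for i
    unfolding const_on_def using r by metis
  then have "(\<Sum>i\<in>{1..n}. of_bool (\<forall>r\<in>I. L r = i)) = (\<Sum>i\<in>{1..n}. if L r = i then of_bool (const_on L I) else (0::complex))"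
    by (intro sum.cong refl) auto
  also have "\<dots> = of_bool (const_on L I)"
    using assms r by (auto simp: sum.delta')
  finally show ?thesis using False by (simp add: label_count_def)
qed (simp add: label_count_def)

text \<open>The contribution of the positions in \<open>S\<close> to the sum over all
  transpositions; each transposition arises from two ordered pairs, hence the factor 1/2.\<close>

definition swap_weight :: "nat \<Rightarrow> (vertex \<Rightarrow> nat) \<Rightarrow> nat set \<Rightarrow> complex"
  where "swap_weight n L S = 1/2 * (\<Sum>i\<in>{1..n}. \<Sum>j\<in>{1..n} - {i}. \<Prod>l\<in>S. - diff_entry i j (L (Top l)) (L (Bot l)))"

text \<open>Read from right to left: as the terms \<open>i = j\<close> vanish they may be added, and
  then \<open>i\<close> and \<open>j\<close> range independently, one constrained by
  \<open>I\<close> only and the other by its complement only.\<close>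

lemma sum_locked_subsets:
  assumes S: "finite S" "L ` dbl S \<subseteq> {1..n}" "\<not> S \<subseteq> Q"
    and Q: "\<And>q. q \<in> Q \<Longrightarrow> L (Top q) = L (Bot q)"
  shows "1/2 * (\<Sum>I\<in>locked_subsets Q S. sg S I * (label_count n L I * label_count n L (dbl S - I))) = swap_weight n L S"
proof -
  let ?b = "\<lambda>I i j. of_bool (\<forall>r\<in>I. L r = i) * of_bool (\<forall>r\<in>dbl S - I. L r = j) :: complex"
  have "label_count n L I * label_count n L (dbl S - I) = (\<Sum>i\<in>{1..n}. \<Sum>j\<in>{1..n}. ?b I i j)"
    if "I \<in> locked_subsets Q S" for I
  proof -
    have "I \<subseteq> dbl S" using that by (simp add: locked_subsets_def)
    then have "L ` I \<subseteq> {1..n}" "L ` (dbl S - I) \<subseteq> {1..n}" using S(2) by blast+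
    then show ?thesis
      by (simp only: sum_label_count[symmetric] sum_product)
  qed
  then have "(\<Sum>I\<in>locked_subsets Q S. sg S I * (label_count n L I * label_count n L (dbl S - I))) =
      (\<Sum>I\<in>locked_subsets Q S. \<Sum>i\<in>{1..n}. \<Sum>j\<in>{1..n}. sg S I * ?b I i j)"
    by (intro sum.cong[OF refl]) (simp only: sum_distrib_left)
  also have "\<dots> = (\<Sum>i\<in>{1..n}. \<Sum>I\<in>locked_subsets Q S. \<Sum>j\<in>{1..n}. sg S I * ?b I i j)"
    by (rule sum.swap)
  also have "\<dots> = (\<Sum>i\<in>{1..n}. \<Sum>j\<in>{1..n}. \<Sum>I\<in>locked_subsets Q S. sg S I * ?b I i j)"
    by (rule sum.cong[OF refl], rule sum.swap)
  also have "\<dots> = (\<Sum>i\<in>{1..n}. \<Sum>j\<in>{1..n}. \<Prod>l\<in>S. \<Sum>c\<in>choices Q l. choice_entry L i j l c)"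
    by (simp only: sum_locked_subsets_prod[OF S(1)])
  also have "\<dots> = (\<Sum>i\<in>{1..n}. \<Sum>j\<in>{1..n} - {i}. \<Prod>l\<in>S. - diff_entry i j (L (Top l)) (L (Bot l)))"
  proof (rule sum.cong[OF refl], rule sum.mono_neutral_cong_right)
    fix i
    \<comment> \<open>A single unlocked column suffices: its factor for \<open>i = j\<close> is
      zero, whatever the locked column contributes.\<close>
    obtain l where l: "l \<in> S" "l \<notin> Q" using S(3) by blast
    have "(\<Prod>l\<in>S. \<Sum>c\<in>choices Q l. choice_entry L i i l c) = 0"
      using l S(1) by (intro prod_zero bexI[of _ l]) (auto simp: sum_choices_free diff_entry_def)
    then show "\<forall>j\<in>{1..n} - ({1..n} - {i}). (\<Prod>l\<in>S. \<Sum>c\<in>choices Q l. choice_entry L i j l c) = 0"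
      by auto
    show "(\<Prod>l\<in>S. \<Sum>c\<in>choices Q l. choice_entry L i j l c) = (\<Prod>l\<in>S. - diff_entry i j (L (Top l)) (L (Bot l)))"
      if "j \<in> {1..n} - {i}" for j
    proof (rule prod.cong[OF refl])
      show "(\<Sum>c\<in>choices Q l. choice_entry L i j l c) = - diff_entry i j (L (Top l)) (L (Bot l))" for l
        using that Q sum_choices_free[of l Q L i j] sum_choices_locked[of l Q L i j] by (cases "l \<in> Q") auto
    qed
  qed auto
  finally show ?thesis
    by (simp only: swap_weight_def)
qed

lemma pair_subsets_subset: "pair_subsets Q S \<subseteq> locked_subsets Q S"
  unfolding pair_subsets_def locked_subsets_def by (auto simp: dbl_def)

lemma empty_full_subset: "{{}, dbl S} \<subseteq> locked_subsets Q S"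
  unfolding locked_subsets_def by auto

lemma sum_locked_subsets_split:
  assumes "finite S"
  shows "sum f (locked_subsets Q S) = sum f (p_range Q S) + sum f ({{}, dbl S} \<union> pair_subsets Q S)"
  unfolding p_range_def
  using pair_subsets_subset empty_full_subset
  by (intro sum.subset_diff finite_locked_subsets[OF assms]) blast

text \<open>The bound on \<open>card S\<close> keeps the two kinds of excluded subsets apart: for
  \<open>S = {l}\<close>, the set \<open>dbl {l}\<close> is all of \<open>dbl S\<close> and its
  complement is empty.\<close>

lemma sum_excluded_subsets:
  assumes "finite S" "2 \<le> card S"
  shows "sum f ({{}, dbl S} \<union> pair_subsets Q S) = f {} + f (dbl S) + sum f (pair_subsets Q S)"
proof -
  have ne: "S \<noteq> {}" "S - {l} \<noteq> {}" "S \<noteq> {l}" for l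
    using assms(2) by (auto dest: subset_singletonD)
  have d: "{{}, dbl S} \<inter> pair_subsets Q S = {}"
    using ne unfolding pair_subsets_def dbl_empty[symmetric] by (auto simp: dbl_eq_iff)
  have "sum f ({{}, dbl S} \<union> pair_subsets Q S) = sum f {{}, dbl S} + sum f (pair_subsets Q S)"
    by (rule sum.union_disjoint[OF _ _ d]) (auto simp: pair_subsets_def assms(1))
  also have "sum f {{}, dbl S} = f {} + f (dbl S)"
    using ne(1) dbl_eq_iff[of "{}" S] by (simp add: dbl_empty)
  finally show ?thesis .
qed

text \<open>From three columns on, the complement of one column is never a single column, so every
  \<open>l\<close> accounts for two subsets.\<close>

lemma sum_pair_subsets:
  assumes "finite S" "3 \<le> card S" and "\<And>l. l \<in> S - Q \<Longrightarrow> f (dbl {l}) = g l \<and> f (dbl (S - {l})) = (g l :: complex)"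
  shows "sum f (pair_subsets Q S) = 2 * sum g (S - Q)"
proof -
  have card: "card (S - {l}) \<noteq> 1" if "l \<in> S" for l
    using assms(1,2) that by simp
  have "(\<lambda>l. dbl {l}) ` (S - Q) \<inter> (\<lambda>l. dbl (S - {l})) ` (S - Q) = {}"
  proof -
    have "dbl {m} \<noteq> dbl (S - {l})" if "l \<in> S" for l m
      using card[OF that] by (metis dbl_eq_iff card.empty card.insert empty_iff finite.emptyI One_nat_def)
    then show ?thesis by blast
  qed
  then have "sum f (pair_subsets Q S) = sum f ((\<lambda>l. dbl {l}) ` (S - Q)) + sum f ((\<lambda>l. dbl (S - {l})) ` (S - Q))"
    unfolding pair_subsets_def using assms(1) by (intro sum.union_disjoint) auto
  also have "sum f ((\<lambda>l. dbl {l}) ` (S - Q)) = sum g (S - Q)"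
    by (rule sum.reindex_cong[of "\<lambda>l. dbl {l}"]) (auto simp: inj_on_def dbl_eq_iff assms(3))
  also have "sum f ((\<lambda>l. dbl (S - {l})) ` (S - Q)) = sum g (S - Q)"
    by (rule sum.reindex_cong[of "\<lambda>l. dbl (S - {l})"]) (auto simp: inj_on_def dbl_eq_iff assms(3))
  finally show ?thesis by simp
qed

text \<open>For two columns each is the complement of the other. Hence there are only two such
  subsets, and they are the same ones if one of the columns is in \<open>Q\<close>.\<close>

lemma sum_pair_subsets_two:
  assumes "card S = 2" "Q \<subseteq> S" "card Q \<le> 1" and "\<And>l. l \<in> S \<Longrightarrow> f (dbl {l}) = (c::complex)"
  shows "sum f (pair_subsets Q S) = 2 * c"
proof -
  obtain l m where S: "S = {l, m}" "l \<noteq> m" using assms(1) by (auto simp: card_2_iff)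
  have Q: "\<not> S \<subseteq> Q" using assms(1-3) by auto
  have "pair_subsets Q S = {dbl {l}, dbl {m}}"
  proof -
    have d: "S - {l} = {m}" "S - {m} = {l}" using S by auto
    consider "S - Q = {l}" | "S - Q = {m}" | "S - Q = {l, m}" using Q S by blast
    then show ?thesis
      unfolding pair_subsets_def by cases (simp_all add: d insert_commute)
  qed
  then show ?thesis
    using S assms(4) by (simp add: dbl_eq_iff)
qed


section \<open>The coefficients of the diagrams in the expansion\<close>

definition vert :: "(vertex \<Rightarrow> nat) \<Rightarrow> nat \<Rightarrow> nat set \<Rightarrow> complex"
  where "vert L K S = of_bool (\<forall>l\<in>{1..K} - S. L (Top l) = L (Bot l))"

text \<open>\<open>vert\<close>, \<open>b_entry\<close> and \<open>p_entry\<close> are the matrix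
  entries of the strands outside \<open>S\<close>, of \<open>b_diag\<close> and of
  \<open>p_gen\<close>, written in terms of the labelling alone.\<close>

definition b_entry :: "(vertex \<Rightarrow> nat) \<Rightarrow> nat \<Rightarrow> nat set \<Rightarrow> complex"
  where "b_entry L K S = of_bool (const_on L (dbl S)) * vert L K S"

definition p_entry :: "(vertex \<Rightarrow> nat) \<Rightarrow> nat \<Rightarrow> nat set \<Rightarrow> nat set \<Rightarrow> complex"
  where "p_entry L K Q S = (\<Sum>I\<in>p_range Q S.
    1/2 * sg S I * (of_bool (const_on L I) * of_bool (const_on L (dbl S - I)) * vert L K S))"

lemma vert_remove:
  assumes "l \<in> S" "S \<subseteq> {1..K}"
  shows "of_bool (L (Top l) = L (Bot l)) * vert L K S = vert L K (S - {l})"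
proof -
  have "{1..K} - (S - {l}) = insert l ({1..K} - S)" using assms by auto
  then show ?thesis by (simp add: vert_def)
qed

lemma const_on_dbl_singleton: "const_on L (dbl {l}) \<longleftrightarrow> L (Top l) = L (Bot l)"
  by (auto simp: const_on_def dbl_singleton)

lemma sum_p_range:
  "(\<Sum>I\<in>p_range Q S. sg S I * (label_count n L I * label_count n L (dbl S - I))) * vert L K S =
    2 * p_entry L K Q S"
proof -
  have "sg S I * (label_count n L I * label_count n L (dbl S - I)) * vert L K S =
      2 * (1/2 * sg S I * (of_bool (const_on L I) * of_bool (const_on L (dbl S - I)) * vert L K S))"
    if "I \<in> p_range Q S" for I
  proof -
    have "I \<noteq> {}" "dbl S - I \<noteq> {}"
      using that by (auto simp: p_range_def locked_subsets_def)
    then show ?thesis by (simp add: label_count_def)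
  qed
  then show ?thesis
    unfolding p_entry_def sum_distrib_right sum_distrib_left by (intro sum.cong[OF refl])
qed

text \<open>The sum over \<open>I\<close> splits into the range of \<open>p_gen\<close>, the two
  trivial subsets and the pair subsets. The trivial ones give \<open>n\<close> times the entry of
  \<open>b_diag\<close>. For a pair subset, column \<open>l\<close> only requires its own ends to
  agree, so it joins the strands outside \<open>S\<close> and leaves the entry of
  \<open>b_diag\<close> for \<open>S - {l}\<close>.\<close>

lemma swap_weight_vert:
  assumes S: "S \<subseteq> {1..K}" "2 \<le> card S" and Q: "Q \<subseteq> S" "card Q \<le> 1"
    and L: "L ` dbl {1..K} \<subseteq> {1..n}" and LQ: "\<And>q. q \<in> Q \<Longrightarrow> L (Top q) = L (Bot q)"
  shows "swap_weight n L S * vert L K S =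
    p_entry L K Q S + of_nat n * (- 1) ^ card S * b_entry L K S +
    (if card S = 2 then vert L K {} else \<Sum>l\<in>S - Q. (- 1) ^ card S * b_entry L K (S - {l}))"
proof -
  have fin: "finite S" using S(1) finite_subset by blast
  have ne: "S \<noteq> {}" "S - {l} \<noteq> {}" for l
    using S(2) by (auto dest: subset_singletonD)
  define f where "f I = sg S I * (label_count n L I * label_count n L (dbl S - I))" for I
  \<comment> \<open>\<open>S\<close> has at least two columns and at most one is locked, so an
    unlocked one exists.\<close>
  have "\<not> S \<subseteq> Q" using card_mono[of Q S] Q S(2) finite_subset[OF Q(1) fin] by auto
  moreover have "L ` dbl S \<subseteq> {1..n}"
    using L S(1) by (blast intro: dbl_subset_iff[THEN iffD2, THEN subsetD])
  ultimately have "swap_weight n L S = 1/2 * sum f (locked_subsets Q S)"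
    unfolding f_def using LQ by (intro sum_locked_subsets[symmetric] fin)
  also have "\<dots> = 1/2 * (sum f (p_range Q S) + (f {} + f (dbl S) + sum f (pair_subsets Q S)))"
    by (simp only: sum_locked_subsets_split[OF fin] sum_excluded_subsets[OF fin S(2)])
  also have "f {} = (- 1) ^ card S * (of_nat n * of_bool (const_on L (dbl S)))"
    using ne dbl_eq_iff[of S "{}"] sg_dbl[OF fin, of "{}"] by (simp add: f_def label_count_def dbl_empty)
  also have "f (dbl S) = (- 1) ^ card S * (of_nat n * of_bool (const_on L (dbl S)))"
    using ne dbl_eq_iff[of S "{}"] sg_dbl[OF fin, of S] by (simp add: f_def label_count_def dbl_empty)
  finally have sw0: "swap_weight n L S = 1/2 * (sum f (p_range Q S) +
      ((- 1) ^ card S * (of_nat n * of_bool (const_on L (dbl S))) +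
       (- 1) ^ card S * (of_nat n * of_bool (const_on L (dbl S))) + sum f (pair_subsets Q S)))" .
  have sw: "swap_weight n L S * vert L K S =
      1/2 * (sum f (p_range Q S) * vert L K S) + of_nat n * (- 1) ^ card S * b_entry L K S +
      1/2 * (\<Sum>I\<in>pair_subsets Q S. f I * vert L K S)"
    unfolding sw0 sum_distrib_right[symmetric] by (simp add: b_entry_def algebra_simps)
  have p: "sum f (p_range Q S) * vert L K S = 2 * p_entry L K Q S"
    unfolding f_def by (rule sum_p_range)
  have fl: "f (dbl {l}) * vert L K S = (- 1) ^ card S * b_entry L K (S - {l}) \<and>
      f (dbl (S - {l})) * vert L K S = (- 1) ^ card S * b_entry L K (S - {l})" if l: "l \<in> S" for l
  proof -
    have m: "dbl S - dbl {l} = dbl (S - {l})" "dbl S - dbl (S - {l}) = dbl {l}"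
      unfolding dbl_minus using l by (auto simp: double_diff)
    have "label_count n L (dbl {l}) = of_bool (L (Top l) = L (Bot l))"
      "label_count n L (dbl (S - {l})) = of_bool (const_on L (dbl (S - {l})))"
      using ne(2)[of l] dbl_eq_iff[of "{l}" "{}"] dbl_eq_iff[of "S - {l}" "{}"]
      by (simp_all only: label_count_def dbl_empty const_on_dbl_singleton if_False insert_not_empty not_False_eq_True simp_thms)
    then show ?thesis
      using sg_dbl[OF fin, of "{l}"] sg_dbl[OF fin, of "S - {l}"] l
      by (simp add: f_def m b_entry_def vert_remove[OF l S(1), symmetric] del: of_bool_eq_iff)
  qed
  show ?thesis
  proof (cases "card S = 2")
    case True
    \<comment> \<open>Here \<open>S - {l}\<close> is a single column, whose block is an ordinary
      strand; the diagram is the identity and the sign is +1.\<close>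
    have "f (dbl {l}) * vert L K S = vert L K {}" if l: "l \<in> S" for l
    proof -
      have "card (S - {l}) = 1" using True l fin by simp
      then obtain m where m: "S - {l} = {m}" by (auto simp: card_1_singleton_iff)
      have "of_bool (L (Top m) = L (Bot m)) * vert L K {m} = vert L K {}"
        using vert_remove[of m "{m}" K L] m S(1) by auto
      with fl[OF l] True m show ?thesis
        by (simp add: b_entry_def const_on_dbl_singleton)
    qed
    then have "(\<Sum>I\<in>pair_subsets Q S. f I * vert L K S) = 2 * vert L K {}"
      by (intro sum_pair_subsets_two[OF True Q])
    then show ?thesis unfolding sw p using True by simp
  next
    case False
    then have "3 \<le> card S" using S(2) by simp
    then have "(\<Sum>I\<in>pair_subsets Q S. f I * vert L K S) =
        2 * (\<Sum>l\<in>S - Q. (- 1) ^ card S * b_entry L K (S - {l}))"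
      by (intro sum_pair_subsets[OF fin] fl) auto
    then show ?thesis unfolding sw p using False by simp
  qed
qed

text \<open>For one column the pair subsets are just the trivial subsets, so only the term with
  \<open>n\<close> and sign -1 remains. Summed over all columns it becomes the \<open>k n\<close> of
  the eigenvalue.\<close>

lemma swap_weight_singleton:
  assumes l: "l \<in> {1..K}" and L: "L ` dbl {1..K} \<subseteq> {1..n}"
  shows "swap_weight n L {l} * vert L K {l} = p_entry L K {} {l} - of_nat n * vert L K {}"
proof -
  define f where "f I = sg {l} I * (label_count n L I * label_count n L (dbl {l} - I))" for I
  have "L ` dbl {l} \<subseteq> {1..n}"
    using L l by (blast intro: dbl_subset_iff[THEN iffD2, THEN subsetD])
  then have "swap_weight n L {l} = 1/2 * sum f (locked_subsets {} {l})"
    unfolding f_def by (intro sum_locked_subsets[symmetric]) auto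
  also have "\<dots> = 1/2 * (sum f (p_range {} {l}) + (f {} + f (dbl {l})))"
  proof -
    have "{{}, dbl {l}} \<union> pair_subsets {} {l} = {{}, dbl {l}}"
      by (auto simp: pair_subsets_def dbl_empty)
    moreover have "{} \<noteq> dbl {l}" by (simp add: dbl_singleton)
    ultimately show ?thesis
      by (simp add: sum_locked_subsets_split)
  qed
  also have "f {} = - of_nat n * of_bool (L (Top l) = L (Bot l))"
    using sg_dbl[of "{l}" "{}"] const_on_dbl_singleton[of L l]
    by (simp add: f_def label_count_def dbl_empty dbl_singleton)
  also have "f (dbl {l}) = - of_nat n * of_bool (L (Top l) = L (Bot l))"
    using sg_dbl[of "{l}" "{l}"] const_on_dbl_singleton[of L l]
    by (simp add: f_def label_count_def dbl_empty dbl_singleton)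
  finally have sw0: "swap_weight n L {l} = 1/2 * (sum f (p_range {} {l}) +
      (- of_nat n * of_bool (L (Top l) = L (Bot l)) + - of_nat n * of_bool (L (Top l) = L (Bot l))))" .
  have "swap_weight n L {l} * vert L K {l} =
      1/2 * (sum f (p_range {} {l}) * vert L K {l}) - of_nat n * (of_bool (L (Top l) = L (Bot l)) * vert L K {l})"
    unfolding sw0 by (simp only: algebra_simps) simp
  also have "sum f (p_range {} {l}) * vert L K {l} = 2 * p_entry L K {} {l}"
    unfolding f_def by (rule sum_p_range)
  also have "of_bool (L (Top l) = L (Bot l)) * vert L K {l} = vert L K {}"
    using vert_remove[of l "{l}" K L] l by simp
  finally show ?thesis by simp
qed

text \<open>The index sets of the \<open>b_diag\<close> terms: in \<open>Z\<close> for
  \<open>Q = {}\<close>, and in the terms that \<open>Z_half\<close> adds for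
  \<open>Q = {k + 1}\<close>.\<close>

definition big_subsets :: "nat \<Rightarrow> nat set \<Rightarrow> nat set set"
  where "big_subsets K Q = {S. Q \<subseteq> S \<and> S \<subseteq> {1..K} \<and> 2 \<le> card S}"

lemma finite_big_subsets: "finite (big_subsets K Q)"
  by (rule finite_subset[of _ "Pow {1..K}"]) (auto simp: big_subsets_def)

text \<open>Double counting of the pairs \<open>(S, l)\<close>: a set \<open>T\<close> arises as
  \<open>S - {l}\<close> once for each \<open>l\<close> outside \<open>T\<close>. The cardinality is
  a separate argument of \<open>g\<close> because the sign belongs to the larger set
  \<open>S\<close>.\<close>

lemma sum_big_subsets_remove:
  fixes g :: "nat \<Rightarrow> nat set \<Rightarrow> complex"
  shows "(\<Sum>S\<in>{S \<in> big_subsets K Q. card S \<noteq> 2}. \<Sum>l\<in>S - Q. g (card S) (S - {l})) =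
    (\<Sum>T\<in>big_subsets K Q. of_nat (K - card T) * g (card T + 1) T)"
proof -
  let ?A = "SIGMA S:{S \<in> big_subsets K Q. card S \<noteq> 2}. S - Q"
  let ?B = "SIGMA T:big_subsets K Q. {1..K} - T"
  have finS: "finite S" if "S \<in> big_subsets K Q" for S
    using that finite_subset by (auto simp: big_subsets_def)
  have "(\<Sum>S\<in>{S \<in> big_subsets K Q. card S \<noteq> 2}. \<Sum>l\<in>S - Q. g (card S) (S - {l})) =
      (\<Sum>(S, l)\<in>?A. g (card S) (S - {l}))"
    by (rule sum.Sigma) (auto simp: finite_big_subsets finS)
  also have "\<dots> = (\<Sum>(T, l)\<in>?B. g (card T + 1) T)"
  proof (rule sum.reindex_bij_witness[of _ "\<lambda>(T, l). (insert l T, l)" "\<lambda>(S, l). (S - {l}, l)"])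
    fix a assume "a \<in> ?A"
    then obtain S l where a: "a = (S, l)" "Q \<subseteq> S" "S \<subseteq> {1..K}" "2 \<le> card S" "card S \<noteq> 2" "l \<in> S" "l \<notin> Q"
      by (auto simp: big_subsets_def)
    have c: "card S = card (S - {l}) + 1"
      using card_Suc_Diff1[OF finite_subset[OF a(3)] a(6)] by simp
    have c2: "2 \<le> card (S - {l})"
      using a(4,5) c by linarith
    show "(case case a of (S, l) \<Rightarrow> (S - {l}, l) of (T, l) \<Rightarrow> (insert l T, l)) = a"
      using a by auto
    show "(case a of (S, l) \<Rightarrow> (S - {l}, l)) \<in> ?B"
      unfolding a(1) prod.case big_subsets_def using a(2,3,6,7) c2 by blast
    show "(case case a of (S, l) \<Rightarrow> (S - {l}, l) of (T, l) \<Rightarrow> g (card T + 1) T) = (case a of (S, l) \<Rightarrow> g (card S) (S - {l}))"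
      unfolding a(1) by (simp only: prod.case c[symmetric])
  next
    fix b assume "b \<in> ?B"
    then obtain T l where b: "b = (T, l)" "Q \<subseteq> T" "T \<subseteq> {1..K}" "2 \<le> card T" "l \<in> {1..K}" "l \<notin> T"
      by (auto simp: big_subsets_def)
    have c: "card (insert l T) = card T + 1"
      using b(6) finite_subset[OF b(3)] by simp
    show "(case case b of (T, l) \<Rightarrow> (insert l T, l) of (S, l) \<Rightarrow> (S - {l}, l)) = b"
      using b by auto
    have "2 \<le> card (insert l T)" "card (insert l T) \<noteq> 2"
      using b(4) c by linarith+
    then show "(case b of (T, l) \<Rightarrow> (insert l T, l)) \<in> ?A"
      unfolding b(1) prod.case big_subsets_def using b(2,3,5,6) by blast
  qed
  also have "\<dots> = (\<Sum>T\<in>big_subsets K Q. \<Sum>l\<in>{1..K} - T. g (card T + 1) T)"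
    by (rule sum.Sigma[symmetric]) (auto simp: finite_big_subsets)
  also have "\<dots> = (\<Sum>T\<in>big_subsets K Q. of_nat (K - card T) * g (card T + 1) T)"
  proof (rule sum.cong[OF refl])
    fix T assume T: "T \<in> big_subsets K Q"
    then have "card ({1..K} - T) = K - card T"
      using card_Diff_subset[OF finS[OF T], of "{1..K}"] by (auto simp: big_subsets_def)
    then show "(\<Sum>l\<in>{1..K} - T. g (card T + 1) T) = of_nat (K - card T) * g (card T + 1) T"
      by simp
  qed
  finally show ?thesis .
qed

text \<open>The removed columns contribute \<open>K - card T\<close> with the sign of a set larger
  by one, so they are subtracted from \<open>n\<close> and produce the coefficient in the definition
  of the central elements. The two-element sets leave multiples of the identity.\<close>

lemma sum_swap_weight_big_subsets:
  assumes Q: "card Q \<le> 1" and L: "L ` dbl {1..K} \<subseteq> {1..n}"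
    and LQ: "\<And>q. q \<in> Q \<Longrightarrow> L (Top q) = L (Bot q)"
  shows "(\<Sum>S\<in>big_subsets K Q. swap_weight n L S * vert L K S) =
    (\<Sum>S\<in>big_subsets K Q. p_entry L K Q S + (of_nat n - of_nat K + of_nat (card S)) * (- 1) ^ card S * b_entry L K S)
    + of_nat (card {S \<in> big_subsets K Q. card S = 2}) * vert L K {}"
proof -
  let ?F = "big_subsets K Q" and ?b = "b_entry L K"
  have "(\<Sum>S\<in>?F. swap_weight n L S * vert L K S) =
      (\<Sum>S\<in>?F. p_entry L K Q S + of_nat n * (- 1) ^ card S * ?b S +
        (if card S = 2 then vert L K {} else \<Sum>l\<in>S - Q. (- 1) ^ card S * ?b (S - {l})))"
    by (rule sum.cong[OF refl], rule swap_weight_vert) (use Q L LQ in \<open>auto simp: big_subsets_def\<close>)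
  also have "\<dots> = (\<Sum>S\<in>?F. p_entry L K Q S + of_nat n * (- 1) ^ card S * ?b S) +
      (\<Sum>S\<in>?F. if card S = 2 then vert L K {} else \<Sum>l\<in>S - Q. (- 1) ^ card S * ?b (S - {l}))"
    by (rule sum.distrib)
  also have "(\<Sum>S\<in>?F. if card S = 2 then vert L K {} else \<Sum>l\<in>S - Q. (- 1) ^ card S * ?b (S - {l})) =
      (\<Sum>S\<in>{S \<in> ?F. card S = 2}. vert L K {}) +
      (\<Sum>S\<in>{S \<in> ?F. card S \<noteq> 2}. \<Sum>l\<in>S - Q. (- 1) ^ card S * ?b (S - {l}))"
    by (simp only: sum.If_cases[OF finite_big_subsets] Int_def Compl_eq mem_Collect_eq)
  also have "(\<Sum>S\<in>{S \<in> ?F. card S \<noteq> 2}. \<Sum>l\<in>S - Q. (- 1) ^ card S * ?b (S - {l})) =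
      (\<Sum>T\<in>?F. of_nat (K - card T) * ((- 1) ^ (card T + 1) * ?b T))"
    by (rule sum_big_subsets_remove[where g = "\<lambda>c T. (- 1) ^ c * ?b T"])
  finally have eq: "(\<Sum>S\<in>?F. swap_weight n L S * vert L K S) =
      (\<Sum>S\<in>?F. p_entry L K Q S + of_nat n * (- 1) ^ card S * ?b S) +
      ((\<Sum>S\<in>{S \<in> ?F. card S = 2}. vert L K {}) +
      (\<Sum>T\<in>?F. of_nat (K - card T) * ((- 1) ^ (card T + 1) * ?b T)))" .
  have "(\<Sum>S\<in>?F. p_entry L K Q S + of_nat n * (- 1) ^ card S * ?b S) +
      (\<Sum>T\<in>?F. of_nat (K - card T) * ((- 1) ^ (card T + 1) * ?b T)) =
      (\<Sum>S\<in>?F. p_entry L K Q S + (of_nat n - of_nat K + of_nat (card S)) * (- 1) ^ card S * ?b S)"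
    unfolding sum.distrib[symmetric]
  proof (rule sum.cong[OF refl])
    fix S assume "S \<in> ?F"
    then have "card S \<le> K" using card_mono[of "{1..K}" S] by (auto simp: big_subsets_def)
    then show "p_entry L K Q S + of_nat n * (- 1) ^ card S * ?b S +
        of_nat (K - card S) * ((- 1) ^ (card S + 1) * ?b S) =
        p_entry L K Q S + (of_nat n - of_nat K + of_nat (card S)) * (- 1) ^ card S * ?b S"
      by (simp add: of_nat_diff algebra_simps)
  qed
  then show ?thesis
    unfolding eq by simp
qed

section \<open>Expansion of the sum of transpositions over sets of positions\<close>

lemma sum_transpose_pairs:
  fixes f :: "(nat \<Rightarrow> nat) \<Rightarrow> complex"
  shows "(\<Sum>i\<in>{1..n}. \<Sum>j\<in>{1..n} - {i}. f (transpose i j)) = 2 * (\<Sum>\<tau>\<in>transps n. f \<tau>)"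
proof -
  let ?P = "{(l, m). 1 \<le> l \<and> l < m \<and> m \<le> n}" and ?P' = "{(l, m). 1 \<le> m \<and> m < l \<and> l \<le> n}"
  let ?f = "\<lambda>(i, j). f (transpose i j)"
  have fin: "finite ?P" "finite ?P'"
    by (auto intro: finite_subset[of _ "{1..n} \<times> {1..n}"])
  have "(\<Sum>i\<in>{1..n}. \<Sum>j\<in>{1..n} - {i}. f (transpose i j)) = sum ?f (SIGMA i:{1..n}. {1..n} - {i})"
    by (subst sum.Sigma) auto
  also have "(SIGMA i:{1..n}. {1..n} - {i}) = ?P \<union> ?P'"
    by auto
  also have "sum ?f (?P \<union> ?P') = sum ?f ?P + sum ?f ?P'"
    by (rule sum.union_disjoint[OF fin]) auto
  also have "sum ?f ?P' = sum ?f ?P"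
    by (rule sum.reindex_bij_witness[of _ prod.swap prod.swap]) (auto simp: transpose_commute)
  also have "sum ?f ?P = (\<Sum>\<tau>\<in>transps n. f \<tau>)"
    unfolding transps_conv_ordered
    by (subst sum.reindex[OF inj_on_transpose_ordered]) (auto intro: sum.cong)
  finally show ?thesis by simp
qed

lemma map_eq_iff_label:
  assumes "w \<in> words n k" "u \<in> words n k"
  shows "map f w = u \<longleftrightarrow> (\<forall>l\<in>{1..k}. f (label w u (Top l)) = label w u (Bot l))"
proof -
  have len: "length w = k" "length u = k" using assms by (auto simp: words_def)
  have "map f w = u \<longleftrightarrow> (\<forall>i<k. f (w ! i) = u ! i)"
    using len by (auto simp: list_eq_iff_nth_eq)
  also have "\<dots> \<longleftrightarrow> (\<forall>l\<in>{1..k}. f (w ! (l - 1)) = u ! (l - 1))"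
  proof safe
    fix i assume *: "\<forall>l\<in>{1..k}. f (w ! (l - 1)) = u ! (l - 1)" and "i < k"
    then show "f (w ! i) = u ! i" using bspec[OF *, of "Suc i"] by simp
  qed auto
  finally show ?thesis by simp
qed

lemma label_in_range:
  assumes "w \<in> words n k" "u \<in> words n k"
  shows "label w u ` dbl {1..k} \<subseteq> {1..n}"
  using words_nth[OF assms(1)] words_nth[OF assms(2)] unfolding dbl_def by fastforce

lemma sum_transps_expansion:
  assumes "w \<in> words n k" "u \<in> words n k"
  shows "(\<Sum>\<tau>\<in>transps n. of_bool (map \<tau> w = u)) =
    (\<Sum>S\<in>Pow {1..k}. swap_weight n (label w u) S * vert (label w u) k S)"
proof -
  let ?L = "label w u"
  let ?e = "\<lambda>i j l. - diff_entry i j (?L (Top l)) (?L (Bot l))"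
  have "of_bool (map (transpose i j) w = u) = (\<Sum>S\<in>Pow {1..k}. prod (?e i j) S * vert ?L k S)"
    if "i \<noteq> j" for i j
  proof -
    have "of_bool (map (transpose i j) w = u) =
        (\<Prod>l\<in>{1..k}. of_bool (transpose i j (?L (Top l)) = ?L (Bot l)) :: complex)"
      unfolding map_eq_iff_label[OF assms] by (rule prod_of_bool[symmetric]) simp
    also have "\<dots> = (\<Prod>l\<in>{1..k}. ?e i j l + of_bool (?L (Top l) = ?L (Bot l)))"
      by (simp only: transpose_entry[OF that])
    also have "\<dots> = (\<Sum>S\<in>Pow {1..k}. prod (?e i j) S * vert ?L k S)"
      by (simp only: prod_add[OF finite_atLeastAtMost] vert_def prod_of_bool finite_Diff finite_atLeastAtMost)
    finally show ?thesis .
  qed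
  then have "2 * (\<Sum>\<tau>\<in>transps n. of_bool (map \<tau> w = u)) =
      (\<Sum>i\<in>{1..n}. \<Sum>j\<in>{1..n} - {i}. \<Sum>S\<in>Pow {1..k}. prod (?e i j) S * vert ?L k S)"
    unfolding sum_transpose_pairs[symmetric] by (intro sum.cong[OF refl]) auto
  also have "\<dots> = (\<Sum>i\<in>{1..n}. \<Sum>S\<in>Pow {1..k}. \<Sum>j\<in>{1..n} - {i}. prod (?e i j) S * vert ?L k S)"
    by (rule sum.cong[OF refl], rule sum.swap)
  also have "\<dots> = (\<Sum>S\<in>Pow {1..k}. \<Sum>i\<in>{1..n}. \<Sum>j\<in>{1..n} - {i}. prod (?e i j) S * vert ?L k S)"
    by (rule sum.swap)
  also have "\<dots> = 2 * (\<Sum>S\<in>Pow {1..k}. swap_weight n ?L S * vert ?L k S)"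
  proof -
    have "(\<Sum>i\<in>{1..n}. \<Sum>j\<in>{1..n} - {i}. prod (?e i j) S * c) = 2 * (swap_weight n ?L S * c)" for S c
      unfolding swap_weight_def sum_distrib_right[symmetric] by simp
    then show ?thesis
      by (simp only: sum_distrib_left)
  qed
  finally show ?thesis by simp
qed

lemma sum_pairs_const: "(\<Sum>i\<in>{1..n}. \<Sum>j\<in>{1..n} - {i}. c) = of_nat (n * (n - 1)) * (c::complex)"
  by (cases n) (simp_all add: algebra_simps)

lemma swap_weight_empty: "swap_weight n L {} = of_nat (n choose 2)"
proof -
  have two: "of_nat (n * (n - 1)) = (2 * of_nat (n choose 2) :: complex)"
  proof -
    have "even (n * (n - 1))" by (cases n) auto
    then have "n * (n - 1) = 2 * (n choose 2)" by (simp add: choose_two)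
    then show ?thesis by (metis of_nat_mult of_nat_numeral)
  qed
  show ?thesis
    unfolding swap_weight_def prod.empty sum_pairs_const two by simp
qed

text \<open>With \<open>n\<close> at both ends, \<open>diff_entry i j\<close> is 1 if one of
  \<open>i\<close>, \<open>j\<close> is \<open>n\<close> and 0 otherwise. This happens for 2 (n - 1)
  ordered pairs, which are then halved and negated.\<close>

lemma swap_weight_last:
  assumes "n \<ge> 1" "L (Top m) = n" "L (Bot m) = n"
  shows "swap_weight n L {m} = 1 - of_nat n"
proof -
  have "(\<Sum>j\<in>{1..n} - {i}. - diff_entry i j n n) = (if i = n then - (of_nat n - 1) else - 1)" if "i \<in> {1..n}" for i
  proof (cases "i = n")
    case True
    have "(\<Sum>j\<in>{1..n} - {i}. - diff_entry i j n n) = (\<Sum>j\<in>{1..n} - {i}. - 1)"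
      using True by (intro sum.cong[OF refl]) (auto simp: diff_entry_def)
    then show ?thesis using True that by (simp add: of_nat_diff)
  next
    case False
    have "(\<Sum>j\<in>{1..n} - {i}. - diff_entry i j n n) = (\<Sum>j\<in>{1..n} - {i}. if n = j then - 1 else 0)"
      using False by (intro sum.cong[OF refl]) (auto simp: diff_entry_def)
    also have "\<dots> = - 1" using False assms(1) by (simp add: sum.delta')
    finally show ?thesis using False by simp
  qed
  then have "(\<Sum>i\<in>{1..n}. \<Sum>j\<in>{1..n} - {i}. - diff_entry i j n n) =
      (\<Sum>i\<in>{1..n}. if i = n then - (of_nat n - 1) else - 1)"
    by (intro sum.cong[OF refl])
  also have "\<dots> = (\<Sum>i\<in>insert n {1..n - 1}. if i = n then - (of_nat n - 1) else - 1)"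
    by (rule sum.cong) (use assms(1) in auto)
  also have "\<dots> = - (of_nat n - 1) + (\<Sum>i\<in>{1..n - 1}. - 1)"
  proof -
    have rest: "(\<Sum>i\<in>{1..n - 1}. if i = n then - (of_nat n - 1) else - 1) = (\<Sum>i\<in>{1..n - 1}. - 1 :: complex)"
      using assms(1) by (intro sum.cong[OF refl]) auto
    have "n \<notin> {1..n - 1}" using assms(1) by auto
    then show ?thesis unfolding sum.insert[OF finite_atLeastAtMost \<open>n \<notin> {1..n - 1}\<close>] rest by simp
  qed
  also have "\<dots> = 2 * (1 - of_nat n)"
    using assms(1) by (simp add: of_nat_diff)
  finally show ?thesis
    by (simp add: swap_weight_def assms(2,3))
qed

lemma vert_full: "w \<in> words n k \<Longrightarrow> u \<in> words n k \<Longrightarrow> vert (label w u) k {} = of_bool (w = u)"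
  using map_eq_iff_label[of w n k u id] by (simp add: vert_def)

section \<open>Diagrams with one or two large blocks\<close>

lemma union_vertical_in_diagrams:
  assumes "S \<subseteq> {1..k}" "partition_on (dbl S) P"
  shows "P \<union> vertical k S \<in> diagrams k"
proof -
  have P: "\<Union>P = dbl S" "{} \<notin> P" "disjoint P"
    using assms(2) by (auto simp: partition_on_def)
  have v: "vertical k S = (\<lambda>l. dbl {l}) ` ({1..k} - S)"
    by (auto simp: vertical_def dbl_singleton)
  have "partition_on (dbl {1..k}) (P \<union> vertical k S)"
  proof (rule partition_onI)
    show "\<Union>(P \<union> vertical k S) = dbl {1..k}"
      unfolding Union_Un_distrib P(1) v using assms(1) by (intro vertex_set_eqI) auto
    show "{} \<notin> P \<union> vertical k S"
      using P(2) by (auto simp: v dbl_singleton)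
    have 1: "disjnt p q" if "p \<in> P" "q \<in> P" "p \<noteq> q" for p q
      using P(3) that by (auto simp: disjoint_def disjnt_def)
    have 2: "disjnt p q" if pq: "p \<in> P" "q \<in> vertical k S" for p q
    proof -
      have "p \<subseteq> dbl S" using P(1) pq by blast
      moreover obtain l where "q = dbl {l}" "l \<notin> S" using pq unfolding v by blast
      ultimately show ?thesis by (auto simp: disjnt_def dbl_singleton)
    qed
    have 3: "disjnt p q" if "p \<in> vertical k S" "q \<in> vertical k S" "p \<noteq> q" for p q
      using that by (auto simp: v disjnt_def dbl_singleton)
    show "disjnt p q" if "p \<in> P \<union> vertical k S" "q \<in> P \<union> vertical k S" "p \<noteq> q" for p q
      using that 1 2 3 disjnt_sym by blast
  qed
  then show ?thesis by (simp add: diagrams_def)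
qed

lemma vertical_const_on: "(\<forall>B\<in>vertical k S. const_on L B) \<longleftrightarrow> (\<forall>l\<in>{1..k} - S. L (Top l) = L (Bot l))"
proof -
  have v: "vertical k S = (\<lambda>l. dbl {l}) ` ({1..k} - S)"
    by (auto simp: vertical_def dbl_singleton)
  show ?thesis unfolding v by (simp only: ball_simps const_on_dbl_singleton)
qed

lemma b_diag_in_diagrams:
  assumes "S \<subseteq> {1..k}" "S \<noteq> {}"
  shows "b_diag k S \<in> diagrams k"
proof -
  have "partition_on (dbl S) {dbl S}"
    using assms(2) dbl_eq_iff[of S "{}"] by (intro partition_on_space) (simp add: dbl_empty)
  from union_vertical_in_diagrams[OF assms(1) this] show ?thesis
    by (simp add: b_diag_def)
qed

lemma d_diag_in_diagrams:
  assumes "S \<subseteq> {1..k}" "I \<in> p_range Q S"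
  shows "d_diag k S I \<in> diagrams k"
proof -
  have "I \<subseteq> dbl S" "I \<noteq> {}" "I \<noteq> dbl S"
    using assms(2) by (auto simp: p_range_def locked_subsets_def)
  then have "partition_on (dbl S) {I, dbl S - I}"
    by (intro partition_onI) (auto simp: disjnt_def)
  from union_vertical_in_diagrams[OF assms(1) this] show ?thesis
    by (simp add: d_diag_def)
qed

lemma vertical_in_diagrams: "vertical k {} \<in> diagrams k"
  using union_vertical_in_diagrams[of "{}" k "{}"] by (simp add: dbl_empty partition_on_def)

lemma mat_b_diag:
  assumes "S \<subseteq> {1..k}" "S \<noteq> {}"
  shows "mat k (basis (b_diag k S)) w u = b_entry (label w u) k S"
  unfolding mat_basis[OF b_diag_in_diagrams[OF assms]] b_entry_def vert_def
  by (simp only: compatible_conv_const_on b_diag_def ball_simps vertical_const_on of_bool_conj)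

lemma mat_p_gen:
  assumes "S \<subseteq> {1..k}"
  shows "mat k (p_gen k Q S) w u = p_entry (label w u) k Q S"
  unfolding p_gen_def p_entry_def mat_sum mat_scale
proof (rule sum.cong[OF refl])
  fix I assume "I \<in> p_range Q S"
  from mat_basis[OF d_diag_in_diagrams[OF assms this], of w u]
  show "1/2 * sg S I * mat k (basis (d_diag k S I)) w u = 1/2 * sg S I *
      (of_bool (const_on (label w u) I) * of_bool (const_on (label w u) (dbl S - I)) * vert (label w u) k S)"
    by (simp add: compatible_conv_const_on d_diag_def vertical_const_on vert_def of_bool_conj ball_Un)
qed

lemma mat_part_one: "mat k (part_one k) w u = vert (label w u) k {}"
  unfolding part_one_def mat_basis[OF vertical_in_diagrams]
  by (simp only: compatible_conv_const_on vertical_const_on vert_def)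

lemma sum_Pow_split:
  fixes f :: "nat set \<Rightarrow> complex"
  shows "sum f (Pow {1..k}) = f {} + (\<Sum>l\<in>{1..k}. f {l}) + sum f (big_subsets k {})"
    and "sum f {S. S \<subseteq> {1..k} \<and> 1 \<le> card S} = (\<Sum>l\<in>{1..k}. f {l}) + sum f (big_subsets k {})"
proof -
  have fin: "finite S" if "S \<subseteq> {1..k}" for S using that finite_subset by blast
  have r: "sum f ((\<lambda>l. {l}) ` {1..k}) = (\<Sum>l\<in>{1..k}. f {l})"
    by (subst sum.reindex) (auto simp: inj_on_def)
  have "{S. S \<subseteq> {1..k} \<and> 1 \<le> card S} = (\<lambda>l. {l}) ` {1..k} \<union> big_subsets k {}"
  proof (intro set_eqI iffI)
    fix S assume S: "S \<in> {S. S \<subseteq> {1..k} \<and> 1 \<le> card S}"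
    then consider "card S = 1" | "2 \<le> card S" by fastforce
    then show "S \<in> (\<lambda>l. {l}) ` {1..k} \<union> big_subsets k {}"
    proof cases
      case 1
      then obtain l where "S = {l}" by (auto simp: card_1_singleton_iff)
      with S show ?thesis by auto
    next
      case 2
      with S show ?thesis by (auto simp: big_subsets_def)
    qed
  qed (auto simp: big_subsets_def)
  moreover have "sum f ((\<lambda>l. {l}) ` {1..k} \<union> big_subsets k {}) =
      sum f ((\<lambda>l. {l}) ` {1..k}) + sum f (big_subsets k {})"
    by (rule sum.union_disjoint) (auto simp: finite_big_subsets big_subsets_def)
  ultimately show *: "sum f {S. S \<subseteq> {1..k} \<and> 1 \<le> card S} = (\<Sum>l\<in>{1..k}. f {l}) + sum f (big_subsets k {})"
    using r by simp
  have "Pow {1..k} = insert {} {S. S \<subseteq> {1..k} \<and> 1 \<le> card S}"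
  proof (intro set_eqI iffI)
    fix S assume "S \<in> Pow {1..k}"
    then show "S \<in> insert {} {S. S \<subseteq> {1..k} \<and> 1 \<le> card S}"
      using fin[of S] card_gt_0_iff[of S] by (cases "S = {}") auto
  qed auto
  then show "sum f (Pow {1..k}) = f {} + (\<Sum>l\<in>{1..k}. f {l}) + sum f (big_subsets k {})"
    using * by (simp add: finite_subset[of _ "Pow {1..k}"] add.assoc)
qed

lemma card_big_subsets_two: "card {S \<in> big_subsets k {}. card S = 2} = k choose 2"
proof -
  have "{S \<in> big_subsets k {}. card S = 2} = {S. S \<subseteq> {1..k} \<and> card S = 2}"
    by (auto simp: big_subsets_def)
  then show ?thesis using n_subsets[of "{1..k}" 2] by simp
qed

lemma card_big_subsets_two_last: "card {S \<in> big_subsets (k + 1) {k + 1}. card S = 2} = k"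
proof -
  have "{S \<in> big_subsets (k + 1) {k + 1}. card S = 2} = (\<lambda>l. {l, k + 1}) ` {1..k}"
  proof (intro set_eqI iffI)
    fix S assume "S \<in> {S \<in> big_subsets (k + 1) {k + 1}. card S = 2}"
    then obtain a b where "S = {a, b}" "a \<noteq> b" "k + 1 \<in> S" "S \<subseteq> {1..k + 1}"
      by (auto simp: big_subsets_def card_2_iff)
    then obtain l where "S = {l, k + 1}" "l \<noteq> k + 1" "l \<in> {1..k + 1}" by auto
    then show "S \<in> (\<lambda>l. {l, k + 1}) ` {1..k}" by auto
  qed (auto simp: big_subsets_def)
  moreover have "inj_on (\<lambda>l. {l, k + 1}) {1..k}"
    by (auto simp: inj_on_def doubleton_eq_iff)
  ultimately show ?thesis by (simp add: card_image)
qed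

text \<open>The expansion of the transpositions, solved for \<open>Z\<close>. The identity occurs in
  it \<open>n choose 2\<close> times from the empty set, -k n times from the singletons and
  \<open>k choose 2\<close> times from the pairs; only the last multiple is part of
  \<open>Z\<close>, so the other two change sides.\<close>

theorem mat_Z:
  assumes "w \<in> words n k" "u \<in> words n k"
  shows "mat k (Z k (of_nat n)) w u = (\<Sum>\<tau>\<in>transps n. of_bool (map \<tau> w = u)) +
    (of_nat k * of_nat n - of_nat (n choose 2)) * of_bool (w = u)"
proof -
  let ?L = "label w u" and ?F = "big_subsets k {}"
  let ?c = "\<lambda>S. (of_nat n - of_nat k + of_nat (card S)) * (- 1) ^ card S :: complex"
  note R = label_in_range[OF assms]
  have "mat k (Z k (of_nat n)) w u = of_nat (k choose 2) * vert ?L k {} +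
      (\<Sum>S\<in>{S. S \<subseteq> {1..k} \<and> 1 \<le> card S}. p_entry ?L k {} S) + (\<Sum>S\<in>?F. ?c S * b_entry ?L k S)"
  proof -
    have F: "{S. S \<subseteq> {1..k} \<and> 2 \<le> card S} = ?F" by (auto simp: big_subsets_def)
    have "(\<Sum>S\<in>?F. ?c S * mat k (basis (b_diag k S)) w u) = (\<Sum>S\<in>?F. ?c S * b_entry ?L k S)"
      by (rule sum.cong[OF refl], subst mat_b_diag) (auto simp: big_subsets_def)
    moreover have "(\<Sum>S\<in>{S. S \<subseteq> {1..k} \<and> 1 \<le> card S}. mat k (p_elem k S) w u) =
        (\<Sum>S\<in>{S. S \<subseteq> {1..k} \<and> 1 \<le> card S}. p_entry ?L k {} S)"
      unfolding p_elem_eq_p_gen by (rule sum.cong[OF refl], rule mat_p_gen) auto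
    ultimately show ?thesis
      unfolding Z_def F by (simp only: mat_add mat_scale mat_sum mat_part_one)
  qed
  moreover have "(\<Sum>S\<in>{S. S \<subseteq> {1..k} \<and> 1 \<le> card S}. p_entry ?L k {} S) =
      (\<Sum>l\<in>{1..k}. p_entry ?L k {} {l}) + (\<Sum>S\<in>?F. p_entry ?L k {} S)"
    by (rule sum_Pow_split(2))
  moreover have "(\<Sum>\<tau>\<in>transps n. of_bool (map \<tau> w = u)) = of_nat (n choose 2) * vert ?L k {} +
      ((\<Sum>l\<in>{1..k}. p_entry ?L k {} {l}) - of_nat k * (of_nat n * vert ?L k {})) +
      ((\<Sum>S\<in>?F. p_entry ?L k {} S) + (\<Sum>S\<in>?F. ?c S * b_entry ?L k S) + of_nat (k choose 2) * vert ?L k {})"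
  proof -
    have "(\<Sum>l\<in>{1..k}. swap_weight n ?L {l} * vert ?L k {l}) =
        (\<Sum>l\<in>{1..k}. p_entry ?L k {} {l} - of_nat n * vert ?L k {})"
      by (rule sum.cong[OF refl], rule swap_weight_singleton[OF _ R])
    moreover have "\<dots> = (\<Sum>l\<in>{1..k}. p_entry ?L k {} {l}) - of_nat k * (of_nat n * vert ?L k {})"
      by (simp add: sum_subtractf)
    ultimately show ?thesis
      unfolding sum_transps_expansion[OF assms] sum_Pow_split(1)
      using sum_swap_weight_big_subsets[OF _ R, of "{}"]
      by (simp only: swap_weight_empty card_big_subsets_two sum.distrib) simp
  qed
  ultimately show ?thesis
    unfolding vert_full[OF assms] by (simp only: algebra_simps)
qed

lemma words_append_last: "w \<in> words n k \<Longrightarrow> n \<ge> 1 \<Longrightarrow> w @ [n] \<in> words n (k + 1)"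
  by (auto simp: words_def)

lemma insert_strand_in_diagrams:
  assumes "d \<in> diagrams k"
  shows "insert {Top (k + 1), Bot (k + 1)} d \<in> half_diagrams k"
proof -
  have "vertical (k + 1) {1..k} = {{Top (k + 1), Bot (k + 1)}}"
    by (auto simp: vertical_def)
  then have "insert {Top (k + 1), Bot (k + 1)} d \<in> diagrams (k + 1)"
    using union_vertical_in_diagrams[of "{1..k}" "k + 1" d] assms by (simp add: diagrams_def)
  then show ?thesis by (auto simp: half_diagrams_def)
qed

lemma label_append:
  assumes "w \<in> words n k" "u \<in> words n k" "r \<in> dbl {1..k}"
  shows "label (w @ [m]) (u @ [m]) r = label w u r"
  using assms by (auto simp: dbl_def words_def nth_append)

lemma label_append_last:
  assumes "w \<in> words n k" "u \<in> words n k"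
  shows "label (w @ [m]) (u @ [m]) (Top (k + 1)) = m" "label (w @ [m]) (u @ [m]) (Bot (k + 1)) = m"
  using assms by (auto simp: words_def nth_append)

lemma mat_add_strand:
  assumes "w \<in> words n k" "u \<in> words n k"
  shows "mat (k + 1) (add_strand k x) (w @ [m]) (u @ [m]) = mat k x w u"
  unfolding add_strand_def mat_sum mat_scale
  unfolding mat_def[of k]
proof (rule sum.cong[OF refl])
  fix d assume d: "d \<in> diagrams k"
  have "const_on (label (w @ [m]) (u @ [m])) B \<longleftrightarrow> const_on (label w u) B" if "B \<in> d" for B
    using partition_onD1[OF diagramD[OF d]] that by (intro const_on_cong label_append[OF assms]) auto
  moreover have "const_on (label (w @ [m]) (u @ [m])) {Top (k + 1), Bot (k + 1)}"
    unfolding dbl_singleton[symmetric] const_on_dbl_singleton label_append_last[OF assms] ..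
  ultimately have "compatible (insert {Top (k + 1), Bot (k + 1)} d) (w @ [m]) (u @ [m]) \<longleftrightarrow> compatible d w u"
    by (simp add: compatible_conv_const_on)
  moreover have "insert {Top (k + 1), Bot (k + 1)} d \<in> diagrams (k + 1)"
    using insert_strand_in_diagrams[OF d] half_diagrams_subset by blast
  ultimately show "x d * mat (k + 1) (basis (insert {Top (k + 1), Bot (k + 1)} d)) (w @ [m]) (u @ [m]) =
      x d * of_bool (compatible d w u)"
    by (simp only: mat_basis)
qed

lemma transps_stabilizer: "n \<ge> 1 \<Longrightarrow> transps (n - 1) = {\<tau> \<in> transps n. \<tau> n = n}"
proof (intro set_eqI iffI)
  fix \<tau> assume "n \<ge> 1" "\<tau> \<in> {\<tau> \<in> transps n. \<tau> n = n}"
  then obtain l m where lm: "\<tau> = transpose l m" "l \<in> {1..n}" "m \<in> {1..n}" "l \<noteq> m" "transpose l m n = n"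
    by (auto simp: transps_def)
  then have "l \<noteq> n" "m \<noteq> n" by auto
  then have "l \<in> {1..n - 1}" "m \<in> {1..n - 1}" using lm by auto
  with lm show "\<tau> \<in> transps (n - 1)" unfolding transps_def by blast
next
  fix \<tau> assume "n \<ge> 1" "\<tau> \<in> transps (n - 1)"
  then obtain l m where lm: "\<tau> = transpose l m" "l \<in> {1..n - 1}" "m \<in> {1..n - 1}" "l \<noteq> m"
    unfolding transps_def by blast
  then have "\<tau> n = n" "l \<in> {1..n}" "m \<in> {1..n}" using \<open>n \<ge> 1\<close> by (auto simp: transpose_def)
  with lm show "\<tau> \<in> {\<tau> \<in> transps n. \<tau> n = n}" unfolding transps_def by blast
qed

lemma sum_Pow_last_split:
  fixes f :: "nat set \<Rightarrow> complex"
  shows "sum f (Pow {1..k + 1}) = sum f (Pow {1..k}) + f {k + 1} + sum f (big_subsets (k + 1) {k + 1})"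
proof -
  have "Pow {1..k + 1} = insert {k + 1} (Pow {1..k} \<union> big_subsets (k + 1) {k + 1})"
  proof (intro set_eqI iffI)
    fix S assume S: "S \<in> Pow {1..k + 1}"
    then have fin: "finite S" using finite_subset by blast
    show "S \<in> insert {k + 1} (Pow {1..k} \<union> big_subsets (k + 1) {k + 1})"
    proof (cases "k + 1 \<in> S")
      case True
      show ?thesis
      proof (cases "card S = 1")
        case True
        with \<open>k + 1 \<in> S\<close> show ?thesis by (auto simp: card_1_singleton_iff)
      next
        case False
        then have "2 \<le> card S" using True fin card_gt_0_iff[of S] by auto
        with True S show ?thesis by (auto simp: big_subsets_def)
      qed
    next
      case False
      with S have "S \<subseteq> {1..k}" by (auto simp: le_Suc_eq)
      then show ?thesis by blast
    qed
  next
    fix S assume "S \<in> insert {k + 1} (Pow {1..k} \<union> big_subsets (k + 1) {k + 1})"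
    then show "S \<in> Pow {1..k + 1}" by (auto simp: big_subsets_def)
  qed
  moreover have "{k + 1} \<notin> Pow {1..k} \<union> big_subsets (k + 1) {k + 1}"
    by (auto simp: big_subsets_def)
  moreover have "sum f (Pow {1..k} \<union> big_subsets (k + 1) {k + 1}) =
      sum f (Pow {1..k}) + sum f (big_subsets (k + 1) {k + 1})"
    by (rule sum.union_disjoint) (auto simp: finite_big_subsets big_subsets_def)
  ultimately show ?thesis
    by (simp add: finite_big_subsets algebra_simps)
qed

text \<open>On words ending in \<open>n\<close>, the sets inside {1..k} reproduce \<open>Z\<close>,
  the set \<open>{k + 1}\<close> contributes 1 - n, and the k pairs containing k + 1 contribute the
  summand \<open>k\<close> of \<open>Z_half\<close>. Moving 1 - n to the other side accounts for the
  additional n - 1.\<close>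

theorem mat_Z_half:
  assumes n: "n \<ge> 1" and w: "w \<in> words n k" and u: "u \<in> words n k"
  shows "mat (k + 1) (Z_half k (of_nat n)) (w @ [n]) (u @ [n]) =
    (\<Sum>\<tau>\<in>transps (n - 1). of_bool (map \<tau> w = u)) +
    (of_nat k * of_nat n + of_nat n - 1 - of_nat (n choose 2)) * of_bool (w = u)"
proof -
  let ?K = "k + 1" and ?L = "label (w @ [n]) (u @ [n])"
  let ?F = "big_subsets ?K {?K}" and ?\<delta> = "of_bool (w = u) :: complex"
  let ?c = "\<lambda>S. (of_nat n - of_nat ?K + of_nat (card S)) * (- 1) ^ card S :: complex"
  note wu = words_append_last[OF w n] words_append_last[OF u n]
  note R = label_in_range[OF wu]
  note last = label_append_last[OF w u]
  have \<delta>: "vert ?L ?K {} = ?\<delta>"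
    using vert_full[OF wu] by simp
  have old: "swap_weight n ?L S * vert ?L ?K S = swap_weight n (label w u) S * vert (label w u) k S"
    if S: "S \<in> Pow {1..k}" for S
  proof -
    have L: "?L (Top l) = label w u (Top l)" "?L (Bot l) = label w u (Bot l)" if "l \<in> {1..k}" for l
      using label_append[OF w u, of "Top l" n] label_append[OF w u, of "Bot l" n] that by simp_all
    have "swap_weight n ?L S = swap_weight n (label w u) S"
      unfolding swap_weight_def using S L
      by (intro arg_cong2[of _ _ _ _ "(*)"] sum.cong prod.cong refl) (auto simp del: label.simps)
    moreover have "{1..?K} - S = insert ?K ({1..k} - S)" using S by auto
    then have "vert ?L ?K S = vert (label w u) k S"
      unfolding vert_def using L last by (simp del: label.simps)
    ultimately show ?thesis by simp
  qed
  have single: "swap_weight n ?L {?K} * vert ?L ?K {?K} = (1 - of_nat n) * ?\<delta>"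
  proof -
    have "vert ?L ?K {?K} = ?\<delta>"
      using vert_remove[of ?K "{?K}" ?K ?L] last \<delta> by (simp del: label.simps)
    with swap_weight_last[OF n last] show ?thesis by simp
  qed
  have big: "(\<Sum>S\<in>?F. swap_weight n ?L S * vert ?L ?K S) =
      (\<Sum>S\<in>?F. p_entry ?L ?K {?K} S + ?c S * b_entry ?L ?K S) + of_nat k * ?\<delta>"
    using sum_swap_weight_big_subsets[OF _ R, of "{?K}"] last
    by (simp only: card_big_subsets_two_last \<delta>) simp
  \<comment> \<open>The final letter \<open>n\<close> has to be preserved, which selects the
    transpositions fixing \<open>n\<close>, that is, those of the smaller symmetric group.\<close>
  have "(\<Sum>\<tau>\<in>transps (n - 1). of_bool (map \<tau> w = u)) =
      (\<Sum>\<tau>\<in>transps n. of_bool (map \<tau> (w @ [n]) = u @ [n]))"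
    unfolding transps_stabilizer[OF n]
    by (subst sum.inter_filter[OF finite_transps]) (auto intro: sum.cong)
  also have "\<dots> = (\<Sum>S\<in>Pow {1..k}. swap_weight n (label w u) S * vert (label w u) k S) +
      (1 - of_nat n) * ?\<delta> +
      ((\<Sum>S\<in>?F. p_entry ?L ?K {?K} S + ?c S * b_entry ?L ?K S) + of_nat k * ?\<delta>)"
    unfolding sum_transps_expansion[OF wu] sum_Pow_last_split single big
    by (simp only: sum.cong[OF refl old])
  also have "(\<Sum>S\<in>Pow {1..k}. swap_weight n (label w u) S * vert (label w u) k S) =
      mat k (Z k (of_nat n)) w u - (of_nat k * of_nat n - of_nat (n choose 2)) * ?\<delta>"
    unfolding mat_Z[OF w u] sum_transps_expansion[OF w u] by simp
  finally have eq: "(\<Sum>\<tau>\<in>transps (n - 1). of_bool (map \<tau> w = u)) =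
      mat k (Z k (of_nat n)) w u - (of_nat k * of_nat n - of_nat (n choose 2)) * ?\<delta> +
      (1 - of_nat n) * ?\<delta> +
      ((\<Sum>S\<in>?F. p_entry ?L ?K {?K} S + ?c S * b_entry ?L ?K S) + of_nat k * ?\<delta>)" .
  have "mat ?K (Z_half k (of_nat n)) (w @ [n]) (u @ [n]) = of_nat k * ?\<delta> + mat k (Z k (of_nat n)) w u +
      (\<Sum>S\<in>?F. p_entry ?L ?K {?K} S + ?c S * b_entry ?L ?K S)"
  proof -
    have F: "{S. S \<subseteq> {1..?K} \<and> ?K \<in> S \<and> 2 \<le> card S} = ?F" by (auto simp: big_subsets_def)
    have "(\<Sum>S\<in>?F. mat ?K (p_tilde k S) (w @ [n]) (u @ [n]) + ?c S * mat ?K (basis (b_diag ?K S)) (w @ [n]) (u @ [n])) =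
        (\<Sum>S\<in>?F. p_entry ?L ?K {?K} S + ?c S * b_entry ?L ?K S)"
    proof (rule sum.cong[OF refl])
      fix S assume "S \<in> ?F"
      then have S: "S \<subseteq> {1..?K}" "S \<noteq> {}" "?K \<in> S" by (auto simp: big_subsets_def)
      show "mat ?K (p_tilde k S) (w @ [n]) (u @ [n]) + ?c S * mat ?K (basis (b_diag ?K S)) (w @ [n]) (u @ [n]) =
          p_entry ?L ?K {?K} S + ?c S * b_entry ?L ?K S"
        unfolding p_tilde_eq_p_gen[OF S(3)] mat_p_gen[OF S(1)] mat_b_diag[OF S(1,2)] ..
    qed
    then show ?thesis
      unfolding Z_half_def F
      by (simp only: mat_add mat_scale mat_sum mat_part_one mat_add_strand[OF w u] \<delta>)
  qed
  with eq show ?thesis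
    by (simp only: algebra_simps)
qed

section \<open>The action on tensor space\<close>

lemma map_transps_words:
  assumes "r \<le> n" "\<tau> \<in> transps r" "w \<in> words n k"
  shows "map \<tau> w \<in> words n k"
proof -
  have "\<tau> permutes {1..r}"
    using assms(2) transps_subset_symm[of r] unfolding symm_def by blast
  then have perm: "\<tau> permutes {1..n}"
    by (rule permutes_subset) (use assms(1) in auto)
  have "\<tau> ` set w \<subseteq> {1..n}"
    using assms(3) permutes_image[OF perm] unfolding words_def by blast
  then show ?thesis
    using assms(3) unfolding words_def by simp
qed

lemma transps_involution: "\<tau> \<in> transps r \<Longrightarrow> \<tau> (\<tau> x) = x"
  unfolding transps_def by auto

lemma map_transps_eq_iff: "\<tau> \<in> transps r \<Longrightarrow> map \<tau> w = u \<longleftrightarrow> w = map \<tau> u"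
proof -
  assume "\<tau> \<in> transps r"
  then have inv: "map \<tau> (map \<tau> x) = x" for x
    by (simp add: transps_involution map_idI)
  show ?thesis
    using inv[of w] inv[of u] by (intro iffI) simp_all
qed

lemma tensor_act_kappa:
  assumes "r \<le> n"
  shows "tensor_act r n k (kappa r) v u =
    (if u \<in> words n k then \<Sum>w\<in>words n k. v w * (\<Sum>\<tau>\<in>transps r. of_bool (map \<tau> w = u)) else 0)"
proof -
  have "tensor_act r n k (kappa r) v u = (\<Sum>\<tau>\<in>transps r. \<Sum>w\<in>words n k. v w * of_bool (map \<tau> w = u))"
    unfolding tensor_act_def symm_act_kappa sum_fun_apply
    by (intro sum.cong[OF refl]) (auto simp: basis_def)
  also have "\<dots> = (\<Sum>w\<in>words n k. v w * (\<Sum>\<tau>\<in>transps r. of_bool (map \<tau> w = u)))"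
    unfolding sum_distrib_left by (rule sum.swap)
  also have "\<dots> = (if u \<in> words n k then \<Sum>w\<in>words n k. v w * (\<Sum>\<tau>\<in>transps r. of_bool (map \<tau> w = u)) else 0)"
  proof (cases "u \<in> words n k")
    case False
    have "of_bool (map \<tau> w = u) = (0::complex)" if "\<tau> \<in> transps r" "w \<in> words n k" for \<tau> w
      using map_transps_words[OF assms that] False by auto
    then have "(\<Sum>w\<in>words n k. v w * (\<Sum>\<tau>\<in>transps r. of_bool (map \<tau> w = u))) = 0"
      by (intro sum.neutral ballI) simp
    then show ?thesis using False by (simp only: if_False)
  qed (simp only: if_True)
  finally show ?thesis .
qed

lemma sum_words_delta: "u \<in> words n k \<Longrightarrow> (\<Sum>w\<in>words n k. v w * (c * of_bool (w = u))) = c * (v u :: complex)"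
proof -
  assume u: "u \<in> words n k"
  have "(\<Sum>w\<in>words n k. v w * (c * of_bool (w = u))) = (\<Sum>w\<in>words n k. if w = u then c * v u else 0)"
    by (rule sum.cong[OF refl]) simp
  then show ?thesis using u by (simp only: sum.delta[OF finite_words] if_True)
qed

theorem diag_act_Z:
  assumes "v \<in> tensor n k"
  shows "diag_act n k v (Z k (of_nat n)) =
    tensor_act n n k (kappa n) v + (- of_nat (n choose 2) + of_nat k * of_nat n) *c v"
proof
  fix u
  show "diag_act n k v (Z k (of_nat n)) u =
    (tensor_act n n k (kappa n) v + (- of_nat (n choose 2) + of_nat k * of_nat n) *c v) u"
  proof (cases "u \<in> words n k")
    case True
    have "diag_act n k v (Z k (of_nat n)) u = (\<Sum>w\<in>words n k. v w * mat k (Z k (of_nat n)) w u)"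
      using True by (simp only: diag_act_mat if_True)
    also have "\<dots> = (\<Sum>w\<in>words n k. v w * (\<Sum>\<tau>\<in>transps n. of_bool (map \<tau> w = u)) +
        v w * ((of_nat k * of_nat n - of_nat (n choose 2)) * of_bool (w = u)))"
      by (rule sum.cong[OF refl]) (simp only: mat_Z[OF _ True] distrib_left)
    also have "\<dots> = tensor_act n n k (kappa n) v u + (of_nat k * of_nat n - of_nat (n choose 2)) * v u"
      using True by (simp only: sum.distrib sum_words_delta tensor_act_kappa[OF order_refl] if_True)
    finally show ?thesis by simp
  next
    case False
    with assms have "v u = 0" by (simp add: tensor_def free_space_def)
    with False show ?thesis by (simp add: diag_act_mat tensor_act_kappa)
  qed
qed

lemma half_diag_act_mat:
  assumes "n \<ge> 1"
  shows "half_diag_act n k v x u =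
    (if u \<in> words n k then \<Sum>w\<in>words n k. v w * mat (k + 1) x (w @ [n]) (u @ [n]) else 0)"
proof -
  have u: "u @ [n] \<in> words n (k + 1) \<longleftrightarrow> u \<in> words n k"
    using assms by (auto simp: words_def)
  have "(\<Sum>w\<in>words n (k + 1). tensor_last n k v w * mat (k + 1) x w (u @ [n])) =
      (\<Sum>w\<in>(\<lambda>w. w @ [n]) ` words n k. tensor_last n k v w * mat (k + 1) x w (u @ [n]))"
  proof (rule sum.mono_neutral_right[OF finite_words])
    show "(\<lambda>w. w @ [n]) ` words n k \<subseteq> words n (k + 1)"
      using words_append_last[OF _ assms] by blast
  qed (simp add: tensor_last_apply)
  also have "\<dots> = (\<Sum>w\<in>words n k. v w * mat (k + 1) x (w @ [n]) (u @ [n]))"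
    by (subst sum.reindex) (auto simp: inj_on_def tensor_last_apply intro: sum.cong)
  finally show ?thesis
    by (simp only: half_diag_act_def diag_act_mat u)
qed

theorem half_diag_act_Z_half:
  assumes n: "n \<ge> 1" and v: "v \<in> tensor n k"
  shows "half_diag_act n k v (Z_half k (of_nat n)) =
    tensor_act (n - 1) n k (kappa (n - 1)) v + (- of_nat (n choose 2) + (of_nat k + 1) * of_nat n - 1) *c v"
proof
  fix u
  show "half_diag_act n k v (Z_half k (of_nat n)) u =
    (tensor_act (n - 1) n k (kappa (n - 1)) v + (- of_nat (n choose 2) + (of_nat k + 1) * of_nat n - 1) *c v) u"
  proof (cases "u \<in> words n k")
    case True
    let ?c = "of_nat k * of_nat n + of_nat n - 1 - of_nat (n choose 2) :: complex"
    have "half_diag_act n k v (Z_half k (of_nat n)) u =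
        (\<Sum>w\<in>words n k. v w * mat (k + 1) (Z_half k (of_nat n)) (w @ [n]) (u @ [n]))"
      using True by (simp only: half_diag_act_mat[OF n] if_True)
    also have "\<dots> = (\<Sum>w\<in>words n k. v w * (\<Sum>\<tau>\<in>transps (n - 1). of_bool (map \<tau> w = u)) +
        v w * (?c * of_bool (w = u)))"
      by (rule sum.cong[OF refl]) (simp only: mat_Z_half[OF n _ True] distrib_left)
    also have "\<dots> = tensor_act (n - 1) n k (kappa (n - 1)) v u + ?c * v u"
      using True by (simp only: sum.distrib sum_words_delta tensor_act_kappa[OF diff_le_self] if_True)
    finally show ?thesis by (simp add: algebra_simps)
  next
    case False
    with v have "v u = 0" by (simp add: tensor_def free_space_def)
    with False show ?thesis by (simp add: half_diag_act_mat[OF n] tensor_act_kappa)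
  qed
qed

section \<open>Centrality\<close>

text \<open>A diagram tests only equalities between labels, and these survive applying the
  involution \<open>\<tau>\<close> to both rows.\<close>

lemma compatible_map_transps:
  assumes "d \<in> diagrams k" "w \<in> words n k" "u \<in> words n k" "\<tau> \<in> transps r"
  shows "compatible d (map \<tau> w) u \<longleftrightarrow> compatible d w (map \<tau> u)"
proof -
  have inj: "\<tau> x = \<tau> y \<longleftrightarrow> x = y" for x y
  proof
    assume "\<tau> x = \<tau> y"
    from arg_cong[OF this, of \<tau>] show "x = y"
      by (simp only: transps_involution[OF assms(4)])
  qed simp
  have lab: "label (map \<tau> w) u r = \<tau> (label w (map \<tau> u) r)" if "r \<in> dbl {1..k}" for r
  proof (cases r)
    case (Top i)
    with that assms(2) show ?thesis by (auto simp: words_def)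
  next
    case (Bot i)
    with that assms(3) show ?thesis by (auto simp: words_def transps_involution[OF assms(4)])
  qed (use that in simp)
  have "const_on (label (map \<tau> w) u) B \<longleftrightarrow> const_on (label w (map \<tau> u)) B" if "B \<in> d" for B
  proof -
    have "B \<subseteq> dbl {1..k}" using that partition_onD1[OF diagramD[OF assms(1)]] by blast
    then have "const_on (label (map \<tau> w) u) B \<longleftrightarrow> const_on (\<tau> \<circ> label w (map \<tau> u)) B"
      using lab by (intro const_on_cong) auto
    then show ?thesis by (simp add: const_on_def inj)
  qed
  then show ?thesis by (simp add: compatible_conv_const_on)
qed

lemma mat_map_transps:
  assumes "w \<in> words n k" "u \<in> words n k" "\<tau> \<in> transps r"
  shows "mat k x (map \<tau> w) u = mat k x w (map \<tau> u)"
  unfolding mat_def by (intro sum.cong[OF refl]) (simp only: compatible_map_transps[OF _ assms])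

text \<open>As transpositions are involutions, the assumption on \<open>M\<close> says that it
  commutes with their permutation matrices; \<open>A\<close> is a sum of these and a scalar.
  \<open>M\<close> is kept abstract so that the lemma applies with \<open>r = n\<close> and, for
  words ending in \<open>n\<close>, with \<open>r = n - 1\<close>.\<close>

lemma transps_matrix_commute:
  fixes M :: "nat list \<Rightarrow> nat list \<Rightarrow> complex" and c :: complex
  assumes r: "r \<le> n" and M: "\<And>w u \<tau>. w \<in> words n k \<Longrightarrow> u \<in> words n k \<Longrightarrow> \<tau> \<in> transps r \<Longrightarrow> M (map \<tau> w) u = M w (map \<tau> u)"
    and wu: "w \<in> words n k" "u \<in> words n k"
  defines "A \<equiv> \<lambda>w u. (\<Sum>\<tau>\<in>transps r. of_bool (map \<tau> w = u)) + c * of_bool (w = u)"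
  shows "(\<Sum>v\<in>words n k. A w v * M v u) = (\<Sum>v\<in>words n k. M w v * A v u)"
proof -
  have pick: "(\<Sum>v\<in>words n k. of_bool (v0 = v) * f v) = f v0" "(\<Sum>v\<in>words n k. f v * of_bool (v = v0)) = f v0"
    if "v0 \<in> words n k" for v0 and f :: "nat list \<Rightarrow> complex"
  proof -
    have "(\<Sum>v\<in>words n k. of_bool (v0 = v) * f v) = (\<Sum>v\<in>words n k. if v0 = v then f v else 0)"
      by (rule sum.cong[OF refl]) simp
    with that show "(\<Sum>v\<in>words n k. of_bool (v0 = v) * f v) = f v0"
      by (simp only: sum.delta'[OF finite_words] if_True)
    have "(\<Sum>v\<in>words n k. f v * of_bool (v = v0)) = (\<Sum>v\<in>words n k. if v = v0 then f v else 0)"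
      by (rule sum.cong[OF refl]) simp
    with that show "(\<Sum>v\<in>words n k. f v * of_bool (v = v0)) = f v0"
      by (simp only: sum.delta[OF finite_words] if_True)
  qed
  note swap = arg_cong2[of _ _ _ _ "(+)", OF sum.swap refl]
  have "(\<Sum>v\<in>words n k. A w v * M v u) =
      (\<Sum>v\<in>words n k. (\<Sum>\<tau>\<in>transps r. of_bool (map \<tau> w = v) * M v u) + c * (of_bool (w = v) * M v u))"
    by (simp only: A_def distrib_right sum_distrib_right mult.assoc)
  also have "\<dots> = (\<Sum>\<tau>\<in>transps r. \<Sum>v\<in>words n k. of_bool (map \<tau> w = v) * M v u) +
      c * (\<Sum>v\<in>words n k. of_bool (w = v) * M v u)"
    unfolding sum.distrib sum_distrib_left by (rule swap)
  also have "\<dots> = (\<Sum>\<tau>\<in>transps r. M (map \<tau> w) u) + c * M w u"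
    by (intro arg_cong2[of _ _ _ _ "(+)"] sum.cong[OF refl] arg_cong[of _ _ "(*) c"] pick
        map_transps_words[OF r] wu)
  also have "(\<Sum>\<tau>\<in>transps r. M (map \<tau> w) u) = (\<Sum>\<tau>\<in>transps r. M w (map \<tau> u))"
    by (intro sum.cong[OF refl] M wu)
  also have "(\<Sum>\<tau>\<in>transps r. M w (map \<tau> u)) + c * M w u =
      (\<Sum>\<tau>\<in>transps r. \<Sum>v\<in>words n k. M w v * of_bool (v = map \<tau> u)) +
      c * (\<Sum>v\<in>words n k. M w v * of_bool (v = u))"
    by (intro arg_cong2[of _ _ _ _ "(+)"] sum.cong[OF refl] arg_cong[of _ _ "(*) c"] pick[symmetric]
        map_transps_words[OF r] wu)
  \<comment> \<open>Here \<open>\<tau>\<close> moves to the other side of the equation because it is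
    its own inverse.\<close>
  also have "(\<Sum>\<tau>\<in>transps r. \<Sum>v\<in>words n k. M w v * of_bool (v = map \<tau> u)) =
      (\<Sum>\<tau>\<in>transps r. \<Sum>v\<in>words n k. M w v * of_bool (map \<tau> v = u))"
    by (rule sum.cong[OF refl]) (simp only: map_transps_eq_iff)
  also have "\<dots> + c * (\<Sum>v\<in>words n k. M w v * of_bool (v = u)) =
      (\<Sum>v\<in>words n k. (\<Sum>\<tau>\<in>transps r. M w v * of_bool (map \<tau> v = u)) + c * (M w v * of_bool (v = u)))"
    unfolding sum.distrib sum_distrib_left by (rule swap)
  also have "\<dots> = (\<Sum>v\<in>words n k. M w v * A v u)"
    by (simp only: A_def distrib_left sum_distrib_left mult.left_commute[of c])
  finally show ?thesis .
qed

lemma mat_Z_commute: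
  assumes "w \<in> words n k" "u \<in> words n k"
  shows "mat k (part_mult (of_nat n) k (Z k (of_nat n)) x) w u =
    mat k (part_mult (of_nat n) k x (Z k (of_nat n))) w u"
  unfolding mat_part_mult[OF assms]
proof -
  define A where "A w u = (\<Sum>\<tau>\<in>transps n. of_bool (map \<tau> w = u)) +
    (of_nat k * of_nat n - of_nat (n choose 2) :: complex) * of_bool (w = u)" for w u
  have A: "mat k (Z k (of_nat n)) w u = A w u" if "w \<in> words n k" "u \<in> words n k" for w u
    unfolding A_def by (rule mat_Z[OF that])
  have "(\<Sum>v\<in>words n k. mat k (Z k (of_nat n)) w v * mat k x v u) = (\<Sum>v\<in>words n k. A w v * mat k x v u)"
    by (rule sum.cong[OF refl]) (simp only: A[OF assms(1)])
  also have "\<dots> = (\<Sum>v\<in>words n k. mat k x w v * A v u)"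
    unfolding A_def by (rule transps_matrix_commute[OF order_refl _ assms]) (rule mat_map_transps)
  also have "\<dots> = (\<Sum>v\<in>words n k. mat k x w v * mat k (Z k (of_nat n)) v u)"
    by (rule sum.cong[OF refl]) (simp only: A[OF _ assms(2)])
  finally show "(\<Sum>v\<in>words n k. mat k (Z k (of_nat n)) w v * mat k x v u) =
    (\<Sum>v\<in>words n k. mat k x w v * mat k (Z k (of_nat n)) v u)" .
qed

lemma mat_half_last:
  assumes "x \<in> half_part_alg k" "w \<in> words n k" "v \<in> words n (k + 1)" "mat (k + 1) x (w @ [n]) v \<noteq> 0"
  shows "v \<in> (\<lambda>w. w @ [n]) ` words n k"
proof -
  obtain d where d: "d \<in> diagrams (k + 1)" "x d \<noteq> 0" "compatible d (w @ [n]) v"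
  proof -
    have "\<exists>d\<in>diagrams (k + 1). x d * of_bool (compatible d (w @ [n]) v) \<noteq> 0"
    proof (rule ccontr)
      assume "\<not> ?thesis"
      then have "mat (k + 1) x (w @ [n]) v = 0"
        unfolding mat_def by (intro sum.neutral) blast
      with assms(4) show False ..
    qed
    then show ?thesis using that by auto
  qed
  then have "d \<in> half_diagrams k"
    using assms(1) by (auto simp: half_part_alg_def free_space_def)
  then obtain B where "B \<in> d" "Top (k + 1) \<in> B" "Bot (k + 1) \<in> B"
    by (auto simp: half_diagrams_def)
  with d(3) have "label (w @ [n]) v (Top (k + 1)) = label (w @ [n]) v (Bot (k + 1))"
    unfolding compatible_def by blast
  then have vk: "v ! k = n" using assms(2) by (simp add: words_def nth_append)
  have len: "length v = k + 1" and set: "set v \<subseteq> {1..n}" using assms(3) by (auto simp: words_def)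
  then have ne: "v \<noteq> []" by auto
  then have "v = butlast v @ [n]"
    using vk len append_butlast_last_id[OF ne] by (simp add: last_conv_nth)
  moreover have "butlast v \<in> words n k"
    using set len by (auto simp: words_def dest: in_set_butlastD)
  ultimately show ?thesis by blast
qed

text \<open>A half diagram forces equal letters at the two ends of column k + 1, so an intermediate
  word with nonzero entry again ends in \<open>n\<close>.\<close>

lemma mat_half_part_mult:
  assumes n: "n \<ge> 1" and x: "x \<in> half_part_alg k" and y: "y \<in> half_part_alg k"
    and wu: "w \<in> words n k" "u \<in> words n k"
  shows "mat (k + 1) (half_part_mult (of_nat n) k x y) (w @ [n]) (u @ [n]) =
    (\<Sum>v\<in>words n k. mat (k + 1) x (w @ [n]) (v @ [n]) * mat (k + 1) y (v @ [n]) (u @ [n]))"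
proof -
  have "mat (k + 1) (half_part_mult (of_nat n) k x y) (w @ [n]) (u @ [n]) =
      (\<Sum>v\<in>words n (k + 1). mat (k + 1) x (w @ [n]) v * mat (k + 1) y v (u @ [n]))"
    unfolding half_part_mult_eq[OF x y]
    by (intro mat_part_mult words_append_last wu n)
  also have "\<dots> = (\<Sum>v\<in>(\<lambda>w. w @ [n]) ` words n k. mat (k + 1) x (w @ [n]) v * mat (k + 1) y v (u @ [n]))"
  proof (rule sum.mono_neutral_right[OF finite_words])
    show "(\<lambda>w. w @ [n]) ` words n k \<subseteq> words n (k + 1)"
      using words_append_last[OF _ n] by blast
  qed (use mat_half_last[OF x wu(1)] in auto)
  also have "\<dots> = (\<Sum>v\<in>words n k. mat (k + 1) x (w @ [n]) (v @ [n]) * mat (k + 1) y (v @ [n]) (u @ [n]))"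
    by (subst sum.reindex) (auto simp: inj_on_def intro: sum.cong)
  finally show ?thesis .
qed

lemma Z_in_part_alg: "Z k n \<in> part_alg k"
proof -
  have "p_elem k S \<in> free_space (diagrams k)" if "S \<subseteq> {1..k}" for S
    unfolding p_elem_eq_p_gen p_gen_def
    by (intro free_space_sum_in free_space_scale basis_in_free_space d_diag_in_diagrams[OF that])
  moreover have "b_diag k S \<in> diagrams k" if "S \<subseteq> {1..k}" "2 \<le> card S" for S
    using that by (intro b_diag_in_diagrams) auto
  ultimately show ?thesis
    unfolding Z_def part_alg_def part_one_def
    by (intro free_space_add free_space_scale free_space_sum_in basis_in_free_space vertical_in_diagrams) auto
qed

lemma Z_half_in_half_part_alg: "Z_half k n \<in> half_part_alg k"
proof -
  have one: "vertical (k + 1) {} \<in> half_diagrams k"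
    using vertical_in_diagrams[of "k + 1"] by (auto simp: half_diagrams_def vertical_def)
  have b: "b_diag (k + 1) S \<in> half_diagrams k" if "S \<subseteq> {1..k + 1}" "k + 1 \<in> S" for S
  proof -
    have "b_diag (k + 1) S \<in> diagrams (k + 1)" using that by (intro b_diag_in_diagrams) auto
    moreover have "dbl S \<in> b_diag (k + 1) S" "Top (k + 1) \<in> dbl S" "Bot (k + 1) \<in> dbl S"
      using that(2) by (auto simp: b_diag_def)
    ultimately show ?thesis unfolding half_diagrams_def by blast
  qed
  have d: "d_diag (k + 1) S I \<in> half_diagrams k"
    if "S \<subseteq> {1..k + 1}" "k + 1 \<in> S" "I \<in> p_range {k + 1} S" for S I
  proof -
    have "{Top (k + 1), Bot (k + 1)} \<subseteq> I \<or> {Top (k + 1), Bot (k + 1)} \<subseteq> dbl S - I"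
      using that(2,3) by (auto simp: p_range_def locked_subsets_def)
    moreover have "I \<in> d_diag (k + 1) S I" "dbl S - I \<in> d_diag (k + 1) S I"
      by (auto simp: d_diag_def)
    ultimately show ?thesis
      unfolding half_diagrams_def using d_diag_in_diagrams[OF that(1,3)] by blast
  qed
  have p: "p_tilde k S \<in> free_space (half_diagrams k)" if "S \<subseteq> {1..k + 1}" "k + 1 \<in> S" for S
    unfolding p_tilde_eq_p_gen[OF that(2)] p_gen_def
    by (intro free_space_sum_in free_space_scale basis_in_free_space d[OF that])
  show ?thesis
    unfolding Z_half_def half_part_alg_def part_one_def add_strand_def
    by (intro free_space_add free_space_scale free_space_sum_in basis_in_free_space one
        insert_strand_in_diagrams b p) auto
qed

lemma mat_Z_half_commute:
  assumes n: "n \<ge> 1" and x: "x \<in> half_part_alg k" and wu: "w \<in> words n k" "u \<in> words n k"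
  shows "mat (k + 1) (half_part_mult (of_nat n) k (Z_half k (of_nat n)) x) (w @ [n]) (u @ [n]) =
    mat (k + 1) (half_part_mult (of_nat n) k x (Z_half k (of_nat n))) (w @ [n]) (u @ [n])"
proof -
  let ?M = "\<lambda>w u. mat (k + 1) x (w @ [n]) (u @ [n])"
  have M: "?M (map \<tau> w) u = ?M w (map \<tau> u)"
    if "w \<in> words n k" "u \<in> words n k" "\<tau> \<in> transps (n - 1)" for w u \<tau>
  proof -
    have "\<tau> n = n" using that(3) transps_stabilizer[OF n] by blast
    then show ?thesis
      using mat_map_transps[OF words_append_last[OF that(1) n] words_append_last[OF that(2) n] that(3), of x]
      by simp
  qed
  define A where "A w u = (\<Sum>\<tau>\<in>transps (n - 1). of_bool (map \<tau> w = u)) +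
    (of_nat k * of_nat n + of_nat n - 1 - of_nat (n choose 2) :: complex) * of_bool (w = u)" for w u
  have A: "mat (k + 1) (Z_half k (of_nat n)) (w @ [n]) (u @ [n]) = A w u"
    if "w \<in> words n k" "u \<in> words n k" for w u
    unfolding A_def by (rule mat_Z_half[OF n that])
  have "mat (k + 1) (half_part_mult (of_nat n) k (Z_half k (of_nat n)) x) (w @ [n]) (u @ [n]) =
      (\<Sum>v\<in>words n k. A w v * ?M v u)"
    unfolding mat_half_part_mult[OF n Z_half_in_half_part_alg x wu]
    by (rule sum.cong[OF refl]) (simp only: A[OF wu(1)])
  also have "\<dots> = (\<Sum>v\<in>words n k. ?M w v * A v u)"
    unfolding A_def by (rule transps_matrix_commute[OF diff_le_self _ wu]) (rule M)
  also have "\<dots> = mat (k + 1) (half_part_mult (of_nat n) k x (Z_half k (of_nat n))) (w @ [n]) (u @ [n])"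
    unfolding mat_half_part_mult[OF n x Z_half_in_half_part_alg wu]
    by (rule sum.cong[OF refl]) (simp only: A[OF _ wu(2)])
  finally show ?thesis .
qed

section \<open>Functions that are polynomial in the parameter\<close>

definition poly_fun :: "(complex \<Rightarrow> complex) \<Rightarrow> bool"
  where "poly_fun f \<longleftrightarrow> f \<in> cfun.span (range (\<lambda>m x. x ^ m))"

lemma poly_fun_power: "poly_fun (\<lambda>x. x ^ m)"
  unfolding poly_fun_def by (rule cfun.span_base) auto

lemma poly_fun_add: "poly_fun f \<Longrightarrow> poly_fun g \<Longrightarrow> poly_fun (\<lambda>x. f x + g x)"
  using cfun.span_add[of f _ g] by (simp add: poly_fun_def plus_fun_def)

lemma poly_fun_diff: "poly_fun f \<Longrightarrow> poly_fun g \<Longrightarrow> poly_fun (\<lambda>x. f x - g x)"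
  using cfun.span_diff[of f _ g] by (simp add: poly_fun_def fun_diff_def)

lemma poly_fun_cmult: "poly_fun f \<Longrightarrow> poly_fun (\<lambda>x. c * f x)"
  using cfun.span_scale[of f _ c] by (simp add: poly_fun_def cscale_def)

lemma poly_fun_const: "poly_fun (\<lambda>x. c)"
  using poly_fun_cmult[OF poly_fun_power[of 0], of c] by simp

lemma poly_fun_id: "poly_fun (\<lambda>x. x)"
  using poly_fun_power[of 1] by simp

lemma poly_fun_sum: "(\<And>a. a \<in> A \<Longrightarrow> poly_fun (f a)) \<Longrightarrow> poly_fun (\<lambda>x. \<Sum>a\<in>A. f a x)"
  by (induction A rule: infinite_finite_induct) (auto intro: poly_fun_add poly_fun_const)

lemma poly_fun_power_mult: "poly_fun f \<Longrightarrow> poly_fun (\<lambda>x. x ^ m * f x)"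
  unfolding poly_fun_def[of f]
proof (induction rule: cfun.span_induct_alt)
  case base
  show ?case using poly_fun_const[of 0] by simp
next
  case (step c g h)
  then obtain i where g: "g = (\<lambda>x. x ^ i)" by auto
  have "(\<lambda>x. x ^ m * (c *c g + h) x) = (\<lambda>x. c * x ^ (m + i) + x ^ m * h x)"
    by (simp add: g fun_eq_iff power_add algebra_simps)
  then show ?case
    using step(2) by (simp only:) (intro poly_fun_add poly_fun_cmult poly_fun_power)
qed

lemma poly_fun_coeffs: "poly_fun f \<Longrightarrow> \<exists>N c. \<forall>x. f x = (\<Sum>i\<le>N. c i * x ^ i)"
  unfolding poly_fun_def
proof (induction rule: cfun.span_induct_alt)
  case base
  show ?case by (intro exI[of _ 0] exI[of _ "\<lambda>_. 0"]) simp
next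
  case (step a g h)
  then obtain m where g: "g = (\<lambda>x. x ^ m)" by auto
  obtain N c where c: "\<And>x. h x = (\<Sum>i\<le>N. c i * x ^ i)" using step(2) by blast
  let ?c = "\<lambda>i. (if i \<le> N then c i else 0) + (if i = m then a else 0)"
  have "(a *c g + h) x = (\<Sum>i\<le>max N m. ?c i * x ^ i)" for x
  proof -
    have "(\<Sum>i\<le>max N m. ?c i * x ^ i) =
        (\<Sum>i\<le>max N m. (if i \<le> N then c i else 0) * x ^ i) + (\<Sum>i\<le>max N m. if i = m then a * x ^ i else 0)"
      unfolding sum.distrib[symmetric] by (intro sum.cong[OF refl]) (auto simp: algebra_simps)
    also have "(\<Sum>i\<le>max N m. if i = m then a * x ^ i else 0) = a * x ^ m"
      by (simp add: sum.delta)
    also have "(\<Sum>i\<le>max N m. (if i \<le> N then c i else 0) * x ^ i) = (\<Sum>i\<le>N. c i * x ^ i)"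
      by (rule sum.mono_neutral_cong_right) auto
    finally show ?thesis by (simp add: g c)
  qed
  then show ?case by (intro exI allI)
qed

text \<open>A nonzero polynomial has only finitely many roots, while here all large integers are
  roots.\<close>

lemma poly_fun_eq_zero:
  assumes "poly_fun f" and "\<And>m. m \<ge> M \<Longrightarrow> f (of_nat m) = 0"
  shows "f x = 0"
proof -
  obtain N c where c: "\<And>x. f x = (\<Sum>i\<le>N. c i * x ^ i)"
    using poly_fun_coeffs[OF assms(1)] by blast
  have "infinite (of_nat ` {M..} :: complex set)"
    by (subst finite_image_iff) (auto simp: inj_on_def infinite_Ici)
  moreover have "of_nat ` {M..} \<subseteq> {x. f x = 0}"
    using assms(2) by auto
  ultimately have "infinite {x. (\<Sum>i\<le>N. c i * x ^ i) = 0}"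
    unfolding c[symmetric] using finite_subset by blast
  then have "\<forall>i\<le>N. c i = 0"
    using polyfun_finite_roots[of c N] by blast
  then show ?thesis
    by (simp add: c)
qed

text \<open>The parameter enters twice: through the structure constants and through the factor
  \<open>X n\<close>, later a central element whose own coefficients depend on
  \<open>n\<close>.\<close>

lemma poly_fun_bilinear_prod:
  assumes "\<And>a. poly_fun (\<lambda>n. X n a)"
  shows "poly_fun (\<lambda>n. bilinear_prod B p (\<lambda>a b. n ^ w a b) (X n) y e)"
    and "poly_fun (\<lambda>n. bilinear_prod B p (\<lambda>a b. n ^ w a b) y (X n) e)"
proof -
  have 1: "bilinear_prod B p (\<lambda>a b. n ^ w a b) (X n) y e =
      (\<Sum>a\<in>B. \<Sum>b\<in>B. (y b * basis (p a b) e) * (n ^ w a b * X n a))" for n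
    by (simp add: bilinear_prod_def sum_fun_apply mult_ac)
  have 2: "bilinear_prod B p (\<lambda>a b. n ^ w a b) y (X n) e =
      (\<Sum>a\<in>B. \<Sum>b\<in>B. (y a * basis (p a b) e) * (n ^ w a b * X n b))" for n
    by (simp add: bilinear_prod_def sum_fun_apply mult_ac)
  show "poly_fun (\<lambda>n. bilinear_prod B p (\<lambda>a b. n ^ w a b) (X n) y e)"
    unfolding 1 by (intro poly_fun_sum poly_fun_cmult poly_fun_power_mult assms)
  show "poly_fun (\<lambda>n. bilinear_prod B p (\<lambda>a b. n ^ w a b) y (X n) e)"
    unfolding 2 by (intro poly_fun_sum poly_fun_cmult poly_fun_power_mult assms)
qed

lemma poly_fun_Z: "poly_fun (\<lambda>n. Z k n a)"
proof -
  have "Z k n a = (of_nat (k choose 2) * part_one k a + (\<Sum>S\<in>{S. S \<subseteq> {1..k} \<and> 1 \<le> card S}. p_elem k S a)) +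
      (\<Sum>S\<in>{S. S \<subseteq> {1..k} \<and> 2 \<le> card S}. ((- 1) ^ card S * basis (b_diag k S) a) * (n + (of_nat (card S) - of_nat k)))" for n
    by (simp add: Z_def sum_fun_apply algebra_simps)
  then show ?thesis
    by (simp only:) (intro poly_fun_add poly_fun_sum poly_fun_cmult poly_fun_id poly_fun_const)
qed

lemma poly_fun_Z_half: "poly_fun (\<lambda>n. Z_half k n a)"
proof -
  have "Z_half k n a = of_nat k * part_one (k + 1) a +
      (\<Sum>d\<in>diagrams k. basis (insert {Top (k + 1), Bot (k + 1)} d) a * Z k n d) +
      (\<Sum>S\<in>{S. S \<subseteq> {1..k + 1} \<and> k + 1 \<in> S \<and> 2 \<le> card S}. p_tilde k S a +
        ((- 1) ^ card S * basis (b_diag (k + 1) S) a) * (n + (of_nat (card S) - of_nat (k + 1))))" for n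
    by (simp add: Z_half_def add_strand_def sum_fun_apply algebra_simps)
  then show ?thesis
    by (simp only:) (intro poly_fun_add poly_fun_sum poly_fun_cmult poly_fun_id poly_fun_const poly_fun_Z)
qed

lemma free_space_diff: "f \<in> free_space B \<Longrightarrow> g \<in> free_space B \<Longrightarrow> f - g \<in> free_space B"
  by (auto simp: free_space_def)

theorem Z_in_center: "Z k n \<in> center (part_alg k) (part_mult n k)"
proof -
  \<comment> \<open>With \<open>x\<close> and the diagram \<open>e\<close> fixed, one coefficient of
    the commutator is a polynomial function of the parameter.\<close>
  have "part_mult n k (Z k n) x e - part_mult n k x (Z k n) e = 0" for x e
  proof (rule poly_fun_eq_zero[where M = "2 * k" and x = n and
        f = "\<lambda>n. part_mult n k (Z k n) x e - part_mult n k x (Z k n) e"])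
    show "poly_fun (\<lambda>n. part_mult n k (Z k n) x e - part_mult n k x (Z k n) e)"
      unfolding part_mult_def by (intro poly_fun_diff poly_fun_bilinear_prod poly_fun_Z)
    fix N :: nat assume N: "2 * k \<le> N"
    let ?D = "part_mult (of_nat N) k (Z k (of_nat N)) x - part_mult (of_nat N) k x (Z k (of_nat N))"
    have "?D \<in> part_alg k"
      using part_mult_in_part_alg free_space_diff unfolding part_alg_def by blast
    then have "?D = 0"
      by (rule mat_eq_zero[OF _ N]) (simp only: mat_diff mat_Z_commute diff_self)
    then show "part_mult (of_nat N) k (Z k (of_nat N)) x e - part_mult (of_nat N) k x (Z k (of_nat N)) e = 0"
      by (auto dest: fun_cong[of _ _ e])
  qed
  then show ?thesis
    unfolding center_def using Z_in_part_alg by (auto simp: fun_eq_iff)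
qed

theorem Z_half_in_center: "Z_half k n \<in> center (half_part_alg k) (half_part_mult n k)"
proof -
  have "half_part_mult n k (Z_half k n) x e - half_part_mult n k x (Z_half k n) e = 0"
    if x: "x \<in> half_part_alg k" for x e
  proof (rule poly_fun_eq_zero[where M = "2 * (k + 1)" and x = n and
        f = "\<lambda>n. half_part_mult n k (Z_half k n) x e - half_part_mult n k x (Z_half k n) e"])
    show "poly_fun (\<lambda>n. half_part_mult n k (Z_half k n) x e - half_part_mult n k x (Z_half k n) e)"
      unfolding half_part_mult_def by (intro poly_fun_diff poly_fun_bilinear_prod poly_fun_Z_half)
    \<comment> \<open>The bound needed for faithfulness is 2 (k + 1) because half diagrams have k +
      1 columns.\<close>
    fix N :: nat assume N: "2 * (k + 1) \<le> N"
    let ?D = "half_part_mult (of_nat N) k (Z_half k (of_nat N)) x - half_part_mult (of_nat N) k x (Z_half k (of_nat N))"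
    have "?D \<in> half_part_alg k"
      using half_part_mult_in_half_part_alg free_space_diff unfolding half_part_alg_def by blast
    moreover have "1 \<le> N" using N by simp
    ultimately have "?D = 0"
      by (intro half_mat_eq_zero[OF _ N]) (simp_all only: mat_diff mat_Z_half_commute[OF _ x] diff_self)
    then show "half_part_mult (of_nat N) k (Z_half k (of_nat N)) x e - half_part_mult (of_nat N) k x (Z_half k (of_nat N)) e = 0"
      by (auto dest: fun_cong[of _ _ e])
  qed
  then show ?thesis
    unfolding center_def using Z_half_in_half_part_alg by (auto simp: fun_eq_iff)
qed

section \<open>The action on multiplicity spaces\<close>

lemma kappa_in_symm_alg: "kappa n \<in> symm_alg n"
  using kappa_in_center[of n] by (simp add: center_def)

text \<open>\<open>\<phi>\<close> intertwines the two actions, so the scalar by which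
  \<open>kappa\<close> acts on the Specht module passes to the image.\<close>

lemma tensor_act_kappa_mult_space:
  assumes "is_partition \<mu> r" "\<phi> \<in> mult_space n k \<mu>" "s \<in> specht \<mu>"
  shows "tensor_act r n k (kappa r) (\<phi> s) = (\<Sum>b\<in>boxes \<mu>. content b) *c \<phi> s"
proof -
  have r: "sum_list \<mu> = r" using assms(1) by (simp add: is_partition_def)
  have "tensor_act r n k (kappa r) (\<phi> s) = \<phi> (specht_act \<mu> (kappa r) s)"
    using assms(2,3) kappa_in_symm_alg[of r] unfolding mult_space_def r by simp
  also have "\<dots> = \<phi> ((\<Sum>b\<in>boxes \<mu>. content b) *c s)"
    by (simp only: specht_act_kappa[OF assms(1,3)])
  also have "\<dots> = (\<Sum>b\<in>boxes \<mu>. content b) *c \<phi> s"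
    using assms(2,3) unfolding mult_space_def by blast
  finally show ?thesis .
qed

lemma mult_space_tensor: "\<phi> \<in> mult_space n k \<mu> \<Longrightarrow> s \<in> specht \<mu> \<Longrightarrow> \<phi> s \<in> tensor n k"
  unfolding mult_space_def by (auto dest: PiE_mem)

theorem mult_space_act_Z:
  assumes "is_partition \<mu> N" "\<phi> \<in> mult_space N k \<mu>"
  shows "mult_space_act N k \<mu> \<phi> (Z k (of_nat N)) =
    mult_space_scale \<mu> (of_nat k * of_nat N - (of_nat N gchoose 2) + (\<Sum>b\<in>boxes \<mu>. content b)) \<phi>"
  unfolding mult_space_act_def mult_space_scale_def
proof (rule restrict_ext)
  fix s assume s: "s \<in> specht \<mu>"
  show "diag_act N k (\<phi> s) (Z k (of_nat N)) =
      (of_nat k * of_nat N - (of_nat N gchoose 2) + (\<Sum>b\<in>boxes \<mu>. content b)) *c \<phi> s"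
    unfolding diag_act_Z[OF mult_space_tensor[OF assms(2) s]] tensor_act_kappa_mult_space[OF assms s]
      cfun.scale_left_distrib[symmetric] binomial_gbinomial
    by (simp add: algebra_simps)
qed

theorem half_mult_space_act_Z_half:
  assumes "N \<ge> 1" "is_partition \<mu> (N - 1)" "\<phi> \<in> mult_space N k \<mu>"
  shows "half_mult_space_act N k \<mu> \<phi> (Z_half k (of_nat N)) =
    mult_space_scale \<mu> (of_nat k * of_nat N + of_nat N - 1 - (of_nat N gchoose 2) + (\<Sum>b\<in>boxes \<mu>. content b)) \<phi>"
  unfolding half_mult_space_act_def mult_space_scale_def
proof (rule restrict_ext)
  fix s assume s: "s \<in> specht \<mu>"
  show "half_diag_act N k (\<phi> s) (Z_half k (of_nat N)) =
      (of_nat k * of_nat N + of_nat N - 1 - (of_nat N gchoose 2) + (\<Sum>b\<in>boxes \<mu>. content b)) *c \<phi> s"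
    unfolding half_diag_act_Z_half[OF assms(1) mult_space_tensor[OF assms(3) s]] tensor_act_kappa_mult_space[OF assms(2,3) s]
      cfun.scale_left_distrib[symmetric] binomial_gbinomial
    by (simp add: algebra_simps)
qed

theorem theorem3p35:
  shows
    "((\<forall>n::nat. kappa n \<in> center (symm_alg n) (symm_mult n)) \<and>
      (\<forall>(n::nat) \<mu>. is_partition \<mu> n \<longrightarrow>
         (\<forall>s\<in>specht \<mu>. specht_act \<mu> (kappa n) s = (\<Sum>b\<in>boxes \<mu>. content b) *c s)))
     \<and>
     ((\<forall>(n::nat) (k::nat). \<forall>v\<in>tensor n k.
         diag_act n k v (Z k (of_nat n)) =
           tensor_act n n k (kappa n) v
           + (- of_nat (n choose 2) + of_nat k * of_nat n) *c v) \<and>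
      (\<forall>(n::nat) (k::nat). n \<ge> 1 \<longrightarrow> (\<forall>v\<in>tensor n k.
         half_diag_act n k v (Z_half k (of_nat n)) =
           tensor_act (n - 1) n k (kappa (n - 1)) v
           + (- of_nat (n choose 2) + (of_nat k + 1) * of_nat n - 1) *c v)))
     \<and>
     (\<forall>(n::complex) (k::nat).
        Z k n \<in> center (part_alg k) (part_mult n k) \<and>
        (semisimple_algebra (part_alg k) (part_mult n k) \<longrightarrow>
          (\<forall>\<mu> (N::nat). n = of_nat N \<and> is_partition \<mu> N \<and> sum_list (tl \<mu>) \<le> k \<longrightarrow>
             (\<forall>\<phi>\<in>mult_space N k \<mu>.
                mult_space_act N k \<mu> \<phi> (Z k n) =
                mult_space_scale \<mu>
                  (of_nat k * n - (n gchoose 2) + (\<Sum>b\<in>boxes \<mu>. content b)) \<phi>))) \<and>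
        Z_half k n \<in> center (half_part_alg k) (half_part_mult n k) \<and>
        (semisimple_algebra (half_part_alg k) (half_part_mult n k) \<longrightarrow>
          (\<forall>\<mu> (N::nat). n = of_nat N \<and> N \<ge> 1 \<and> is_partition \<mu> (N - 1) \<and>
                          sum_list (tl \<mu>) \<le> k \<longrightarrow>
             (\<forall>\<phi>\<in>mult_space N k \<mu>.
                half_mult_space_act N k \<mu> \<phi> (Z_half k n) =
                mult_space_scale \<mu>
                  (of_nat k * n + n - 1 - (n gchoose 2) + (\<Sum>b\<in>boxes \<mu>. content b)) \<phi>))))"
proof (intro conjI allI impI ballI)
  \<comment> \<open>The two statements on multiplicity spaces need the complex parameter replaced by
    the integer \<open>N\<close>; the remaining goals are instances of earlier results.\<close>
  show "mult_space_act N k \<mu> \<phi> (Z k n) = mult_space_scale \<mu>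
      (of_nat k * n - (n gchoose 2) + (\<Sum>b\<in>boxes \<mu>. content b)) \<phi>"
    if "n = of_nat N \<and> is_partition \<mu> N \<and> sum_list (tl \<mu>) \<le> k" "\<phi> \<in> mult_space N k \<mu>"
    for n k \<mu> N \<phi>
    using that mult_space_act_Z[of \<mu> N \<phi> k] by simp
  show "half_mult_space_act N k \<mu> \<phi> (Z_half k n) = mult_space_scale \<mu>
      (of_nat k * n + n - 1 - (n gchoose 2) + (\<Sum>b\<in>boxes \<mu>. content b)) \<phi>"
    if "n = of_nat N \<and> N \<ge> 1 \<and> is_partition \<mu> (N - 1) \<and> sum_list (tl \<mu>) \<le> k"
      "\<phi> \<in> mult_space N k \<mu>"
    for n k \<mu> N \<phi>
    using that half_mult_space_act_Z_half[of N \<mu> \<phi> k] by simp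
qed (rule kappa_in_center specht_act_kappa diag_act_Z half_diag_act_Z_half Z_in_center
  Z_half_in_center; assumption)+

end
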